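(* Let $M$ be a hermitean locally symmetric space and $p\in M$. The Kähler normal potential of $M$ at $p$ takes the form $$\theta_p(X)=g_p\Big(X,\;\frac{\log(\mathrm{id}-\frac14\,\mathrm{ad}^2IX)}{-\frac14\,\mathrm{ad}^2IX}\,X\Big)$$ for $X\in T_pM$ (as a power series in $X$), where $\mathrm{ad}^2IX$ is the endomorphism $A\mapsto R_{IX,A}IX$ of $T_pM$ and the quotient is the power series $\frac{\log(1-u)}{-u}=\sum_{k\ge0}\frac{u^k}{k+1}$ evaluated at $u=\frac14\mathrm{ad}^2IX$.
   Context: A Kähler manifold is a smooth manifold $M$ with a Riemannian metric $g$ and an orthogonal almost complex structure $I$ with $\nabla I=0$ for the Levi-Civita connection $\nabla$. A hermitean locally symmetric space is a Kähler manifold with $\nabla R=0$, where $R_{X,Y}Z=\nabla_X\nabla_YZ-\nabla_Y\nabla_XZ-\nabla_{[X,Y]}Z$. The Kähler form is $\omega(X,Y)=g(IX,Y)$. A local potential is a real function $\theta^{\mathrm{loc}}$ on an open set with $\omega=\frac i2\partial\overline\partial\theta^{\mathrm{loc}}$. $\mathrm{Sym}^{\kappa,\overline\kappa}T_p^*M$ is the space of complex valued polynomials $\eta$ on $T_pM$, homogeneous of degree $\kappa+\overline\kappa$, with $\frac d{dt}|_0\eta(X+tI_pX)=i(\kappa-\overline\kappa)\eta(X)$. $\overline{\mathrm{Sym}}^{\ge(2,2)}T_p^*M$ is the space of real formal power series on $T_pM$ all of whose bihomogeneous components have $\kappa,\overline\kappa\ge2$. Anchored coordinates centered in $p$ are a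 smooth map $\varphi$ from a neighborhood of $0\in T_pM$ to $M$, diffeomorphic onto a neighborhood of $p$, with $\varphi(0)=p$ and differential $\mathrm{id}_{T_pM}$ at $0$. Kähler normal coordinates (Bochner): there are unique (as germs) anchored coordinates $\mathrm{knc}_p$ centered in $p$, holomorphic with respect to $I_p$ on $T_pM$ and $I$ on $M$, and a unique local potential $\theta_p^{\mathrm{loc}}$ near $p$ such that the Taylor series $\theta_p$ of $\theta_p^{\mathrm{loc}}\circ\mathrm{knc}_p$ in $0$ satisfies $\theta_p(X)\equiv g_p(X,X)$ modulo $\overline{\mathrm{Sym}}^{\ge(2,2)}T_p^*M$. This $\theta_p$ is the Kähler normal potential. *)

theory Defs
  imports "HOL-Analysis.Analysis" "HOL-Library.Function_Algebras"
begin

text \<open>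
  Function spaces are real vector spaces under the pointwise operations; tangent spaces are
  realised below as subspaces of such function spaces.
\<close>

instantiation "fun" :: (type, real_vector) real_vector
begin

definition scaleR_fun :: "real \<Rightarrow> ('a \<Rightarrow> 'b) \<Rightarrow> 'a \<Rightarrow> 'b"
  where "scaleR_fun a f = (\<lambda>x. a *\<^sub>R f x)"

instance
  by standard (auto simp: scaleR_fun_def fun_eq_iff scaleR_add_right scaleR_add_left)

end


section \<open>Smooth functions on open subsets of normed spaces\<close>

primrec C_times_on :: "nat \<Rightarrow> 'a::real_normed_vector set \<Rightarrow> ('a \<Rightarrow> 'b::real_normed_vector) \<Rightarrow> bool" where
  "C_times_on 0 S f \<longleftrightarrow> continuous_on S f"
| "C_times_on (Suc n) S f \<longleftrightarrow> (\<forall>x\<in>S. f differentiable (at x)) \<and>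
     (\<forall>v. C_times_on n S (\<lambda>x. frechet_derivative f (at x) v))"

definition smooth_on :: "'a::real_normed_vector set \<Rightarrow> ('a \<Rightarrow> 'b::real_normed_vector) \<Rightarrow> bool" where
  "smooth_on S f \<longleftrightarrow> open S \<and> (\<forall>n. C_times_on n S f)"


section \<open>Smooth manifolds\<close>

text \<open>
  A chart is a pair of its domain and its coordinate map.  A manifold is given by an atlas; its
  underlying space is the union of the chart domains.  The atlas need not be maximal.
\<close>

type_synonym ('m, 'e) chart = "'m set \<times> ('m \<Rightarrow> 'e)"

definition chart_inv :: "('m, 'e) chart \<Rightarrow> 'e \<Rightarrow> 'm" where
  "chart_inv c = inv_into (fst c) (snd c)"

definition is_chart :: "('m::topological_space, 'e::euclidean_space) chart \<Rightarrow> bool" where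
  "is_chart c \<longleftrightarrow> open (fst c) \<and> open (snd c ` fst c) \<and>
     homeomorphism (fst c) (snd c ` fst c) (snd c) (chart_inv c)"

definition compatible :: "('m, 'e::euclidean_space) chart \<Rightarrow> ('m, 'e) chart \<Rightarrow> bool" where
  "compatible c c' \<longleftrightarrow>
     smooth_on (snd c ` (fst c \<inter> fst c')) (snd c' \<circ> chart_inv c) \<and>
     smooth_on (snd c' ` (fst c \<inter> fst c')) (snd c \<circ> chart_inv c')"

definition points :: "('m, 'e) chart set \<Rightarrow> 'm set" where
  "points A = (\<Union>c\<in>A. fst c)"

definition charts_at :: "('m, 'e) chart set \<Rightarrow> 'm \<Rightarrow> ('m, 'e) chart set" where
  "charts_at A p = {c \<in> A. p \<in> fst c}"

locale smooth_manifold =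
  fixes A :: "('m::{t2_space,second_countable_topology}, 'e::euclidean_space) chart set"
  assumes is_chart: "c \<in> A \<Longrightarrow> is_chart c"
    and compatible: "c \<in> A \<Longrightarrow> c' \<in> A \<Longrightarrow> compatible c c'"

text \<open>
  A tangent vector at \<open>p\<close> is a family of coordinate vectors, one for each chart of the atlas
  around \<open>p\<close>, related by the differentials of the transition maps (and extended by 0).
\<close>

type_synonym ('m, 'e) tangent = "('m, 'e) chart \<Rightarrow> 'e"

definition tangent_space ::
    "('m, 'e::euclidean_space) chart set \<Rightarrow> 'm \<Rightarrow> ('m, 'e) tangent set" where
  "tangent_space A p = {v.
     (\<forall>c. c \<notin> charts_at A p \<longrightarrow> v c = 0) \<and>
     (\<forall>c\<in>charts_at A p. \<forall>c'\<in>charts_at A p.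
        v c' = frechet_derivative (snd c' \<circ> chart_inv c) (at (snd c p)) (v c))}"

definition velocity ::
    "('m, 'e::euclidean_space) chart set \<Rightarrow> (real \<Rightarrow> 'm) \<Rightarrow> ('m, 'e) tangent" where
  "velocity A \<gamma> = (\<lambda>c. if c \<in> charts_at A (\<gamma> 0)
     then vector_derivative (\<lambda>t. snd c (\<gamma> t)) (at 0) else 0)"

definition smooth_function ::
    "('m::topological_space, 'e::euclidean_space) chart set \<Rightarrow> 'm set \<Rightarrow>
     ('m \<Rightarrow> 'b::real_normed_vector) \<Rightarrow> bool" where
  "smooth_function A U f \<longleftrightarrow> open U \<and> U \<subseteq> points A \<and>
     (\<forall>c\<in>A. smooth_on (snd c ` (U \<inter> fst c)) (f \<circ> chart_inv c))"

type_synonym ('m, 'e) field = "'m \<Rightarrow> ('m, 'e) tangent"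

definition smooth_field ::
    "('m::topological_space, 'e::euclidean_space) chart set \<Rightarrow> 'm set \<Rightarrow> ('m, 'e) field \<Rightarrow> bool" where
  "smooth_field A U X \<longleftrightarrow> open U \<and> U \<subseteq> points A \<and> (\<forall>q\<in>U. X q \<in> tangent_space A q) \<and>
     (\<forall>c\<in>A. smooth_on (snd c ` (U \<inter> fst c)) (\<lambda>x. X (chart_inv c x) c))"

text \<open>
  The derivative of a function along a tangent vector; for functions that are smooth near \<open>p\<close>
  it does not depend on the chart used to compute it.
\<close>

definition dir_deriv ::
    "('m, 'e::euclidean_space) chart set \<Rightarrow> 'm \<Rightarrow> ('m, 'e) tangent \<Rightarrow>
     ('m \<Rightarrow> 'b::real_normed_vector) \<Rightarrow> 'b" where
  "dir_deriv A p v f = (let c = (SOME c. c \<in> charts_at A p) in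
     frechet_derivative (f \<circ> chart_inv c) (at (snd c p)) (v c))"

definition lie_bracket ::
    "('m, 'e::euclidean_space) chart set \<Rightarrow> ('m, 'e) field \<Rightarrow> ('m, 'e) field \<Rightarrow> ('m, 'e) field" where
  "lie_bracket A X Y = (\<lambda>q c. if c \<in> charts_at A q then
      frechet_derivative (\<lambda>x. Y (chart_inv c x) c) (at (snd c q)) (X q c)
    - frechet_derivative (\<lambda>x. X (chart_inv c x) c) (at (snd c q)) (Y q c) else 0)"


section \<open>Riemannian metrics, the Levi-Civita connection and curvature\<close>

locale riemannian_manifold = smooth_manifold A
  for A :: "('m::{t2_space,second_countable_topology}, 'e::euclidean_space) chart set" +
  fixes g :: "'m \<Rightarrow> ('m, 'e) tangent \<Rightarrow> ('m, 'e) tangent \<Rightarrow> real"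
  assumes metric_sym: "\<lbrakk>p \<in> points A; u \<in> tangent_space A p; v \<in> tangent_space A p\<rbrakk>
      \<Longrightarrow> g p u v = g p v u"
    and metric_add: "\<lbrakk>p \<in> points A; u \<in> tangent_space A p; v \<in> tangent_space A p;
        w \<in> tangent_space A p\<rbrakk> \<Longrightarrow> g p (u + v) w = g p u w + g p v w"
    and metric_scale: "\<lbrakk>p \<in> points A; u \<in> tangent_space A p; v \<in> tangent_space A p\<rbrakk>
      \<Longrightarrow> g p (a *\<^sub>R u) v = a * g p u v"
    and metric_pos: "\<lbrakk>p \<in> points A; u \<in> tangent_space A p; u \<noteq> 0\<rbrakk> \<Longrightarrow> g p u u > 0"
    and metric_smooth: "\<lbrakk>smooth_field A U X; smooth_field A U Y\<rbrakk>
      \<Longrightarrow> smooth_function A U (\<lambda>q. g q (X q) (Y q))"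

text \<open>
  A connection \<open>\<nabla>\<close> acts on vector fields that are defined and smooth on an open set
  (\<open>nabla p v Y\<close> stands for \<open>\<nabla>\<^sub>v Y\<close> with \<open>v\<close> tangent at \<open>p\<close>); since fields
  are total functions, locality has to be required explicitly.
\<close>

locale affine_connection = smooth_manifold A
  for A :: "('m::{t2_space,second_countable_topology}, 'e::euclidean_space) chart set" +
  fixes nabla :: "'m \<Rightarrow> ('m, 'e) tangent \<Rightarrow> ('m, 'e) field \<Rightarrow> ('m, 'e) tangent"
  assumes nabla_local: "\<lbrakk>smooth_field A U Y; smooth_field A U Z; p \<in> U; v \<in> tangent_space A p;
        \<And>q. q \<in> U \<Longrightarrow> Y q = Z q\<rbrakk> \<Longrightarrow> nabla p v Y = nabla p v Z"
    and nabla_add_vec: "\<lbrakk>smooth_field A U Y; p \<in> U; v \<in> tangent_space A p; w \<in> tangent_space A p\<rbrakk>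
      \<Longrightarrow> nabla p (v + w) Y = nabla p v Y + nabla p w Y"
    and nabla_scale_vec: "\<lbrakk>smooth_field A U Y; p \<in> U; v \<in> tangent_space A p\<rbrakk>
      \<Longrightarrow> nabla p (a *\<^sub>R v) Y = a *\<^sub>R nabla p v Y"
    and nabla_add_field: "\<lbrakk>smooth_field A U Y; smooth_field A U Z; p \<in> U; v \<in> tangent_space A p\<rbrakk>
      \<Longrightarrow> nabla p v (\<lambda>q. Y q + Z q) = nabla p v Y + nabla p v Z"
    and nabla_leibniz: "\<lbrakk>smooth_function A U f; smooth_field A U Y; p \<in> U; v \<in> tangent_space A p\<rbrakk>
      \<Longrightarrow> nabla p v (\<lambda>q. f q *\<^sub>R Y q) = dir_deriv A p v f *\<^sub>R Y p + f p *\<^sub>R nabla p v Y"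
    and nabla_smooth: "\<lbrakk>smooth_field A U X; smooth_field A U Y\<rbrakk>
      \<Longrightarrow> smooth_field A U (\<lambda>q. nabla q (X q) Y)"

locale levi_civita = riemannian_manifold A g + affine_connection A nabla
  for A :: "('m::{t2_space,second_countable_topology}, 'e::euclidean_space) chart set"
    and g nabla +
  assumes nabla_metric: "\<lbrakk>smooth_field A U Y; smooth_field A U Z; p \<in> U; v \<in> tangent_space A p\<rbrakk>
      \<Longrightarrow> dir_deriv A p v (\<lambda>q. g q (Y q) (Z q)) = g p (nabla p v Y) (Z p) + g p (Y p) (nabla p v Z)"
    and nabla_torsion_free: "\<lbrakk>smooth_field A U X; smooth_field A U Y; p \<in> U\<rbrakk>
      \<Longrightarrow> nabla p (X p) Y - nabla p (Y p) X = lie_bracket A X Y p"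

definition curvature_field ::
    "('m, 'e::euclidean_space) chart set \<Rightarrow> ('m \<Rightarrow> ('m, 'e) tangent \<Rightarrow> ('m, 'e) field \<Rightarrow> ('m, 'e) tangent) \<Rightarrow>
     ('m, 'e) field \<Rightarrow> ('m, 'e) field \<Rightarrow> ('m, 'e) field \<Rightarrow> ('m, 'e) field" where
  "curvature_field A nabla X Y Z = (\<lambda>q.
      nabla q (X q) (\<lambda>r. nabla r (Y r) Z)
    - nabla q (Y q) (\<lambda>r. nabla r (X r) Z)
    - nabla q (lie_bracket A X Y q) Z)"

text \<open>
  For an affine connection the value of \<open>curvature_field\<close> at \<open>p\<close> only depends on the values of
  the fields at \<open>p\<close>, so that it defines a tensor on the tangent space.
\<close>

definition curvature ::
    "('m::topological_space, 'e::euclidean_space) chart set \<Rightarrow>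
     ('m \<Rightarrow> ('m, 'e) tangent \<Rightarrow> ('m, 'e) field \<Rightarrow> ('m, 'e) tangent) \<Rightarrow>
     'm \<Rightarrow> ('m, 'e) tangent \<Rightarrow> ('m, 'e) tangent \<Rightarrow> ('m, 'e) tangent \<Rightarrow> ('m, 'e) tangent" where
  "curvature A nabla p u v w = (THE r. \<forall>U X Y Z.
     p \<in> U \<and> smooth_field A U X \<and> smooth_field A U Y \<and> smooth_field A U Z \<and>
     X p = u \<and> Y p = v \<and> Z p = w \<longrightarrow> r = curvature_field A nabla X Y Z p)"

definition ad_sq ::
    "('m::topological_space, 'e::euclidean_space) chart set \<Rightarrow>
     ('m \<Rightarrow> ('m, 'e) tangent \<Rightarrow> ('m, 'e) field \<Rightarrow> ('m, 'e) tangent) \<Rightarrow>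
     'm \<Rightarrow> ('m, 'e) tangent \<Rightarrow> ('m, 'e) tangent \<Rightarrow> ('m, 'e) tangent" where
  "ad_sq A nabla p Y B = curvature A nabla p Y B Y"


section \<open>Kaehler manifolds and hermitean locally symmetric spaces\<close>

locale kaehler_manifold = levi_civita A g nabla
  for A :: "('m::{t2_space,second_countable_topology}, 'e::euclidean_space) chart set"
    and g nabla +
  fixes I :: "'m \<Rightarrow> ('m, 'e) tangent \<Rightarrow> ('m, 'e) tangent"
  assumes I_tangent: "\<lbrakk>p \<in> points A; v \<in> tangent_space A p\<rbrakk> \<Longrightarrow> I p v \<in> tangent_space A p"
    and I_add: "\<lbrakk>p \<in> points A; v \<in> tangent_space A p; w \<in> tangent_space A p\<rbrakk>
      \<Longrightarrow> I p (v + w) = I p v + I p w"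
    and I_scale: "\<lbrakk>p \<in> points A; v \<in> tangent_space A p\<rbrakk> \<Longrightarrow> I p (a *\<^sub>R v) = a *\<^sub>R I p v"
    and I_smooth: "smooth_field A U X \<Longrightarrow> smooth_field A U (\<lambda>q. I q (X q))"
    and I_square: "\<lbrakk>p \<in> points A; v \<in> tangent_space A p\<rbrakk> \<Longrightarrow> I p (I p v) = - v"
    and I_orthogonal: "\<lbrakk>p \<in> points A; v \<in> tangent_space A p; w \<in> tangent_space A p\<rbrakk>
      \<Longrightarrow> g p (I p v) (I p w) = g p v w"
    and I_parallel: "\<lbrakk>smooth_field A U Y; p \<in> U; v \<in> tangent_space A p\<rbrakk>
      \<Longrightarrow> nabla p v (\<lambda>q. I q (Y q)) = I p (nabla p v Y)"

locale hermitean_locally_symmetric_space = kaehler_manifold A g nabla I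
  for A :: "('m::{t2_space,second_countable_topology}, 'e::euclidean_space) chart set"
    and g nabla I +
  assumes curvature_parallel:
    "\<lbrakk>smooth_field A U W; smooth_field A U X; smooth_field A U Y; smooth_field A U Z; p \<in> U\<rbrakk> \<Longrightarrow>
       nabla p (W p) (curvature_field A nabla X Y Z) =
         curvature_field A nabla (\<lambda>q. nabla q (W q) X) Y Z p
       + curvature_field A nabla X (\<lambda>q. nabla q (W q) Y) Z p
       + curvature_field A nabla X Y (\<lambda>q. nabla q (W q) Z) p"


section \<open>Local potentials\<close>

definition kaehler_form ::
    "('m \<Rightarrow> ('m, 'e) tangent \<Rightarrow> ('m, 'e) tangent \<Rightarrow> real) \<Rightarrow> ('m \<Rightarrow> ('m, 'e) tangent \<Rightarrow> ('m, 'e) tangent) \<Rightarrow>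
     'm \<Rightarrow> ('m, 'e) tangent \<Rightarrow> ('m, 'e) tangent \<Rightarrow> real" where
  "kaehler_form g I p u v = g p (I p u) v"

definition exterior_deriv ::
    "('m, 'e::euclidean_space) chart set \<Rightarrow> ('m \<Rightarrow> ('m, 'e) tangent \<Rightarrow> complex) \<Rightarrow>
     ('m, 'e) field \<Rightarrow> ('m, 'e) field \<Rightarrow> 'm \<Rightarrow> complex" where
  "exterior_deriv A \<alpha> X Y q =
      dir_deriv A q (X q) (\<lambda>r. \<alpha> r (Y r)) - dir_deriv A q (Y q) (\<lambda>r. \<alpha> r (X r))
    - \<alpha> q (lie_bracket A X Y q)"

text \<open>The (0,1)-part of the differential of a real function.\<close>

definition del_bar ::
    "('m, 'e::euclidean_space) chart set \<Rightarrow> ('m \<Rightarrow> ('m, 'e) tangent \<Rightarrow> ('m, 'e) tangent) \<Rightarrow>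
     ('m \<Rightarrow> real) \<Rightarrow> 'm \<Rightarrow> ('m, 'e) tangent \<Rightarrow> complex" where
  "del_bar A I \<theta> q v =
     (complex_of_real (dir_deriv A q v \<theta>) + \<i> * complex_of_real (dir_deriv A q (I q v) \<theta>)) / 2"

text \<open>
  On forms of type (0,1) the operator \<open>\<partial>\<close> is the (1,1)-part of the exterior derivative, and the
  (1,1)-part of a 2-form \<open>\<beta>\<close> is \<open>(\<beta>(X,Y) + \<beta>(IX,IY)) / 2\<close>.
\<close>

definition del_del_bar ::
    "('m, 'e::euclidean_space) chart set \<Rightarrow> ('m \<Rightarrow> ('m, 'e) tangent \<Rightarrow> ('m, 'e) tangent) \<Rightarrow>
     ('m \<Rightarrow> real) \<Rightarrow> ('m, 'e) field \<Rightarrow> ('m, 'e) field \<Rightarrow> 'm \<Rightarrow> complex" where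
  "del_del_bar A I \<theta> X Y q =
     (exterior_deriv A (del_bar A I \<theta>) X Y q
      + exterior_deriv A (del_bar A I \<theta>) (\<lambda>r. I r (X r)) (\<lambda>r. I r (Y r)) q) / 2"

definition local_potential ::
    "('m::topological_space, 'e::euclidean_space) chart set \<Rightarrow>
     ('m \<Rightarrow> ('m, 'e) tangent \<Rightarrow> ('m, 'e) tangent \<Rightarrow> real) \<Rightarrow>
     ('m \<Rightarrow> ('m, 'e) tangent \<Rightarrow> ('m, 'e) tangent) \<Rightarrow> 'm set \<Rightarrow> ('m \<Rightarrow> real) \<Rightarrow> bool" where
  "local_potential A g I V \<theta> \<longleftrightarrow> smooth_function A V \<theta> \<and>
     (\<forall>U X Y. U \<subseteq> V \<and> smooth_field A U X \<and> smooth_field A U Y \<longrightarrow>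
        (\<forall>q\<in>U. complex_of_real (kaehler_form g I q (X q) (Y q)) = \<i> / 2 * del_del_bar A I \<theta> X Y q))"


section \<open>Polynomials and power series on tangent spaces\<close>

text \<open>
  Frames, i.e. linear isomorphisms from the model space onto a tangent space, are used to speak
  about polynomials and smooth maps on the tangent space.
\<close>

definition tangent_frame ::
    "('m, 'e::euclidean_space) chart set \<Rightarrow> 'm \<Rightarrow> ('e \<Rightarrow> ('m, 'e) tangent) \<Rightarrow> bool" where
  "tangent_frame A p L \<longleftrightarrow> linear L \<and> inj L \<and> range L = tangent_space A p"

definition Sym ::
    "('m, 'e::euclidean_space) chart set \<Rightarrow> ('m \<Rightarrow> ('m, 'e) tangent \<Rightarrow> ('m, 'e) tangent) \<Rightarrow> 'm \<Rightarrow>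
     nat \<Rightarrow> nat \<Rightarrow> (('m, 'e) tangent \<Rightarrow> complex) set" where
  "Sym A I p k l = {\<eta>.
     (\<forall>L. tangent_frame A p L \<longrightarrow> polynomial_function (\<eta> \<circ> L)) \<and>
     (\<forall>X\<in>tangent_space A p. \<forall>t. \<eta> (t *\<^sub>R X) = of_real t ^ (k + l) * \<eta> X) \<and>
     (\<forall>X\<in>tangent_space A p.
        ((\<lambda>t. \<eta> (X + t *\<^sub>R I p X)) has_vector_derivative \<i> * (of_nat k - of_nat l) * \<eta> X) (at 0))}"

text \<open>
  A formal power series on the tangent space is the sequence of its homogeneous components.
  A component of degree \<open>m\<close> is the sum of its bihomogeneous components of bidegree
  \<open>(k, l)\<close> with \<open>k + l = m\<close>.
\<close>

definition Sym_ge22 ::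
    "('m, 'e::euclidean_space) chart set \<Rightarrow> ('m \<Rightarrow> ('m, 'e) tangent \<Rightarrow> ('m, 'e) tangent) \<Rightarrow> 'm \<Rightarrow>
     (nat \<Rightarrow> ('m, 'e) tangent \<Rightarrow> real) set" where
  "Sym_ge22 A I p = {\<eta>. \<forall>m. \<exists>\<beta>. (\<forall>k l. \<beta> k l \<in> Sym A I p k l) \<and>
     (\<forall>X\<in>tangent_space A p. complex_of_real (\<eta> m X) =
        (\<Sum>(k, l) | k + l = m \<and> 2 \<le> k \<and> 2 \<le> l. \<beta> k l X))}"

definition taylor_series :: "('v::real_vector \<Rightarrow> real) \<Rightarrow> nat \<Rightarrow> 'v \<Rightarrow> real" where
  "taylor_series f m X = (deriv ^^ m) (\<lambda>t::real. f (t *\<^sub>R X)) 0 / fact m"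


section \<open>Kaehler normal coordinates and the Kaehler normal potential\<close>

text \<open>
  That \<open>\<phi>\<close> maps an open neighbourhood \<open>W\<close> of 0 in the tangent space diffeomorphically onto an
  open subset of the manifold is expressed by saying that, after the choice of a frame, its
  inverse is a chart compatible with the atlas.
\<close>

definition anchored_coordinates ::
    "('m::topological_space, 'e::euclidean_space) chart set \<Rightarrow> 'm \<Rightarrow> ('m, 'e) tangent set \<Rightarrow>
     (('m, 'e) tangent \<Rightarrow> 'm) \<Rightarrow> bool" where
  "anchored_coordinates A p W \<phi> \<longleftrightarrow>
     W \<subseteq> tangent_space A p \<and> 0 \<in> W \<and> inj_on \<phi> W \<and> \<phi> ` W \<subseteq> points A \<and>
     (\<exists>L. tangent_frame A p L \<and>
        (let c = (\<phi> ` W, inv L \<circ> inv_into W \<phi>) in is_chart c \<and> (\<forall>c'\<in>A. compatible c c'))) \<and>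
     \<phi> 0 = p \<and>
     (\<forall>X\<in>tangent_space A p. velocity A (\<lambda>t. \<phi> (t *\<^sub>R X)) = X)"

definition holomorphic_coordinates ::
    "('m::topological_space, 'e::euclidean_space) chart set \<Rightarrow>
     ('m \<Rightarrow> ('m, 'e) tangent \<Rightarrow> ('m, 'e) tangent) \<Rightarrow> 'm \<Rightarrow> ('m, 'e) tangent set \<Rightarrow>
     (('m, 'e) tangent \<Rightarrow> 'm) \<Rightarrow> bool" where
  "holomorphic_coordinates A I p W \<phi> \<longleftrightarrow> (\<forall>X\<in>W. \<forall>B\<in>tangent_space A p.
     velocity A (\<lambda>t. \<phi> (X + t *\<^sub>R I p B)) = I (\<phi> X) (velocity A (\<lambda>t. \<phi> (X + t *\<^sub>R B))))"

text \<open>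
  Kaehler normal coordinates are a pair of coordinates and a local potential; by Bochner both
  exist and are unique as germs.
\<close>

definition kaehler_normal_coordinates ::
    "('m::topological_space, 'e::euclidean_space) chart set \<Rightarrow>
     ('m \<Rightarrow> ('m, 'e) tangent \<Rightarrow> ('m, 'e) tangent \<Rightarrow> real) \<Rightarrow>
     ('m \<Rightarrow> ('m, 'e) tangent \<Rightarrow> ('m, 'e) tangent) \<Rightarrow> 'm \<Rightarrow>
     ('m, 'e) tangent set \<Rightarrow> (('m, 'e) tangent \<Rightarrow> 'm) \<Rightarrow> 'm set \<Rightarrow> ('m \<Rightarrow> real) \<Rightarrow> bool" where
  "kaehler_normal_coordinates A g I p W knc V \<theta> \<longleftrightarrow>
     anchored_coordinates A p W knc \<and> holomorphic_coordinates A I p W knc \<and>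
     p \<in> V \<and> local_potential A g I V \<theta> \<and>
     (\<lambda>m X. taylor_series (\<theta> \<circ> knc) m X - (if m = 2 then g p X X else 0)) \<in> Sym_ge22 A I p"

definition kaehler_normal_potential ::
    "('m::topological_space, 'e::euclidean_space) chart set \<Rightarrow>
     ('m \<Rightarrow> ('m, 'e) tangent \<Rightarrow> ('m, 'e) tangent \<Rightarrow> real) \<Rightarrow>
     ('m \<Rightarrow> ('m, 'e) tangent \<Rightarrow> ('m, 'e) tangent) \<Rightarrow> 'm \<Rightarrow>
     (nat \<Rightarrow> ('m, 'e) tangent \<Rightarrow> real) \<Rightarrow> bool" where
  "kaehler_normal_potential A g I p \<Theta> \<longleftrightarrow>
     (\<exists>W knc V \<theta>. kaehler_normal_coordinates A g I p W knc V \<theta> \<and>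
        (\<forall>m. \<forall>X\<in>tangent_space A p. \<Theta> m X = taylor_series (\<theta> \<circ> knc) m X))"

text \<open>
  The formal power series \<open>X \<mapsto> g\<^sub>p(X, (log(1 - u) / (- u)) X)\<close>, where
  \<open>u = ad\<^sup>2 IX / 4\<close> and \<open>log(1 - u) / (- u) = (\<Sum>k. u^k / (k + 1))\<close>.
  As \<open>u\<close> is homogeneous of degree 2 in \<open>X\<close>, the summand of index \<open>k\<close> is homogeneous of
  degree \<open>2 * k + 2\<close>; the sum below thus has at most one summand.
\<close>

definition log_potential ::
    "('m::topological_space, 'e::euclidean_space) chart set \<Rightarrow>
     ('m \<Rightarrow> ('m, 'e) tangent \<Rightarrow> ('m, 'e) tangent \<Rightarrow> real) \<Rightarrow>
     ('m \<Rightarrow> ('m, 'e) tangent \<Rightarrow> ('m, 'e) field \<Rightarrow> ('m, 'e) tangent) \<Rightarrow>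
     ('m \<Rightarrow> ('m, 'e) tangent \<Rightarrow> ('m, 'e) tangent) \<Rightarrow> 'm \<Rightarrow> nat \<Rightarrow> ('m, 'e) tangent \<Rightarrow> real" where
  "log_potential A g nabla I p m X = (\<Sum>k | 2 * k + 2 = m.
     g p X ((1 / real (k + 1)) *\<^sub>R ((\<lambda>B. (1 / 4) *\<^sub>R ad_sq A nabla p (I p X) B) ^^ k) X))"

end

theory Submission
  imports Defs
begin

text \<open>
  In Kaehler normal coordinates all fields live on a neighbourhood of 0 in a vector space with
  complex structure \<open>J\<close>; write \<open>P\<close> and \<open>Q\<close> for the (1,0)- and (0,1)-derivatives and \<open>{a b c}\<close> for the
  (1,1)-part of the curvature at 0, complex linear in \<open>a\<close>, \<open>c\<close> and conjugate linear in \<open>b\<close>.  Let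
  \<open>Z\<close> be half the gradient of the potential with respect to the constant metric at 0.  The
  normalisation of the potential says that the jets of \<open>Z\<close> and of \<open>x \<mapsto> Z x - x\<close> contain no pure
  \<open>Q\<close>-words and no pure \<open>P\<close>-words, respectively.
  
  Parallelity of the curvature turns the differences \<open>\<Omega>\<close>, \<open>\<Theta>\<close>, \<open>\<Psi>\<close> below into solutions of a closed
  homogeneous linear first order system for \<open>P\<close> with vanishing pure \<open>Q\<close>-jets, so they vanish to
  infinite order at 0.  In particular \<open>Q\<^sub>b Z + {Z b Z} / 2\<close> does.  Commuting two \<open>Q\<close>-derivatives of \<open>Z\<close>
  yields the Jordan identity \<open>{x b {x c x}} = {x c {x b x}}\<close>, and with it the same method, with the
  roles of \<open>P\<close> and \<open>Q\<close> exchanged, gives \<open>Z + {x Z x} / 2 = x\<close> to infinite order.  Hence the Taylor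
  series of \<open>Z\<close> along the line through \<open>X\<close> is the geometric series of \<open>A y = - {X y X} / 2\<close>, and
  integrating once produces the coefficients \<open>1 / (k + 1)\<close> of the logarithm.  On the iterates
  of \<open>X\<close>, \<open>A\<close> agrees with \<open>R(JX, _)JX / 4\<close>.  All statements are about infinite jets at 0; no convergence is
  needed.
\<close>

section \<open>Calculus of smooth functions\<close>

text \<open>The model is complex dimension one with \<open>{a b c} = 2 k a cnj(b) c\<close>: there f
  = log (1 + k |z|^2) / k and Z = z / (1 + k |z|^2), and the two equations for \<open>Z\<close> read
  dZ/dcnj(z) = - k Z^2 and Z + k z^2 cnj(Z) = z. The obstacle in general is that potential, metric
  and Christoffel map are merely smooth and cannot be expanded. Two facts help. Functions with
  vanishing jets of a given kind form a module over the smooth functions, so coefficients such as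
  \<open>\<Gamma>\<close> may stay unknown and only homogeneity of a system counts. And although the
  normalisation concerns derivatives along a single vector \<open>X\<close>, polarization yields
  mixed derivatives, where the complex type of an argument separates terms that real polarization
  leaves entangled. The Jordan identity serves twice. It puts the conjugate linear arguments into
  the order that makes the system for \<open>\<Delta>\<close> below homogeneous, and it makes
  \<open>y \<mapsto> {X X y}\<close> commute with \<open>A\<close>; this is why \<open>A\<close> and
  \<open>R(JX, _)JX / 4\<close>, in general different operators, have the same iterates on
  \<open>X\<close>.\<close>

lemma frechet_derivative_cong_open:
  assumes "open S" "x \<in> S" "\<And>y. y \<in> S \<Longrightarrow> f y = g y"
  shows "frechet_derivative f (at x) = frechet_derivative g (at x)"
proof -
  have "(f has_derivative D) (at x) \<longleftrightarrow> (g has_derivative D) (at x)" for D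
    using has_derivative_transform_within_open[OF _ assms(1,2)] assms(3) by metis
  then show ?thesis by (simp add: frechet_derivative_def)
qed

lemma differentiable_cong_open:
  assumes "open S" "x \<in> S" "\<And>y. y \<in> S \<Longrightarrow> f y = g y"
  shows "f differentiable at x \<longleftrightarrow> g differentiable at x"
  using has_derivative_transform_within_open[OF _ assms(1,2)] assms(3)
  unfolding differentiable_def by metis

lemma C_times_on_cong:
  assumes "open S" "\<And>y. y \<in> S \<Longrightarrow> f y = g y"
  shows "C_times_on n S f \<longleftrightarrow> C_times_on n S g"
  using assms(2)
proof (induction n arbitrary: f g)
  case 0 then show ?case using continuous_on_cong[OF refl] by auto
next
  case (Suc n)
  have "C_times_on n S (\<lambda>x. frechet_derivative f (at x) v) \<longleftrightarrow>
        C_times_on n S (\<lambda>x. frechet_derivative g (at x) v)" for v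
    by (rule Suc.IH) (metis Suc.prems frechet_derivative_cong_open[OF assms(1)])
  moreover have "(\<forall>x\<in>S. f differentiable at x) \<longleftrightarrow> (\<forall>x\<in>S. g differentiable at x)"
    using differentiable_cong_open[OF assms(1), of _ f g] Suc.prems by blast
  ultimately show ?case by simp
qed

lemma smooth_on_cong:
  assumes "\<And>y. y \<in> S \<Longrightarrow> f y = g y"
  shows "smooth_on S f \<longleftrightarrow> smooth_on S g"
  using C_times_on_cong[of S f g] assms unfolding smooth_on_def by blast

lemma C_times_on_subset:
  assumes "C_times_on n S f" "T \<subseteq> S"
  shows "C_times_on n T f"
  using assms
proof (induction n arbitrary: f)
  case 0 then show ?case using continuous_on_subset by auto
next
  case (Suc n) then show ?case by auto
qed

lemma C_times_on_Suc_imp: "C_times_on (Suc n) S f \<Longrightarrow> C_times_on n S f"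
proof (induction n arbitrary: f)
  case 0
  then show ?case
    by (simp add: continuous_at_imp_continuous_on differentiable_imp_continuous_within)
next
  case (Suc n)
  have "C_times_on n S (\<lambda>x. frechet_derivative f (at x) v)" for v
    by (rule Suc.IH) (use Suc.prems in simp)
  then show ?case using Suc.prems by simp
qed

lemma smooth_on_subset: "smooth_on S f \<Longrightarrow> T \<subseteq> S \<Longrightarrow> open T \<Longrightarrow> smooth_on T f"
  unfolding smooth_on_def using C_times_on_subset by blast

lemma smooth_on_open: "smooth_on S f \<Longrightarrow> open S"
  by (simp add: smooth_on_def)

lemma smooth_on_C_times: "smooth_on S f \<Longrightarrow> C_times_on n S f"
  by (simp add: smooth_on_def)

lemma smooth_on_differentiable: "smooth_on S f \<Longrightarrow> x \<in> S \<Longrightarrow> f differentiable (at x)"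
  using smooth_on_C_times[of S f "Suc 0"] by simp

lemma smooth_on_has_derivative:
  "smooth_on S f \<Longrightarrow> x \<in> S \<Longrightarrow> (f has_derivative frechet_derivative f (at x)) (at x)"
  using smooth_on_differentiable frechet_derivative_works by blast

lemma smooth_on_continuous: "smooth_on S f \<Longrightarrow> continuous_on S f"
  using smooth_on_C_times[of S f 0] by simp

lemma smooth_on_frechet_derivative:
  assumes "smooth_on S f"
  shows "smooth_on S (\<lambda>x. frechet_derivative f (at x) v)"
proof -
  have "C_times_on n S (\<lambda>x. frechet_derivative f (at x) v)" for n
    using smooth_on_C_times[OF assms, of "Suc n"] by simp
  then show ?thesis using assms by (simp add: smooth_on_def)
qed

lemma C_times_on_local:
  assumes "\<And>x. x \<in> S \<Longrightarrow> \<exists>T. open T \<and> x \<in> T \<and> C_times_on n T f"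
  shows "C_times_on n S f"
  using assms
proof (induction n arbitrary: f)
  case 0
  show ?case unfolding C_times_on.simps
  proof (rule continuous_at_imp_continuous_on, rule ballI)
    fix x assume "x \<in> S"
    with 0 obtain T where "open T" "x \<in> T" "continuous_on T f" by auto
    then show "isCont f x" using continuous_on_eq_continuous_at by blast
  qed
next
  case (Suc n)
  have "f differentiable at x" if "x \<in> S" for x
    using Suc.prems[OF that] by auto
  moreover have "C_times_on n S (\<lambda>x. frechet_derivative f (at x) v)" for v
  proof (rule Suc.IH)
    fix x assume "x \<in> S"
    from Suc.prems[OF this] show "\<exists>T. open T \<and> x \<in> T \<and> C_times_on n T (\<lambda>x. frechet_derivative f (at x) v)"
      by auto
  qed
  ultimately show ?case by auto
qed

lemma smooth_on_local:
  assumes "\<And>x. x \<in> S \<Longrightarrow> \<exists>T. x \<in> T \<and> T \<subseteq> S \<and> smooth_on T f"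
  shows "smooth_on S f"
proof -
  have "open S" using assms unfolding smooth_on_def by (metis open_subopen)
  moreover have "C_times_on n S f" for n
  proof (rule C_times_on_local)
    fix x assume "x \<in> S"
    then obtain T where "x \<in> T" "smooth_on T f" using assms by metis
    then show "\<exists>T. open T \<and> x \<in> T \<and> C_times_on n T f"
      using smooth_on_open smooth_on_C_times by metis
  qed
  ultimately show ?thesis by (simp add: smooth_on_def)
qed

lemma C_times_on_const: "C_times_on n S (\<lambda>x. c)"
proof (induction n arbitrary: c)
  case 0 then show ?case by simp
next
  case (Suc n) then show ?case by simp
qed

lemma frechet_derivative_bounded_linear:
  assumes "bounded_linear M" "f differentiable at x"
  shows "frechet_derivative (\<lambda>x. M (f x)) (at x) = (\<lambda>v. M (frechet_derivative f (at x) v))"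
  by (rule frechet_derivative_at[symmetric])
    (use assms frechet_derivative_works bounded_linear.has_derivative in blast)

lemma frechet_derivative_bounded_bilinear:
  assumes "bounded_bilinear M" "f differentiable at x" "g differentiable at x"
  shows "frechet_derivative (\<lambda>x. M (f x) (g x)) (at x) =
    (\<lambda>v. M (f x) (frechet_derivative g (at x) v) + M (frechet_derivative f (at x) v) (g x))"
  by (rule frechet_derivative_at[symmetric], rule bounded_bilinear.FDERIV[OF assms(1)])
    (use assms frechet_derivative_works in blast)+

lemma frechet_derivative_plus:
  assumes "f differentiable at x" "g differentiable at x"
  shows "frechet_derivative (\<lambda>x. f x + g x) (at x) =
    (\<lambda>v. frechet_derivative f (at x) v + frechet_derivative g (at x) v)"
  by (rule frechet_derivative_at[symmetric], rule has_derivative_add)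
    (use assms frechet_derivative_works in blast)+

lemma frechet_derivative_chain:
  assumes "f differentiable at x" "g differentiable at (f x)"
  shows "frechet_derivative (\<lambda>x. g (f x)) (at x) =
    (\<lambda>v. frechet_derivative g (at (f x)) (frechet_derivative f (at x) v))"
  by (rule frechet_derivative_at[symmetric], rule has_derivative_compose)
    (use assms frechet_derivative_works in blast)+

lemma C_times_on_add:
  assumes "open S" "C_times_on n S f" "C_times_on n S g"
  shows "C_times_on n S (\<lambda>x. f x + g x)"
  using assms(2,3)
proof (induction n arbitrary: f g)
  case 0 then show ?case by (simp add: continuous_on_add)
next
  case (Suc n)
  have "C_times_on n S (\<lambda>x. frechet_derivative f (at x) v + frechet_derivative g (at x) v)" for v
    using Suc by simp
  then have "C_times_on n S (\<lambda>x. frechet_derivative (\<lambda>x. f x + g x) (at x) v)" for v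
    by (subst C_times_on_cong[OF assms(1)])
      (use Suc.prems in \<open>auto simp: frechet_derivative_plus\<close>)
  then show ?case using Suc.prems by simp
qed

lemma C_times_on_bounded_linear:
  assumes "open S" "C_times_on n S f" "bounded_linear M"
  shows "C_times_on n S (\<lambda>x. M (f x))"
  using assms(2)
proof (induction n arbitrary: f)
  case 0 then show ?case using assms(3) bounded_linear.continuous_on by auto
next
  case (Suc n)
  have "C_times_on n S (\<lambda>x. M (frechet_derivative f (at x) v))" for v
    using Suc by simp
  then have "C_times_on n S (\<lambda>x. frechet_derivative (\<lambda>x. M (f x)) (at x) v)" for v
    by (subst C_times_on_cong[OF assms(1)])
      (use Suc.prems assms(3) in \<open>auto simp: frechet_derivative_bounded_linear\<close>)
  moreover have "(\<lambda>x. M (f x)) differentiable at x" if "x \<in> S" for x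
    using Suc.prems that bounded_linear.has_derivative[OF assms(3)]
    unfolding C_times_on.simps differentiable_def by blast
  ultimately show ?case by simp
qed

lemma C_times_on_bounded_bilinear:
  assumes "open S" "bounded_bilinear M" "C_times_on n S f" "C_times_on n S g"
  shows "C_times_on n S (\<lambda>x. M (f x) (g x))"
  using assms(3,4)
proof (induction n arbitrary: f g)
  case 0 then show ?case using assms(2) bounded_bilinear.continuous_on by auto
next
  case (Suc n)
  have "C_times_on n S (\<lambda>x. M (f x) (frechet_derivative g (at x) v) +
      M (frechet_derivative f (at x) v) (g x))" for v
    by (intro C_times_on_add assms(1) Suc.IH)
      (use Suc.prems C_times_on_Suc_imp[OF Suc.prems(1)] C_times_on_Suc_imp[OF Suc.prems(2)] in simp_all)
  then have "C_times_on n S (\<lambda>x. frechet_derivative (\<lambda>x. M (f x) (g x)) (at x) v)" for v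
    by (subst C_times_on_cong[OF assms(1)])
      (use Suc.prems assms(2) in \<open>auto simp: frechet_derivative_bounded_bilinear\<close>)
  moreover have "(\<lambda>x. M (f x) (g x)) differentiable at x" if "x \<in> S" for x
    using Suc.prems that bounded_bilinear.FDERIV[OF assms(2)]
    unfolding C_times_on.simps differentiable_def by blast
  ultimately show ?case by simp
qed

lemma smooth_on_const [simp]: "open S \<Longrightarrow> smooth_on S (\<lambda>x. c)"
  by (simp add: smooth_on_def C_times_on_const)

lemma smooth_on_add: "smooth_on S f \<Longrightarrow> smooth_on S g \<Longrightarrow> smooth_on S (\<lambda>x. f x + g x)"
  by (simp add: smooth_on_def C_times_on_add)

lemma smooth_on_bounded_linear:
  "bounded_linear M \<Longrightarrow> smooth_on S f \<Longrightarrow> smooth_on S (\<lambda>x. M (f x))"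
  by (simp add: smooth_on_def C_times_on_bounded_linear)

lemma smooth_on_bounded_bilinear:
  "bounded_bilinear M \<Longrightarrow> smooth_on S f \<Longrightarrow> smooth_on S g \<Longrightarrow> smooth_on S (\<lambda>x. M (f x) (g x))"
  by (simp add: smooth_on_def C_times_on_bounded_bilinear)

lemma smooth_on_scaleR:
  "smooth_on S f \<Longrightarrow> smooth_on S g \<Longrightarrow> smooth_on S (\<lambda>x. f x *\<^sub>R g x)"
  by (rule smooth_on_bounded_bilinear[OF bounded_bilinear_scaleR])

lemma smooth_on_minus: "smooth_on S f \<Longrightarrow> smooth_on S (\<lambda>x. - f x)"
  using smooth_on_bounded_linear[of uminus] bounded_linear_minus[OF bounded_linear_ident] by blast

lemma smooth_on_diff: "smooth_on S f \<Longrightarrow> smooth_on S g \<Longrightarrow> smooth_on S (\<lambda>x. f x - g x)"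
  using smooth_on_add[OF _ smooth_on_minus, of S f g] by simp

lemma smooth_on_sum:
  assumes "open S" "\<And>i. i \<in> I \<Longrightarrow> smooth_on S (f i)"
  shows "smooth_on S (\<lambda>x. \<Sum>i\<in>I. f i x)"
  using assms(2)
proof (induction I rule: infinite_finite_induct)
  case (insert i I) then show ?case by (simp add: smooth_on_add)
qed (use assms(1) in auto)

lemma smooth_on_ident [simp]: "open S \<Longrightarrow> smooth_on S (\<lambda>x. x)"
proof -
  assume "open S"
  have "C_times_on n S (\<lambda>x. x)" for n
    by (cases n) (auto simp: C_times_on_const)
  with \<open>open S\<close> show ?thesis by (simp add: smooth_on_def)
qed

lemma frechet_derivative_basis_expansion:
  fixes g :: "'a::euclidean_space \<Rightarrow> 'b::real_normed_vector"
  assumes "g differentiable at x"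
  shows "frechet_derivative g (at x) v = (\<Sum>b\<in>Basis. (v \<bullet> b) *\<^sub>R frechet_derivative g (at x) b)"
proof -
  have l: "linear (frechet_derivative g (at x))" by (rule linear_frechet_derivative[OF assms])
  have "frechet_derivative g (at x) v = frechet_derivative g (at x) (\<Sum>b\<in>Basis. (v \<bullet> b) *\<^sub>R b)"
    by (simp add: euclidean_representation)
  also have "\<dots> = (\<Sum>b\<in>Basis. (v \<bullet> b) *\<^sub>R frechet_derivative g (at x) b)"
    by (simp add: linear_sum[OF l] linear_cmul[OF l])
  finally show ?thesis .
qed

lemma C_times_on_sum:
  assumes "open S" "\<And>i. i \<in> I \<Longrightarrow> C_times_on n S (f i)"
  shows "C_times_on n S (\<lambda>x. \<Sum>i\<in>I. f i x)"
  using assms(2)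
proof (induction I rule: infinite_finite_induct)
  case (insert i I) then show ?case by (simp add: C_times_on_add[OF assms(1)])
qed (use assms(1) C_times_on_const in auto)

text \<open>The chain rule differentiates \<open>g\<close> in a direction that moves with
  \<open>x\<close>, while \<open>C_times_on\<close> speaks of fixed directions only. A basis
  expansion of the moving direction gives a sum of products of smooth scalars with derivatives in
  fixed directions; hence the Euclidean middle space.\<close>

lemma C_times_on_compose:
  fixes f :: "'a::real_normed_vector \<Rightarrow> 'b::euclidean_space"
  assumes "open S" "open T" "C_times_on n S f" "C_times_on n T g" "f ` S \<subseteq> T"
  shows "C_times_on n S (\<lambda>x. g (f x))"
  using assms(3,4)
proof (induction n arbitrary: g)
  case 0 then show ?case using assms(5) continuous_on_compose2 by auto
next
  case (Suc n)
  have "C_times_on n S (\<lambda>x. (frechet_derivative f (at x) v \<bullet> b) *\<^sub>R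
      frechet_derivative g (at (f x)) b)" for v b
  proof (rule C_times_on_bounded_bilinear[OF assms(1) bounded_bilinear_scaleR])
    show "C_times_on n S (\<lambda>x. frechet_derivative f (at x) v \<bullet> b)"
      by (rule C_times_on_bounded_linear[OF assms(1) _ bounded_linear_inner_left]) (use Suc.prems in simp)
    show "C_times_on n S (\<lambda>x. frechet_derivative g (at (f x)) b)"
      by (rule Suc.IH) (use Suc.prems(2) C_times_on_Suc_imp[OF Suc.prems(1)] in simp_all)
  qed
  then have "C_times_on n S (\<lambda>x. \<Sum>b\<in>Basis. (frechet_derivative f (at x) v \<bullet> b) *\<^sub>R
      frechet_derivative g (at (f x)) b)" for v
    by (intro C_times_on_sum assms(1))
  moreover have "(\<Sum>b\<in>Basis. (frechet_derivative f (at x) v \<bullet> b) *\<^sub>R frechet_derivative g (at (f x)) b) =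
      frechet_derivative (\<lambda>x. g (f x)) (at x) v" if "x \<in> S" for x v
  proof -
    have d: "f differentiable at x" "g differentiable at (f x)"
      using Suc.prems that assms(5) by auto
    show ?thesis
      unfolding frechet_derivative_chain[OF d] by (rule frechet_derivative_basis_expansion[OF d(2), symmetric])
  qed
  ultimately have "C_times_on n S (\<lambda>x. frechet_derivative (\<lambda>x. g (f x)) (at x) v)" for v
    using C_times_on_cong[OF assms(1)] by (metis (no_types, lifting))
  moreover have "(\<lambda>x. g (f x)) differentiable at x" if "x \<in> S" for x
    using Suc.prems that assms(5) differentiable_chain_at[of f x g] by (auto simp: o_def image_subset_iff)
  ultimately show ?case by simp
qed

lemma smooth_on_compose:
  fixes f :: "'a::real_normed_vector \<Rightarrow> 'b::euclidean_space"
  assumes "smooth_on S f" "smooth_on T g" "f ` S \<subseteq> T"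
  shows "smooth_on S (\<lambda>x. g (f x))"
  using assms unfolding smooth_on_def by (metis C_times_on_compose)

lemma smooth_on_derivative_field:
  fixes f :: "'a::euclidean_space \<Rightarrow> 'b::real_normed_vector"
  assumes "smooth_on S f" "smooth_on S h"
  shows "smooth_on S (\<lambda>x. frechet_derivative f (at x) (h x))"
proof -
  have "smooth_on S (\<lambda>x. \<Sum>b\<in>Basis. (h x \<bullet> b) *\<^sub>R frechet_derivative f (at x) b)"
    by (rule smooth_on_sum[OF smooth_on_open[OF assms(1)]],
        rule smooth_on_scaleR[OF smooth_on_bounded_linear[OF bounded_linear_inner_left assms(2)]
          smooth_on_frechet_derivative[OF assms(1)]])
  moreover have "(\<Sum>b\<in>Basis. (h x \<bullet> b) *\<^sub>R frechet_derivative f (at x) b) =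
      frechet_derivative f (at x) (h x)" if "x \<in> S" for x
    by (rule frechet_derivative_basis_expansion[symmetric]) (rule smooth_on_differentiable[OF assms(1) that])
  ultimately show ?thesis
    using smooth_on_cong[of S "\<lambda>x. \<Sum>b\<in>Basis. (h x \<bullet> b) *\<^sub>R frechet_derivative f (at x) b"
      "\<lambda>x. frechet_derivative f (at x) (h x)"] by blast
qed

section \<open>Symmetry of second derivatives\<close>

lemma smooth_on_second_difference:
  fixes F :: "'a::real_normed_vector \<Rightarrow> real"
  assumes F: "smooth_on U F" and h: "0 < h"
    and U: "\<And>s t. 0 \<le> s \<Longrightarrow> s \<le> h \<Longrightarrow> 0 \<le> t \<Longrightarrow> t \<le> h \<Longrightarrow> x + s *\<^sub>R v + t *\<^sub>R w \<in> U"
  shows "\<exists>s t. 0 < s \<and> s < h \<and> 0 < t \<and> t < h \<and>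
    F (x + h *\<^sub>R v + h *\<^sub>R w) - F (x + h *\<^sub>R v) - F (x + h *\<^sub>R w) + F x =
    h * h * frechet_derivative (\<lambda>y. frechet_derivative F (at y) v) (at (x + s *\<^sub>R v + t *\<^sub>R w)) w"
proof -
  have d: "((\<lambda>s. G (y + s *\<^sub>R u)) has_real_derivative frechet_derivative G (at (y + s *\<^sub>R u)) u) (at s)"
    if G: "smooth_on U G" and "y + s *\<^sub>R u \<in> U" for G y s u
  proof -
    have "((\<lambda>s. y + s *\<^sub>R u) has_derivative (\<lambda>t. t *\<^sub>R u)) (at s)"
      by (auto intro!: derivative_eq_intros)
    then have "((\<lambda>s. G (y + s *\<^sub>R u)) has_derivative (\<lambda>t. frechet_derivative G (at (y + s *\<^sub>R u)) (t *\<^sub>R u))) (at s)"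
      by (rule has_derivative_compose[where g = G]) (rule smooth_on_has_derivative[OF that])
    moreover have "frechet_derivative G (at (y + s *\<^sub>R u)) (t *\<^sub>R u) = frechet_derivative G (at (y + s *\<^sub>R u)) u * t" for t
      using linear_cmul[OF linear_frechet_derivative[OF smooth_on_differentiable[OF that]]] by simp
    ultimately show ?thesis by (simp add: has_field_derivative_def)
  qed
  \<comment> \<open>The mean value theorem is applied in direction \<open>v\<close> to the
    difference of \<open>F\<close> along two parallel sides, and then in direction \<open>w\<close>
    to the derivative so obtained.\<close>
  have "\<exists>s>0. s < h \<and> (F (x + h *\<^sub>R w + h *\<^sub>R v) - F (x + h *\<^sub>R v)) - (F (x + h *\<^sub>R w + 0 *\<^sub>R v) - F (x + 0 *\<^sub>R v)) =
     (h - 0) * (frechet_derivative F (at (x + h *\<^sub>R w + s *\<^sub>R v)) v - frechet_derivative F (at (x + s *\<^sub>R v)) v)"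
  proof (rule MVT2[OF h])
    fix s assume s: "0 \<le> s" "s \<le> h"
    have "x + h *\<^sub>R w + s *\<^sub>R v \<in> U" "x + s *\<^sub>R v \<in> U"
      using U[of s h] U[of s 0] s h by (simp_all add: ac_simps)
    then show "((\<lambda>s. F (x + h *\<^sub>R w + s *\<^sub>R v) - F (x + s *\<^sub>R v)) has_real_derivative
      frechet_derivative F (at (x + h *\<^sub>R w + s *\<^sub>R v)) v - frechet_derivative F (at (x + s *\<^sub>R v)) v) (at s)"
      by (intro DERIV_diff d[OF F])
  qed
  then obtain s where s: "0 < s" "s < h" and
    e1: "F (x + h *\<^sub>R v + h *\<^sub>R w) - F (x + h *\<^sub>R v) - F (x + h *\<^sub>R w) + F x =
     h * (frechet_derivative F (at (x + s *\<^sub>R v + h *\<^sub>R w)) v - frechet_derivative F (at (x + s *\<^sub>R v)) v)"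
    by (auto simp: ac_simps algebra_simps)
  have "\<exists>t>0. t < h \<and> frechet_derivative F (at (x + s *\<^sub>R v + h *\<^sub>R w)) v - frechet_derivative F (at (x + s *\<^sub>R v + 0 *\<^sub>R w)) v =
     (h - 0) * frechet_derivative (\<lambda>y. frechet_derivative F (at y) v) (at (x + s *\<^sub>R v + t *\<^sub>R w)) w"
  proof (rule MVT2[OF h])
    fix t assume t: "0 \<le> t" "t \<le> h"
    show "((\<lambda>t. frechet_derivative F (at (x + s *\<^sub>R v + t *\<^sub>R w)) v) has_real_derivative
      frechet_derivative (\<lambda>y. frechet_derivative F (at y) v) (at (x + s *\<^sub>R v + t *\<^sub>R w)) w) (at t)"
      by (rule d[OF smooth_on_frechet_derivative[OF F]]) (use U s t in auto)
  qed
  with e1 s show ?thesis by auto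
qed

text \<open>The second difference over a small parallelogram is symmetric in \<open>v\<close> and
  \<open>w\<close>, so the two mixed derivatives agree at some pair of points close to
  \<open>x\<close>; by continuity they cannot differ at \<open>x\<close>.\<close>

lemma frechet_derivative_symmetric_real:
  fixes F :: "'a::real_normed_vector \<Rightarrow> real"
  assumes F: "smooth_on U F" and x: "x \<in> U"
  shows "frechet_derivative (\<lambda>y. frechet_derivative F (at y) v) (at x) w =
         frechet_derivative (\<lambda>y. frechet_derivative F (at y) w) (at x) v"
proof (rule ccontr)
  let ?a = "\<lambda>z. frechet_derivative (\<lambda>y. frechet_derivative F (at y) v) (at z) w"
  let ?b = "\<lambda>z. frechet_derivative (\<lambda>y. frechet_derivative F (at y) w) (at z) v"
  assume ne: "?a x \<noteq> ?b x"
  have oU: "open U" using F smooth_on_open by blast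
  have "isCont ?a x" "isCont ?b x"
    using smooth_on_continuous smooth_on_frechet_derivative[OF smooth_on_frechet_derivative[OF F]]
      continuous_on_eq_continuous_at[OF oU] x by blast+
  \<comment> \<open>Half the gap: values closer than \<open>e\<close> to \<open>?a x\<close> and to
    \<open>?b x\<close>, respectively, are distinct.\<close>
  moreover define e where "e = \<bar>?a x - ?b x\<bar> / 2"
  moreover have "e > 0" using ne by (simp add: e_def)
  ultimately obtain d1 d2 where d: "d1 > 0" "d2 > 0"
    "\<And>y. dist y x < d1 \<Longrightarrow> dist (?a y) (?a x) < e" "\<And>y. dist y x < d2 \<Longrightarrow> dist (?b y) (?b x) < e"
    unfolding continuous_at_eps_delta by metis
  obtain d3 where d3: "d3 > 0" "ball x d3 \<subseteq> U" using oU x open_contains_ball by blast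
  define r where "r = min d1 (min d2 d3)"
  have r: "r > 0" using d d3 by (simp add: r_def)
  \<comment> \<open>The summand 1 keeps \<open>N\<close> positive when both vectors vanish;
    \<open>h * N = r / 2\<close> keeps the whole parallelogram in the ball of radius
    \<open>r\<close>.\<close>
  define N where "N = norm v + norm w + 1"
  define h where "h = r / (2 * N)"
  have nn: "0 < N" by (simp add: N_def add_nonneg_pos)
  have h: "h > 0" using r nn by (simp add: h_def)
  have "h * N = r / 2" using nn by (simp add: h_def)
  then have hr: "h * (norm v + norm w + 1) < r" using r by (simp add: N_def)
  have near: "dist (x + s *\<^sub>R v + t *\<^sub>R w) x < r" if "0 \<le> s" "s \<le> h" "0 \<le> t" "t \<le> h" for s t
  proof -
    have "norm (s *\<^sub>R v + t *\<^sub>R w) \<le> s * norm v + t * norm w"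
      using norm_triangle_ineq[of "s *\<^sub>R v" "t *\<^sub>R w"] that by simp
    also have "\<dots> \<le> h * norm v + h * norm w"
      using that by (intro add_mono mult_right_mono) auto
    also have "\<dots> < r" using hr h by (simp add: algebra_simps)
    finally show ?thesis by (simp add: dist_norm add.assoc)
  qed
  have near': "dist (x + s *\<^sub>R w + t *\<^sub>R v) x < r" if "0 \<le> s" "s \<le> h" "0 \<le> t" "t \<le> h" for s t
    using near[of t s] that by (simp add: ac_simps)
  have U: "y \<in> U" if "dist y x < r" for y
    using that d3 by (auto simp: r_def dist_commute)
  obtain s t where st: "0 < s" "s < h" "0 < t" "t < h" and
    e1: "F (x + h *\<^sub>R v + h *\<^sub>R w) - F (x + h *\<^sub>R v) - F (x + h *\<^sub>R w) + F x = h * h * ?a (x + s *\<^sub>R v + t *\<^sub>R w)"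
    using smooth_on_second_difference[OF F h, of x v w] near U by blast
  obtain s' t' where st': "0 < s'" "s' < h" "0 < t'" "t' < h" and
    e2: "F (x + h *\<^sub>R w + h *\<^sub>R v) - F (x + h *\<^sub>R w) - F (x + h *\<^sub>R v) + F x = h * h * ?b (x + s' *\<^sub>R w + t' *\<^sub>R v)"
    using smooth_on_second_difference[OF F h, of x w v] near' U by blast
  have "h * h * ?a (x + s *\<^sub>R v + t *\<^sub>R w) = h * h * ?b (x + s' *\<^sub>R w + t' *\<^sub>R v)"
    using e1 e2 unfolding add.commute[of "h *\<^sub>R w" "h *\<^sub>R v"] add.assoc[of x] by linarith
  then have "?a (x + s *\<^sub>R v + t *\<^sub>R w) = ?b (x + s' *\<^sub>R w + t' *\<^sub>R v)" using h by simp
  moreover have "dist (?a (x + s *\<^sub>R v + t *\<^sub>R w)) (?a x) < e"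
    using near[of s t] st by (intro d) (auto simp: r_def)
  moreover have "dist (?b (x + s' *\<^sub>R w + t' *\<^sub>R v)) (?b x) < e"
    using near'[of s' t'] st' by (intro d) (auto simp: r_def)
  ultimately show False unfolding e_def dist_real_def by argo
qed

text \<open>
  The directional derivative is cut off outside \<open>U\<close>, so that identities between iterated
  derivatives become equalities of functions.
\<close>

definition dd :: "'a::real_normed_vector set \<Rightarrow> 'a \<Rightarrow> ('a \<Rightarrow> 'b::real_normed_vector) \<Rightarrow> 'a \<Rightarrow> 'b" where
  "dd U v F = (\<lambda>x. if x \<in> U then frechet_derivative F (at x) v else 0)"

lemma dd_cong: "open U \<Longrightarrow> (\<And>y. y \<in> U \<Longrightarrow> F y = G y) \<Longrightarrow> dd U v F = dd U v G"
  using frechet_derivative_cong_open[of U _ F G] by (auto simp: dd_def fun_eq_iff)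

lemma smooth_on_dd [intro]: "smooth_on U F \<Longrightarrow> smooth_on U (dd U v F)"
  using smooth_on_frechet_derivative[of U F v]
    smooth_on_cong[of U "dd U v F" "\<lambda>x. frechet_derivative F (at x) v"] by (simp add: dd_def)

lemma dd_outside: "x \<notin> U \<Longrightarrow> dd U v F x = 0"
  by (simp add: dd_def)

lemma dd_add: "smooth_on U F \<Longrightarrow> smooth_on U G \<Longrightarrow>
  dd U v (\<lambda>x. F x + G x) = (\<lambda>x. dd U v F x + dd U v G x)"
  by (auto simp: dd_def fun_eq_iff frechet_derivative_plus smooth_on_differentiable)

lemma dd_bounded_linear: "bounded_linear M \<Longrightarrow> smooth_on U F \<Longrightarrow>
  dd U v (\<lambda>x. M (F x)) = (\<lambda>x. M (dd U v F x))"
  by (auto simp: dd_def fun_eq_iff frechet_derivative_bounded_linear smooth_on_differentiable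
      linear_simps)

lemma dd_bounded_bilinear: "bounded_bilinear M \<Longrightarrow> smooth_on U F \<Longrightarrow> smooth_on U G \<Longrightarrow>
  dd U v (\<lambda>x. M (F x) (G x)) = (\<lambda>x. M (F x) (dd U v G x) + M (dd U v F x) (G x))"
  by (auto simp: dd_def fun_eq_iff frechet_derivative_bounded_bilinear smooth_on_differentiable
      bounded_bilinear.zero_left bounded_bilinear.zero_right)

lemma dd_const [simp]: "dd U v (\<lambda>x. c) = (\<lambda>x. 0)"
  by (auto simp: dd_def)

lemma dd_ident: "dd U v (\<lambda>x. x) = (\<lambda>x. if x \<in> U then v else 0)"
  by (auto simp: dd_def)

lemma dd_scaleR: "smooth_on U F \<Longrightarrow> smooth_on U G \<Longrightarrow>
  dd U v (\<lambda>x. F x *\<^sub>R G x) = (\<lambda>x. F x *\<^sub>R dd U v G x + dd U v F x *\<^sub>R G x)"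
  by (rule dd_bounded_bilinear[OF bounded_bilinear_scaleR])

lemma dd_minus: "smooth_on U F \<Longrightarrow> dd U v (\<lambda>x. - F x) = (\<lambda>x. - dd U v F x)"
  by (rule dd_bounded_linear[OF bounded_linear_minus[OF bounded_linear_ident]])

lemma dd_diff: "smooth_on U F \<Longrightarrow> smooth_on U G \<Longrightarrow>
  dd U v (\<lambda>x. F x - G x) = (\<lambda>x. dd U v F x - dd U v G x)"
  using dd_add[OF _ smooth_on_minus, of U F G v] by (simp add: dd_minus)

lemma dd_sum:
  assumes "\<And>i. i \<in> I \<Longrightarrow> smooth_on U (F i)" "open U"
  shows "dd U v (\<lambda>x. \<Sum>i\<in>I. F i x) = (\<lambda>x. \<Sum>i\<in>I. dd U v (F i) x)"
  using assms(1)
proof (induction I rule: infinite_finite_induct)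
  case (insert i I)
  then show ?case using dd_add[of U "F i" "\<lambda>x. \<Sum>i\<in>I. F i x"] smooth_on_sum[OF assms(2), of I F]
    by simp
qed auto

lemma dd_vec_add: "smooth_on U F \<Longrightarrow> dd U (v + w) F = (\<lambda>x. dd U v F x + dd U w F x)"
  using linear_add[OF linear_frechet_derivative[OF smooth_on_differentiable]]
  by (fastforce simp: dd_def fun_eq_iff)

lemma dd_vec_scaleR: "smooth_on U F \<Longrightarrow> dd U (c *\<^sub>R v) F = (\<lambda>x. c *\<^sub>R dd U v F x)"
  using linear_cmul[OF linear_frechet_derivative[OF smooth_on_differentiable]]
  by (fastforce simp: dd_def fun_eq_iff)

lemma dd_vec_minus: "smooth_on U F \<Longrightarrow> dd U (- v) F = (\<lambda>x. - dd U v F x)"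
  using dd_vec_scaleR[of U F "-1" v] by simp

lemma dd_eq: "x \<in> U \<Longrightarrow> dd U v F x = frechet_derivative F (at x) v"
  by (simp add: dd_def)

lemma linear_dd: "smooth_on U F \<Longrightarrow> linear (\<lambda>v. dd U v F x)"
  by (simp add: linear_iff dd_vec_add dd_vec_scaleR)

text \<open>Pairing with a vector \<open>b\<close> reduces this to the real valued case. Outside
  \<open>U\<close> both sides are 0, which makes it an equality of functions.\<close>

lemma dd_commute:
  fixes F :: "'a::real_normed_vector \<Rightarrow> 'b::euclidean_space"
  assumes F: "smooth_on U F"
  shows "dd U v (dd U w F) = dd U w (dd U v F)"
proof
  fix x
  have oU: "open U" by (rule smooth_on_open[OF F])
  have *: "dd U v (dd U w F) x \<bullet> b = frechet_derivative (\<lambda>y. frechet_derivative (\<lambda>z. F z \<bullet> b) (at y) w) (at x) v"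
    if "x \<in> U" for v w b
  proof -
    have bl: "bounded_linear (\<lambda>y. y \<bullet> b)" by (rule bounded_linear_inner_left)
    have "dd U v (\<lambda>y. dd U w F y \<bullet> b) x = dd U v (dd U w F) x \<bullet> b"
      by (subst dd_bounded_linear[OF bl]) (use F in auto)
    moreover have "(\<lambda>y. dd U w F y \<bullet> b) = dd U w (\<lambda>z. F z \<bullet> b)"
      by (subst dd_bounded_linear[OF bl]) (use F in auto)
    moreover have "dd U v (dd U w (\<lambda>z. F z \<bullet> b)) = dd U v (\<lambda>y. frechet_derivative (\<lambda>z. F z \<bullet> b) (at y) w)"
      by (rule dd_cong[OF oU]) (simp add: dd_def)
    moreover have "dd U v (\<lambda>y. frechet_derivative (\<lambda>z. F z \<bullet> b) (at y) w) x =
        frechet_derivative (\<lambda>y. frechet_derivative (\<lambda>z. F z \<bullet> b) (at y) w) (at x) v"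
      using that by (simp add: dd_def)
    ultimately show ?thesis by metis
  qed
  show "dd U v (dd U w F) x = dd U w (dd U v F) x"
  proof (cases "x \<in> U")
    case True
    have "dd U v (dd U w F) x \<bullet> b = dd U w (dd U v F) x \<bullet> b" for b
      unfolding *[OF True]
      by (rule frechet_derivative_symmetric_real[OF smooth_on_bounded_linear[OF bounded_linear_inner_left F] True])
    then show ?thesis by (metis euclidean_eqI)
  qed (simp add: dd_outside)
qed

section \<open>Wirtinger derivatives and their jets\<close>

text \<open>Linearity is demanded on smooth functions only, since \<open>frechet_derivative\<close>
  says nothing where a function is not differentiable.\<close>

definition lin_op :: "'a::real_normed_vector set \<Rightarrow> (('a \<Rightarrow> 'b::real_normed_vector) \<Rightarrow> 'a \<Rightarrow> 'b) \<Rightarrow> bool" where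
  "lin_op U A \<longleftrightarrow> (\<forall>F. smooth_on U F \<longrightarrow> smooth_on U (A F)) \<and>
    (\<forall>F G. smooth_on U F \<longrightarrow> smooth_on U G \<longrightarrow> A (\<lambda>x. F x + G x) = (\<lambda>x. A F x + A G x)) \<and>
    (\<forall>c F. smooth_on U F \<longrightarrow> A (\<lambda>x. c *\<^sub>R F x) = (\<lambda>x. c *\<^sub>R A F x))"

lemma lin_opI:
  assumes "\<And>F. smooth_on U F \<Longrightarrow> smooth_on U (A F)"
    "\<And>F G. smooth_on U F \<Longrightarrow> smooth_on U G \<Longrightarrow> A (\<lambda>x. F x + G x) = (\<lambda>x. A F x + A G x)"
    "\<And>c F. smooth_on U F \<Longrightarrow> A (\<lambda>x. c *\<^sub>R F x) = (\<lambda>x. c *\<^sub>R A F x)"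
  shows "lin_op U A"
  using assms by (simp add: lin_op_def)

lemma lin_op_smooth: "lin_op U A \<Longrightarrow> smooth_on U F \<Longrightarrow> smooth_on U (A F)"
  by (simp add: lin_op_def)

lemma lin_op_add: "lin_op U A \<Longrightarrow> smooth_on U F \<Longrightarrow> smooth_on U G \<Longrightarrow>
  A (\<lambda>x. F x + G x) = (\<lambda>x. A F x + A G x)"
  by (simp add: lin_op_def)

lemma lin_op_scaleR: "lin_op U A \<Longrightarrow> smooth_on U F \<Longrightarrow> A (\<lambda>x. c *\<^sub>R F x) = (\<lambda>x. c *\<^sub>R A F x)"
  by (simp add: lin_op_def)

lemma smooth_on_cscaleR: "smooth_on U F \<Longrightarrow> smooth_on U (\<lambda>x. c *\<^sub>R F x)"
  by (rule smooth_on_bounded_linear[OF bounded_linear_scaleR_right])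

lemma smooth_on_cmult: "smooth_on U F \<Longrightarrow> smooth_on U (\<lambda>x. (c::real) * F x)"
  by (rule smooth_on_bounded_linear[OF bounded_linear_mult_right])

lemma lin_op_minus: "lin_op U A \<Longrightarrow> smooth_on U F \<Longrightarrow> A (\<lambda>x. - F x) = (\<lambda>x. - A F x)"
  using lin_op_scaleR[of U A F "-1"] by simp

lemma lin_op_diff: "lin_op U A \<Longrightarrow> smooth_on U F \<Longrightarrow> smooth_on U G \<Longrightarrow>
  A (\<lambda>x. F x - G x) = (\<lambda>x. A F x - A G x)"
  using lin_op_add[of U A F "\<lambda>x. - G x"] by (simp add: lin_op_minus smooth_on_minus)

lemma lin_op_zero: "lin_op U A \<Longrightarrow> open U \<Longrightarrow> A (\<lambda>x. 0) = (\<lambda>x. 0)"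
  using lin_op_scaleR[of U A "\<lambda>x. 0" 0] by simp

lemma lin_op_sum:
  assumes "lin_op U A" "open U" "\<And>i. i \<in> I \<Longrightarrow> smooth_on U (F i)"
  shows "A (\<lambda>x. \<Sum>i\<in>I. F i x) = (\<lambda>x. \<Sum>i\<in>I. A (F i) x)"
  using assms(3)
proof (induction I rule: infinite_finite_induct)
  case (insert i I)
  then show ?case
    using lin_op_add[OF assms(1), of "F i" "\<lambda>x. \<Sum>i\<in>I. F i x"] smooth_on_sum[OF assms(2), of I F] by simp
qed (auto simp: lin_op_zero[OF assms(1,2)])

lemma lin_op_funpow: "lin_op U A \<Longrightarrow> lin_op U (A ^^ n)"
proof (induction n)
  case 0 then show ?case by (simp add: lin_op_def)
next
  case (Suc n)
  then have IH: "lin_op U (A ^^ n)" and A: "lin_op U A" by auto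
  show ?case
    by (rule lin_opI)
      (simp_all add: lin_op_smooth[OF IH] lin_op_smooth[OF A] lin_op_add[OF IH] lin_op_add[OF A]
        lin_op_scaleR[OF IH] lin_op_scaleR[OF A])
qed

lemma funpow_commute_on:
  assumes "\<And>F. S F \<Longrightarrow> S (A F)" "\<And>F. S F \<Longrightarrow> S (B F)" "\<And>F. S F \<Longrightarrow> A (B F) = B (A F)" "S F"
  shows "(A ^^ n) (B F) = B ((A ^^ n) F)"
proof -
  have "S ((A ^^ n) F) \<and> (A ^^ n) (B F) = B ((A ^^ n) F)"
    using assms by (induction n) auto
  then show ?thesis by simp
qed

text \<open>The operators commute on smooth functions only, so smoothness of all iterates
  accompanies Pascal's rule.\<close>

lemma lin_op_binomial:
  assumes A: "lin_op U A" and B: "lin_op U B" and U: "open U" and F: "smooth_on U F"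
    and comm: "\<And>F. smooth_on U F \<Longrightarrow> A (B F) = B (A F)"
  shows "((\<lambda>F x. A F x + B F x) ^^ n) F =
    (\<lambda>x. \<Sum>k\<le>n. real (n choose k) *\<^sub>R (A ^^ k) ((B ^^ (n - k)) F) x)"
proof (induction n)
  case 0 show ?case by simp
next
  case (Suc n)
  let ?G = "\<lambda>k l. (A ^^ k) ((B ^^ l) F)"
  have sm: "smooth_on U (?G k l)" for k l
    by (intro lin_op_smooth[OF lin_op_funpow] A B F)
  have 1: "A (\<lambda>x. \<Sum>k\<le>n. real (n choose k) *\<^sub>R ?G k (n - k) x) =
     (\<lambda>x. \<Sum>k\<le>n. real (n choose k) *\<^sub>R ?G (Suc k) (n - k) x)"
    by (subst lin_op_sum[OF A U]) (auto simp: lin_op_scaleR[OF A] sm intro: smooth_on_cscaleR)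
  have BG: "B (?G k l) = ?G k (Suc l)" for k l
    using funpow_commute_on[of "smooth_on U" A B "(B ^^ l) F" k] lin_op_smooth[OF A] lin_op_smooth[OF B]
      lin_op_smooth[OF lin_op_funpow[OF B] F] comm by simp
  have 2: "B (\<lambda>x. \<Sum>k\<le>n. real (n choose k) *\<^sub>R ?G k (n - k) x) =
     (\<lambda>x. \<Sum>k\<le>n. real (n choose k) *\<^sub>R ?G k (Suc (n - k)) x)"
    by (subst lin_op_sum[OF B U]) (auto simp: lin_op_scaleR[OF B] sm BG intro: smooth_on_cscaleR)
  have "((\<lambda>F x. A F x + B F x) ^^ Suc n) F x =
    (\<Sum>k\<le>n. real (n choose k) *\<^sub>R ?G (Suc k) (n - k) x) +
    (\<Sum>k\<le>n. real (n choose k) *\<^sub>R ?G k (Suc n - k) x)" for x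
    using Suc 1 2 by (simp add: Suc_diff_le del: funpow.simps) (simp add: Suc_diff_le)
  also have "\<dots> x = (\<Sum>k\<le>Suc n. real (Suc n choose k) *\<^sub>R ?G k (Suc n - k) x)" for x
  proof -
    have "(\<Sum>k\<le>n. real (n choose k) *\<^sub>R ?G k (Suc n - k) x) =
       (\<Sum>k\<le>Suc n. real (n choose k) *\<^sub>R ?G k (Suc n - k) x)"
      by (simp add: binomial_eq_0)
    also have "\<dots> = ?G 0 (Suc n) x + (\<Sum>k\<le>n. real (n choose Suc k) *\<^sub>R ?G (Suc k) (n - k) x)"
      by (subst sum.atMost_Suc_shift) simp
    moreover have "(\<Sum>k\<le>Suc n. real (Suc n choose k) *\<^sub>R ?G k (Suc n - k) x) =
      ?G 0 (Suc n) x + (\<Sum>k\<le>n. real (Suc n choose Suc k) *\<^sub>R ?G (Suc k) (n - k) x)"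
      by (subst sum.atMost_Suc_shift) simp
    moreover have "(\<Sum>k\<le>n. real (Suc n choose Suc k) *\<^sub>R ?G (Suc k) (n - k) x) =
      (\<Sum>k\<le>n. real (n choose k) *\<^sub>R ?G (Suc k) (n - k) x) + (\<Sum>k\<le>n. real (n choose Suc k) *\<^sub>R ?G (Suc k) (n - k) x)"
      by (simp add: scaleR_add_left sum.distrib)
    ultimately show ?thesis by (simp del: sum.atMost_Suc funpow.simps)
  qed
  finally show ?case by blast
qed

lemma vector_polyfun_eq_0:
  fixes c :: "nat \<Rightarrow> 'b::euclidean_space"
  assumes "\<And>t::real. (\<Sum>k\<le>n. t ^ k *\<^sub>R c k) = 0" "k \<le> n"
  shows "c k = 0"
proof -
  have "c k \<bullet> b = 0" for b
  proof -
    have "(\<Sum>k\<le>n. (c k \<bullet> b) * t ^ k) = 0" for t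
      using arg_cong[OF assms(1)[of t], of "\<lambda>y. y \<bullet> b"] by (simp add: inner_sum_left mult.commute)
    then show ?thesis using polyfun_eq_0[where n = n and c = "\<lambda>k. c k \<bullet> b"] assms(2) by auto
  qed
  then show ?thesis by (metis euclidean_all_zero_iff)
qed

lemma lin_op_times: "lin_op U A \<Longrightarrow> lin_op U (\<lambda>F x. t *\<^sub>R A F x)"
  by (rule lin_opI) (simp_all add: lin_op_smooth lin_op_add lin_op_scaleR smooth_on_cscaleR scaleR_add_right mult.commute)

lemma lin_op_times_funpow:
  assumes "lin_op U A" "smooth_on U F"
  shows "((\<lambda>F x. t *\<^sub>R A F x) ^^ n) F = (\<lambda>x. t ^ n *\<^sub>R (A ^^ n) F x)"
proof (induction n)
  case (Suc n)
  then show ?case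
    by (simp add: lin_op_scaleR[OF assms(1) lin_op_smooth[OF lin_op_funpow[OF assms(1)] assms(2)]])
qed simp

text \<open>The hypothesis says that a polynomial in \<open>t\<close> vanishes identically; its
  coefficient at the first power of \<open>t\<close> is \<open>Suc n\<close> times the claimed
  value.\<close>

lemma lin_op_polarize:
  fixes A B :: "('a::real_normed_vector \<Rightarrow> 'b::euclidean_space) \<Rightarrow> 'a \<Rightarrow> 'b"
  assumes A: "lin_op U A" and B: "lin_op U B" and U: "open U" and F: "smooth_on U F"
    and comm: "\<And>F. smooth_on U F \<Longrightarrow> A (B F) = B (A F)"
    and van: "\<And>t::real. (((\<lambda>F x. t *\<^sub>R B F x + A F x) ^^ Suc n) F) p = 0"
  shows "B ((A ^^ n) F) p = 0"
proof -
  have "(\<Sum>k\<le>Suc n. t ^ k *\<^sub>R (real (Suc n choose k) *\<^sub>R (B ^^ k) ((A ^^ (Suc n - k)) F) p)) = 0" for t :: real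
  proof -
    have tB: "lin_op U (\<lambda>F x. t *\<^sub>R B F x)" by (rule lin_op_times[OF B])
    have c: "(\<lambda>x. t *\<^sub>R B (A F) x) = A (\<lambda>x. t *\<^sub>R B F x)" if "smooth_on U F" for F
      using that lin_op_scaleR[OF A lin_op_smooth[OF B that]] comm by simp
    have "(\<Sum>k\<le>Suc n. real (Suc n choose k) *\<^sub>R ((\<lambda>F x. t *\<^sub>R B F x) ^^ k) ((A ^^ (Suc n - k)) F) p) = 0"
      using fun_cong[OF lin_op_binomial[OF tB A U F c, of "Suc n"], of p] van[of t] by simp
    then show ?thesis
      by (subst (asm) lin_op_times_funpow[OF B lin_op_smooth[OF lin_op_funpow[OF A] F]])
        (simp add: mult.commute del: sum.atMost_Suc binomial_Suc_Suc)
  qed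
  from vector_polyfun_eq_0[OF this, of 1] show ?thesis by simp
qed

lemma lin_op_dd: "lin_op U (dd U v)"
  by (rule lin_opI) (auto simp: dd_add dd_bounded_linear[OF bounded_linear_scaleR_right])

text \<open>
  For \<open>s = 1\<close> and \<open>s = - 1\<close> this is the (1,0)- and the (0,1)-derivative with respect to the complex
  structures \<open>J\<close> on the domain and \<open>K\<close> on the target.
\<close>

definition wd :: "'a::real_normed_vector set \<Rightarrow> ('a \<Rightarrow> 'a) \<Rightarrow> ('b \<Rightarrow> 'b) \<Rightarrow> real \<Rightarrow> 'a \<Rightarrow>
    ('a \<Rightarrow> 'b::real_normed_vector) \<Rightarrow> 'a \<Rightarrow> 'b" where
  "wd U J K s v F = (\<lambda>x. (1 / 2) *\<^sub>R (dd U v F x - s *\<^sub>R K (dd U (J v) F x)))"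

text \<open>\<open>K\<close> is kept apart from \<open>J\<close> because two targets occur: the
  model space itself with \<open>K = J\<close>, and the complex numbers with multiplication by
  \<open>\<i>\<close>.\<close>

locale wirtinger =
  fixes U :: "'a::euclidean_space set" and J :: "'a \<Rightarrow> 'a" and K :: "'b::euclidean_space \<Rightarrow> 'b"
  assumes open_U: "open U"
    and linear_J: "linear J" and J_J [simp]: "J (J v) = - v"
    and linear_K: "linear K" and K_K [simp]: "K (K y) = - y"
begin

abbreviation "sm \<equiv> smooth_on U"

abbreviation "W \<equiv> wd U J K"

lemma bl_K: "bounded_linear K"
  using linear_K linear_conv_bounded_linear by blast

lemmas K_simps [simp] = linear_add[OF linear_K] linear_diff[OF linear_K] linear_neg[OF linear_K]
  linear_cmul[OF linear_K] linear_0[OF linear_K]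

lemmas J_simps [simp] = linear_add[OF linear_J] linear_diff[OF linear_J] linear_neg[OF linear_J]
  linear_cmul[OF linear_J] linear_0[OF linear_J]

lemma sm_K: "sm F \<Longrightarrow> sm (\<lambda>x. K (F x))"
  by (rule smooth_on_bounded_linear[OF bl_K])

lemma sm_W: "sm F \<Longrightarrow> sm (W s v F)"
  unfolding wd_def by (intro smooth_on_cscaleR smooth_on_diff smooth_on_dd sm_K)

lemma W_cong: "(\<And>y. y \<in> U \<Longrightarrow> F y = G y) \<Longrightarrow> W s v F = W s v G"
  using dd_cong[OF open_U, of F G] by (simp add: wd_def)

lemma lin_op_W: "lin_op U (W s v)"
proof (rule lin_opI)
  fix F G :: "'a \<Rightarrow> 'b" assume "sm F" "sm G"
  then show "W s v (\<lambda>x. F x + G x) = (\<lambda>x. W s v F x + W s v G x)"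
    by (simp add: wd_def dd_add algebra_simps)
next
  fix c and F :: "'a \<Rightarrow> 'b" assume "sm F"
  then show "W s v (\<lambda>x. c *\<^sub>R F x) = (\<lambda>x. c *\<^sub>R W s v F x)"
    by (simp add: wd_def dd_bounded_linear[OF bounded_linear_scaleR_right] algebra_simps)
qed (rule sm_W)

lemma W_add: "sm F \<Longrightarrow> sm G \<Longrightarrow> W s v (\<lambda>x. F x + G x) = (\<lambda>x. W s v F x + W s v G x)"
  by (rule lin_op_add[OF lin_op_W])

lemma W_linear:
  assumes "linear M" "\<And>y. M (K y) = K (M y)" "sm F"
  shows "W s v (\<lambda>x. M (F x)) = (\<lambda>x. M (W s v F x))"
proof -
  have M: "bounded_linear M" using assms(1) linear_conv_bounded_linear by blast
  show ?thesis using assms(2)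
    by (simp add: wd_def dd_bounded_linear[OF M assms(3)] linear_diff[OF assms(1)] linear_cmul[OF assms(1)])
qed

text \<open>Moving a conjugate linear map out of the derivative reverses the sign in front of
  \<open>K\<close>, hence exchanges the types (1,0) and (0,1).\<close>

lemma W_antilinear:
  assumes "linear M" "\<And>y. M (K y) = - K (M y)" "sm F"
  shows "W s v (\<lambda>x. M (F x)) = (\<lambda>x. M (W (- s) v F x))"
proof -
  have M: "bounded_linear M" using assms(1) linear_conv_bounded_linear by blast
  show ?thesis using assms(2)
    by (simp add: wd_def dd_bounded_linear[OF M assms(3)] linear_add[OF assms(1)] linear_diff[OF assms(1)] linear_cmul[OF assms(1)])
qed

lemma W_K: "sm F \<Longrightarrow> W s v (\<lambda>x. K (F x)) = (\<lambda>x. K (W s v F x))"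
  by (rule W_linear[OF linear_K refl])

text \<open>The last two terms together are a complex derivative of \<open>c\<close> acting on
  \<open>F\<close> through \<open>K\<close>; real scalars force them to be written apart.\<close>

lemma W_scalar:
  fixes c :: "'a \<Rightarrow> real"
  assumes "sm F" "smooth_on U c"
  shows "W s v (\<lambda>x. c x *\<^sub>R F x) = (\<lambda>x. c x *\<^sub>R W s v F x + (1 / 2 * dd U v c x) *\<^sub>R F x
    + (- s / 2 * dd U (J v) c x) *\<^sub>R K (F x))"
  by (simp add: wd_def dd_scaleR assms algebra_simps)

lemma W_commute:
  assumes "sm F"
  shows "W s v (W t w F) = W t w (W s v F)"
proof -
  have e: "dd U v (W t w F) = (\<lambda>x. (1/2) *\<^sub>R (dd U v (dd U w F) x - t *\<^sub>R K (dd U v (dd U (J w) F) x)))" for v w t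
  proof -
    have "dd U v (W t w F) = (\<lambda>x. (1/2) *\<^sub>R dd U v (\<lambda>x. dd U w F x - t *\<^sub>R K (dd U (J w) F x)) x)"
      unfolding wd_def by (rule dd_bounded_linear[OF bounded_linear_scaleR_right])
        (intro smooth_on_diff smooth_on_dd assms smooth_on_cscaleR sm_K)
    also have "dd U v (\<lambda>x. dd U w F x - t *\<^sub>R K (dd U (J w) F x)) =
       (\<lambda>x. dd U v (dd U w F) x - dd U v (\<lambda>x. t *\<^sub>R K (dd U (J w) F x)) x)"
      by (rule dd_diff) (intro smooth_on_diff smooth_on_dd assms smooth_on_cscaleR sm_K)+
    also have "dd U v (\<lambda>x. t *\<^sub>R K (dd U (J w) F x)) = (\<lambda>x. t *\<^sub>R dd U v (\<lambda>x. K (dd U (J w) F x)) x)"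
      by (rule dd_bounded_linear[OF bounded_linear_scaleR_right])
        (intro smooth_on_diff smooth_on_dd assms smooth_on_cscaleR sm_K)
    also have "dd U v (\<lambda>x. K (dd U (J w) F x)) = (\<lambda>x. K (dd U v (dd U (J w) F) x))"
      by (rule dd_bounded_linear[OF bl_K]) (intro smooth_on_dd assms)
    finally show ?thesis .
  qed
  show ?thesis
    by (subst wd_def, subst (2) wd_def) (simp add: e dd_commute[OF assms, of _ w] dd_commute[OF assms, of _ "J w"] algebra_simps)
qed

lemma dd_eq_W: "dd U v F = (\<lambda>x. W 1 v F x + W (- 1) v F x)"
  by (auto simp: wd_def fun_eq_iff algebra_simps scaleR_2[symmetric])

lemma W_vec_add: "sm F \<Longrightarrow> W s (v + w) F = (\<lambda>x. W s v F x + W s w F x)"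
  by (simp add: wd_def dd_vec_add algebra_simps)

lemma W_vec_scaleR: "sm F \<Longrightarrow> W s (c *\<^sub>R v) F = (\<lambda>x. c *\<^sub>R W s v F x)"
  by (simp add: wd_def dd_vec_scaleR algebra_simps)

lemma W_vec_J: "sm F \<Longrightarrow> s * s = 1 \<Longrightarrow> W s (J v) F = (\<lambda>x. s *\<^sub>R K (W s v F x))"
  by (simp add: wd_def dd_vec_minus algebra_simps)

lemma sm_Wn: "sm F \<Longrightarrow> sm ((W s v ^^ n) F)"
  by (rule lin_op_smooth[OF lin_op_funpow[OF lin_op_W]])

lemma Wn_W_commute: "sm F \<Longrightarrow> (W s v ^^ n) (W t w F) = W t w ((W s v ^^ n) F)"
  by (rule funpow_commute_on[of sm]) (auto intro: sm_W W_commute)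

lemma Wn_Wm_commute: "sm F \<Longrightarrow> (W s v ^^ n) ((W t w ^^ m) F) = (W t w ^^ m) ((W s v ^^ n) F)"
proof (induction m)
  case (Suc m) then show ?case using Wn_W_commute[OF sm_Wn] by simp
qed simp

text \<open>
  \<open>NL s X l F\<close> says that all jets along the complex line through \<open>X\<close> with at most \<open>l\<close> derivatives of
  type \<open>- s\<close> vanish; \<open>pure\<close> is the case \<open>l = 0\<close>.
\<close>

definition pure :: "real \<Rightarrow> 'a \<Rightarrow> ('a \<Rightarrow> 'b) \<Rightarrow> bool" where
  "pure s X F \<longleftrightarrow> (\<forall>n. (W s X ^^ n) F 0 = 0)"

definition NL :: "real \<Rightarrow> 'a \<Rightarrow> nat \<Rightarrow> ('a \<Rightarrow> 'b) \<Rightarrow> bool" where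
  "NL s X l F \<longleftrightarrow> (\<forall>j\<le>l. pure s X ((W (- s) X ^^ j) F))"

lemma pure_add: "sm F \<Longrightarrow> sm G \<Longrightarrow> pure s X F \<Longrightarrow> pure s X G \<Longrightarrow> pure s X (\<lambda>x. F x + G x)"
  by (simp add: pure_def lin_op_add[OF lin_op_funpow[OF lin_op_W]])

lemma Wn_linear:
  assumes "linear M" "\<And>y. M (K y) = K (M y)" "sm F"
  shows "(W s v ^^ n) (\<lambda>x. M (F x)) = (\<lambda>x. M ((W s v ^^ n) F x))"
proof (induction n)
  case (Suc n) then show ?case by (simp add: W_linear[OF assms(1,2) sm_Wn[OF assms(3)]])
qed simp

lemma pure_linear:
  assumes "linear M" "\<And>y. M (K y) = K (M y)" "sm F" "pure s X F"
  shows "pure s X (\<lambda>x. M (F x))"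
  using assms(4) unfolding pure_def Wn_linear[OF assms(1-3)] by (simp add: linear_0[OF assms(1)])

lemma pure_W: "pure s X F \<Longrightarrow> pure s X (W s X F)"
  unfolding pure_def by (metis funpow_Suc_right o_apply)

lemma pure_cong:
  assumes "0 \<in> U" "\<And>y. y \<in> U \<Longrightarrow> F y = G y" "pure s X F"
  shows "pure s X G"
proof -
  have "(W s X ^^ n) G 0 = (W s X ^^ n) F 0" for n
  proof (cases n)
    case (Suc m)
    have "W s X G = W s X F" by (rule W_cong) (simp add: assms(2))
    then show ?thesis unfolding Suc funpow_Suc_right o_apply by simp
  qed (use assms(1,2) in simp)
  then show ?thesis using assms(3) by (simp add: pure_def)
qed

text \<open>One derivative of the product is a sum of smooth real functions times
  \<open>W s X F\<close>, \<open>F\<close> and \<open>K F\<close>, and all three are pure again. The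
  induction therefore runs over all \<open>c\<close> and \<open>F\<close> at once.\<close>

lemma pure_scalar:
  assumes "smooth_on U c" "sm F" "pure s X F"
  shows "pure s X (\<lambda>x. c x *\<^sub>R F x)"
proof -
  have "(W s X ^^ n) (\<lambda>x. c x *\<^sub>R F x) 0 = 0" for n
    using assms
  proof (induction n arbitrary: c F)
    case 0 then show ?case unfolding pure_def by (metis funpow_0 scaleR_zero_right)
  next
    case (Suc n)
    let ?a = "\<lambda>x. c x *\<^sub>R W s X F x" and ?b = "\<lambda>x. (1 / 2 * dd U X c x) *\<^sub>R F x"
      and ?d = "\<lambda>x. (- s / 2 * dd U (J X) c x) *\<^sub>R K (F x)"
    have c1: "smooth_on U (\<lambda>x. 1 / 2 * dd U X c x)" "smooth_on U (\<lambda>x. - s / 2 * dd U (J X) c x)"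
      by (intro smooth_on_cmult smooth_on_dd Suc.prems(1))+
    have s: "sm ?a" "sm ?b" "sm ?d"
      by (intro smooth_on_scaleR c1 Suc.prems sm_W sm_K)+
    have "(W s X ^^ n) ?a 0 = 0"
      by (rule Suc.IH) (use Suc.prems in \<open>auto intro: sm_W pure_W\<close>)
    moreover have "(W s X ^^ n) ?b 0 = 0"
      by (rule Suc.IH) (use Suc.prems c1 in auto)
    moreover have "(W s X ^^ n) ?d 0 = 0"
      by (rule Suc.IH) (use Suc.prems c1 in \<open>auto intro: sm_K pure_linear[OF linear_K refl]\<close>)
    moreover have "(W s X ^^ Suc n) (\<lambda>x. c x *\<^sub>R F x) 0 = (W s X ^^ n) ?a 0 + (W s X ^^ n) ?b 0 + (W s X ^^ n) ?d 0"
      unfolding funpow_Suc_right o_apply W_scalar[OF Suc.prems(2,1)]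
      unfolding lin_op_add[OF lin_op_funpow[OF lin_op_W] smooth_on_add[OF s(1,2)] s(3)]
        lin_op_add[OF lin_op_funpow[OF lin_op_W] s(1,2)] ..
    ultimately show ?case by simp
  qed
  then show ?thesis by (simp add: pure_def)
qed

lemma pure_diff: "sm F \<Longrightarrow> sm G \<Longrightarrow> pure s X F \<Longrightarrow> pure s X G \<Longrightarrow> pure s X (\<lambda>x. F x - G x)"
  by (simp add: pure_def lin_op_diff[OF lin_op_funpow[OF lin_op_W]])

lemma pure_sum:
  assumes "\<And>i. i \<in> I \<Longrightarrow> sm (F i)" "\<And>i. i \<in> I \<Longrightarrow> pure s X (F i)"
  shows "pure s X (\<lambda>x. \<Sum>i\<in>I. F i x)"
  using assms by (simp add: pure_def lin_op_sum[OF lin_op_funpow[OF lin_op_W] open_U])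

lemma NL_0: "NL s X 0 F \<longleftrightarrow> pure s X F"
  by (simp add: NL_def)

lemma NL_Suc: "NL s X (Suc l) F \<longleftrightarrow> pure s X F \<and> NL s X l (W (- s) X F)"
proof -
  have "NL s X (Suc l) F \<longleftrightarrow> pure s X F \<and> (\<forall>j\<le>l. pure s X ((W (- s) X ^^ Suc j) F))"
    unfolding NL_def by (metis Suc_le_mono funpow_0 le0 not0_implies_Suc)
  also have "\<dots> \<longleftrightarrow> pure s X F \<and> NL s X l (W (- s) X F)"
    unfolding NL_def by (simp only: funpow_Suc_right o_apply)
  finally show ?thesis .
qed

lemma NL_mono: "NL s X l F \<Longrightarrow> k \<le> l \<Longrightarrow> NL s X k F"
  by (simp add: NL_def)

lemma NL_add: "sm F \<Longrightarrow> sm G \<Longrightarrow> NL s X l F \<Longrightarrow> NL s X l G \<Longrightarrow> NL s X l (\<lambda>x. F x + G x)"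
  by (simp add: NL_def lin_op_add[OF lin_op_funpow[OF lin_op_W]] pure_add sm_Wn)

lemma NL_diff: "sm F \<Longrightarrow> sm G \<Longrightarrow> NL s X l F \<Longrightarrow> NL s X l G \<Longrightarrow> NL s X l (\<lambda>x. F x - G x)"
  by (simp add: NL_def lin_op_diff[OF lin_op_funpow[OF lin_op_W]] pure_diff sm_Wn)

lemma NL_linear:
  assumes "linear M" "\<And>y. M (K y) = K (M y)" "sm F" "NL s X l F"
  shows "NL s X l (\<lambda>x. M (F x))"
  using assms(4) unfolding NL_def Wn_linear[OF assms(1-3)]
  by (auto intro!: pure_linear[OF assms(1,2)] sm_Wn assms(3))

lemma NL_scalar:
  assumes "smooth_on U c" "sm F" "NL s X l F"
  shows "NL s X l (\<lambda>x. c x *\<^sub>R F x)"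
  using assms
proof (induction l arbitrary: c F)
  case 0 then show ?case by (simp add: NL_0 pure_scalar)
next
  case (Suc l)
  have c1: "smooth_on U (\<lambda>x. 1 / 2 * dd U X c x)" "smooth_on U (\<lambda>x. - (- s) / 2 * dd U (J X) c x)"
    by (intro smooth_on_cmult smooth_on_dd Suc.prems(1))+
  have "NL s X l (W (- s) X (\<lambda>x. c x *\<^sub>R F x))"
    unfolding W_scalar[OF Suc.prems(2,1)]
  proof (intro NL_add smooth_on_add smooth_on_scaleR Suc.IH)
    show "NL s X l (W (- s) X F)" using Suc.prems(3) by (simp add: NL_Suc)
    show N: "NL s X l F" by (rule NL_mono[OF Suc.prems(3)]) simp
    show "NL s X l (\<lambda>x. K (F x))" by (rule NL_linear[OF linear_K refl Suc.prems(2) N])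
  qed (use Suc.prems c1 in \<open>auto intro: sm_W sm_K\<close>)
  moreover have "pure s X (\<lambda>x. c x *\<^sub>R F x)"
    by (rule pure_scalar) (use Suc.prems in \<open>auto simp: NL_Suc\<close>)
  ultimately show ?case by (simp add: NL_Suc)
qed

lemma NL_sum:
  assumes "\<And>i. i \<in> I \<Longrightarrow> sm (F i)" "\<And>i. i \<in> I \<Longrightarrow> NL s X l (F i)"
  shows "NL s X l (\<lambda>x. \<Sum>i\<in>I. F i x)"
  using assms by (simp add: NL_def lin_op_sum[OF lin_op_funpow[OF lin_op_W] open_U] pure_sum sm_Wn)

lemma NL_cong:
  assumes "0 \<in> U" "\<And>y. y \<in> U \<Longrightarrow> F y = G y" "NL s X l F"
  shows "NL s X l G"
proof -
  have "pure s X ((W (- s) X ^^ j) G)" if "pure s X ((W (- s) X ^^ j) F)" for j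
  proof (cases j)
    case 0 then show ?thesis using pure_cong[OF assms(1,2)] that by simp
  next
    case (Suc m)
    have "W (- s) X G = W (- s) X F" by (rule W_cong) (simp add: assms(2))
    then show ?thesis using that unfolding Suc funpow_Suc_right o_apply by simp
  qed
  then show ?thesis using assms(3) by (auto simp: NL_def)
qed

text \<open>
  The unique continuation principle behind all vanishing statements: pure jets of type \<open>s\<close> together
  with a linear system for the derivatives of type \<open>- s\<close> determine all jets.
\<close>

lemma NL_ode:
  assumes "\<And>i. i \<in> I \<Longrightarrow> pure s X (F i)"
    and "\<And>l i. (\<And>j. j \<in> I \<Longrightarrow> NL s X l (F j)) \<Longrightarrow> i \<in> I \<Longrightarrow> NL s X l (W (- s) X (F i))"
    and "i \<in> I"
  shows "NL s X l (F i)"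
  using assms(3)
proof (induction l arbitrary: i)
  case 0 then show ?case using assms(1) by (simp add: NL_0)
next
  case (Suc l) then show ?case using assms(1,2) by (simp add: NL_Suc)
qed

definition flat :: "'a \<Rightarrow> ('a \<Rightarrow> 'b) \<Rightarrow> bool" where
  "flat X F \<longleftrightarrow> (\<forall>n m. (W 1 X ^^ n) ((W (- 1) X ^^ m) F) 0 = 0)"

lemma flat_iff_NL: "flat X F \<longleftrightarrow> (\<forall>l. NL 1 X l F)"
  unfolding flat_def NL_def pure_def by auto

lemma flat_iff_NL': "sm F \<Longrightarrow> flat X F \<longleftrightarrow> (\<forall>l. NL (- 1) X l F)"
  unfolding flat_def NL_def pure_def by (auto simp: Wn_Wm_commute[where s = "-1" and t = 1])

lemma flat_dd_vanish:
  assumes "sm F" "flat X F"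
  shows "(dd U X ^^ n) F 0 = 0"
  using assms
proof (induction n arbitrary: F)
  case 0 then show ?case unfolding flat_def by (metis funpow_0)
next
  case (Suc n)
  have 1: "flat X (W (- 1) X F)"
    unfolding flat_def
  proof (intro allI)
    fix k m
    show "(W 1 X ^^ k) ((W (- 1) X ^^ m) (W (- 1) X F)) 0 = 0"
      using Suc.prems(2)[unfolded flat_def, rule_format, of k "Suc m"]
      unfolding funpow_Suc_right o_apply .
  qed
  have 2: "flat X (W 1 X F)"
    unfolding flat_def
  proof (intro allI)
    fix k m
    show "(W 1 X ^^ k) ((W (- 1) X ^^ m) (W 1 X F)) 0 = 0"
      using Suc.prems(2)[unfolded flat_def, rule_format, of "Suc k" m]
      unfolding funpow_Suc_right o_apply Wn_W_commute[OF Suc.prems(1), symmetric] .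
  qed
  have "(dd U X ^^ Suc n) F 0 = (dd U X ^^ n) (\<lambda>x. W 1 X F x + W (- 1) X F x) 0"
    unfolding funpow_Suc_right o_apply dd_eq_W ..
  also have "\<dots> = (dd U X ^^ n) (W 1 X F) 0 + (dd U X ^^ n) (W (- 1) X F) 0"
    by (simp add: lin_op_add[OF lin_op_funpow[OF lin_op_dd] sm_W[OF Suc.prems(1)] sm_W[OF Suc.prems(1)]])
  also have "\<dots> = 0"
    using Suc.IH[OF sm_W[OF Suc.prems(1)] 1] Suc.IH[OF sm_W[OF Suc.prems(1)] 2] by simp
  finally show ?case .
qed

end

section \<open>Vanishing to infinite order along all real lines through the origin\<close>

definition flat0 :: "'a::euclidean_space set \<Rightarrow> ('a \<Rightarrow> 'b::euclidean_space) \<Rightarrow> bool" where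
  "flat0 U F \<longleftrightarrow> (\<forall>X n. (dd U X ^^ n) F 0 = 0)"

lemma flat0_add: "smooth_on U F \<Longrightarrow> smooth_on U G \<Longrightarrow> flat0 U F \<Longrightarrow> flat0 U G \<Longrightarrow> flat0 U (\<lambda>x. F x + G x)"
  by (simp add: flat0_def lin_op_add[OF lin_op_funpow[OF lin_op_dd]])

lemma flat0_diff: "smooth_on U F \<Longrightarrow> smooth_on U G \<Longrightarrow> flat0 U F \<Longrightarrow> flat0 U G \<Longrightarrow> flat0 U (\<lambda>x. F x - G x)"
  by (simp add: flat0_def lin_op_diff[OF lin_op_funpow[OF lin_op_dd]])

lemma flat0_sum:
  assumes "open U" "\<And>i. i \<in> I \<Longrightarrow> smooth_on U (F i)" "\<And>i. i \<in> I \<Longrightarrow> flat0 U (F i)"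
  shows "flat0 U (\<lambda>x. \<Sum>i\<in>I. F i x)"
  using assms by (simp add: flat0_def lin_op_sum[OF lin_op_funpow[OF lin_op_dd]])

lemma ddn_bounded_linear:
  assumes "bounded_linear M" "smooth_on U F"
  shows "(dd U X ^^ n) (\<lambda>x. M (F x)) = (\<lambda>x. M ((dd U X ^^ n) F x))"
proof (induction n)
  case (Suc n)
  then show ?case
    using dd_bounded_linear[OF assms(1) lin_op_smooth[OF lin_op_funpow[OF lin_op_dd] assms(2)]] by simp
qed simp

lemma flat0_linear:
  "linear M \<Longrightarrow> smooth_on U F \<Longrightarrow> flat0 U F \<Longrightarrow> flat0 U (\<lambda>x. M (F x))"
  by (simp add: flat0_def ddn_bounded_linear linear_conv_bounded_linear linear_0)

lemma flat0_cong:
  assumes "open U" "0 \<in> U" "\<And>y. y \<in> U \<Longrightarrow> F y = G y" "flat0 U F"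
  shows "flat0 U G"
proof -
  have "(dd U X ^^ n) G 0 = (dd U X ^^ n) F 0" for X n
  proof (cases n)
    case (Suc m)
    have "dd U X G = dd U X F" by (rule dd_cong[OF assms(1)]) (simp add: assms(3))
    then show ?thesis unfolding Suc funpow_Suc_right o_apply by simp
  qed (use assms(2,3) in simp)
  then show ?thesis using assms(4) by (simp add: flat0_def)
qed

lemma flat0_scalar:
  assumes "smooth_on U c" "smooth_on U F" "flat0 U F"
  shows "flat0 U (\<lambda>x. c x *\<^sub>R F x)"
proof -
  have "(dd U X ^^ n) (\<lambda>x. c x *\<^sub>R F x) 0 = 0" if "smooth_on U c" "smooth_on U F" "\<And>n. (dd U X ^^ n) F 0 = 0" for X n c and F :: "'a \<Rightarrow> 'b"
    using that
  proof (induction n arbitrary: c F)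
    case 0 then show ?case by (metis funpow_0 scaleR_zero_right)
  next
    case (Suc n)
    have s: "smooth_on U (\<lambda>x. c x *\<^sub>R dd U X F x)" "smooth_on U (\<lambda>x. dd U X c x *\<^sub>R F x)"
      by (intro smooth_on_scaleR smooth_on_dd Suc.prems)+
    have "(dd U X ^^ n) (\<lambda>x. c x *\<^sub>R dd U X F x) 0 = 0"
    proof (rule Suc.IH[OF Suc.prems(1) smooth_on_dd[OF Suc.prems(2)]])
      show "(dd U X ^^ n) (dd U X F) 0 = 0" for n
        using Suc.prems(3)[of "Suc n"] unfolding funpow_Suc_right o_apply .
    qed
    moreover have "(dd U X ^^ n) (\<lambda>x. dd U X c x *\<^sub>R F x) 0 = 0"
      by (rule Suc.IH[OF smooth_on_dd[OF Suc.prems(1)] Suc.prems(2,3)])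
    ultimately show ?case
      unfolding funpow_Suc_right o_apply dd_scaleR[OF Suc.prems(1,2)]
      by (simp add: lin_op_add[OF lin_op_funpow[OF lin_op_dd] s])
  qed
  then show ?thesis using assms by (simp add: flat0_def)
qed

text \<open>Only powers of a single directional derivative are known to vanish. Using this for the
  direction \<open>t b + X\<close> and comparing coefficients of \<open>t\<close> gives the mixed
  derivatives.\<close>

lemma flat0_dd:
  assumes F: "smooth_on U F" and fl: "flat0 U F"
  shows "flat0 U (dd U b F)"
  unfolding flat0_def
proof (intro allI)
  fix X n
  have "dd U b ((dd U X ^^ n) F) 0 = 0"
  proof (rule lin_op_polarize[OF lin_op_dd lin_op_dd smooth_on_open[OF F] F])
    show "dd U X (dd U b F) = dd U b (dd U X F)" if "smooth_on U F" for F :: "'a \<Rightarrow> 'b"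
      by (rule dd_commute[OF that])
    fix t
    \<comment> \<open>The operator \<open>t D_b + D_X\<close> equals the derivative along
      \<open>t b + X\<close> on smooth functions only, so smoothness of the iterates is carried
      through the induction.\<close>
    have "smooth_on U ((dd U (t *\<^sub>R b + X) ^^ k) F) \<and>
       ((\<lambda>F x. t *\<^sub>R dd U b F x + dd U X F x) ^^ k) F = (dd U (t *\<^sub>R b + X) ^^ k) F" for k
    proof (induction k)
      case (Suc k)
      then have "dd U (t *\<^sub>R b + X) ((dd U (t *\<^sub>R b + X) ^^ k) F) =
          (\<lambda>x. t *\<^sub>R dd U b ((dd U (t *\<^sub>R b + X) ^^ k) F) x + dd U X ((dd U (t *\<^sub>R b + X) ^^ k) F) x)"
        by (simp add: dd_vec_add dd_vec_scaleR)
      with Suc show ?case using smooth_on_dd[of U "(dd U (t *\<^sub>R b + X) ^^ k) F" "t *\<^sub>R b + X"] by simp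
    qed (simp add: F)
    then show "((\<lambda>F x. t *\<^sub>R dd U b F x + dd U X F x) ^^ Suc n) F 0 = 0"
      using fl by (metis flat0_def)
  qed
  then show "(dd U X ^^ n) (dd U b F) 0 = 0"
    using funpow_commute_on[of "smooth_on U" "dd U X" "dd U b" F n] F dd_commute by fastforce
qed

context wirtinger begin

lemma flat0I:
  assumes "sm F" "\<And>X. flat X F"
  shows "flat0 U F"
  using flat_dd_vanish[OF assms] by (simp add: flat0_def)

lemma flat0_W: "sm F \<Longrightarrow> flat0 U F \<Longrightarrow> flat0 U (W s v F)"
proof -
  assume F: "sm F" "flat0 U F"
  have 1: "flat0 U (\<lambda>x. s *\<^sub>R K (dd U (J v) F x))"
    by (rule flat0_linear[OF bounded_linear.linear[OF bounded_linear_scaleR_right] _ flat0_linear[OF linear_K]])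
      (use F in \<open>auto intro: flat0_dd sm_K\<close>)
  have "flat0 U (\<lambda>x. dd U v F x - s *\<^sub>R K (dd U (J v) F x))"
    by (rule flat0_diff[OF _ _ _ 1]) (use F in \<open>auto intro!: flat0_dd sm_K smooth_on_cscaleR\<close>)
  then show ?thesis unfolding wd_def
    by (intro flat0_linear[OF bounded_linear.linear[OF bounded_linear_scaleR_right]])
      (use F in \<open>auto intro!: sm_K smooth_on_cscaleR smooth_on_diff\<close>)
qed

lemma flat0_flat: "sm F \<Longrightarrow> flat0 U F \<Longrightarrow> flat X F"
proof -
  assume F: "sm F" "flat0 U F"
  have *: "sm ((W s X ^^ n) G) \<and> flat0 U ((W s X ^^ n) G)" if "sm G" "flat0 U G" for n s G
    using that by (induction n) (auto intro: sm_W flat0_W)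
  have "flat0 U ((W 1 X ^^ n) ((W (- 1) X ^^ m) F))" for n m
    using *[of "(W (- 1) X ^^ m) F" n 1] *[OF F, of m "-1"] by blast
  then show ?thesis
    unfolding flat_def flat0_def by (metis funpow_0)
qed

end

section \<open>Families of linear maps and polarization\<close>

lemma linear_basis_expansion:
  fixes M :: "'a::euclidean_space \<Rightarrow> 'b::real_vector"
  assumes "linear M"
  shows "M y = (\<Sum>i\<in>Basis. (y \<bullet> i) *\<^sub>R M i)"
proof -
  have "M y = M (\<Sum>i\<in>Basis. (y \<bullet> i) *\<^sub>R i)" by (simp add: euclidean_representation)
  also have "\<dots> = (\<Sum>i\<in>Basis. (y \<bullet> i) *\<^sub>R M i)"
    by (simp add: linear_sum[OF assms] linear_cmul[OF assms])
  finally show ?thesis .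
qed

lemma smooth_on_component: "smooth_on U Y \<Longrightarrow> smooth_on U (\<lambda>x. Y x \<bullet> i)"
  by (rule smooth_on_bounded_linear[OF bounded_linear_inner_left])

text \<open>A family of linear maps is encoded by its values on fixed vectors, without a normed
  space of linear maps. A basis expansion of \<open>Y\<close> leaves finitely many smooth
  functions.\<close>

lemma smooth_on_family:
  fixes Y :: "'a::real_normed_vector \<Rightarrow> 'c::euclidean_space"
  assumes "open U" "smooth_on U Y" "\<And>y. smooth_on U (\<lambda>x. \<Lambda> x y)" "\<And>x. x \<in> U \<Longrightarrow> linear (\<Lambda> x)"
  shows "smooth_on U (\<lambda>x. \<Lambda> x (Y x))"
proof -
  have "smooth_on U (\<lambda>x. \<Sum>i\<in>Basis. (Y x \<bullet> i) *\<^sub>R \<Lambda> x i)"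
    by (intro smooth_on_sum smooth_on_scaleR smooth_on_component assms)
  moreover have "(\<Sum>i\<in>Basis. (Y x \<bullet> i) *\<^sub>R \<Lambda> x i) = \<Lambda> x (Y x)" if "x \<in> U" for x
    using linear_basis_expansion[OF assms(4)[OF that], of "Y x"] by simp
  ultimately show ?thesis
    using smooth_on_cong[of U "\<lambda>x. \<Sum>i\<in>Basis. (Y x \<bullet> i) *\<^sub>R \<Lambda> x i" "\<lambda>x. \<Lambda> x (Y x)"] by blast
qed

lemma dd_family:
  fixes Y :: "'a::real_normed_vector \<Rightarrow> 'c::euclidean_space"
  assumes "open U" "smooth_on U Y" "\<And>y. smooth_on U (\<lambda>x. \<Lambda> x y)" "\<And>x. x \<in> U \<Longrightarrow> linear (\<Lambda> x)"
    and "p \<in> U"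
  shows "dd U v (\<lambda>x. \<Lambda> x (Y x)) p = dd U v (\<lambda>x. \<Lambda> x (Y p)) p + \<Lambda> p (dd U v Y p)"
proof -
  have sc: "smooth_on U (\<lambda>x. (Y x \<bullet> i) *\<^sub>R \<Lambda> x i)" for i
    by (intro smooth_on_scaleR smooth_on_component assms)
  have e: "dd U v (\<lambda>x. \<Lambda> x (Y x)) = dd U v (\<lambda>x. \<Sum>i\<in>Basis. (Y x \<bullet> i) *\<^sub>R \<Lambda> x i)"
    by (rule dd_cong[OF assms(1)]) (rule linear_basis_expansion[OF assms(4)])
  have e2: "dd U v (\<lambda>x. \<Lambda> x y) = dd U v (\<lambda>x. \<Sum>i\<in>Basis. (y \<bullet> i) *\<^sub>R \<Lambda> x i)" for y
    by (rule dd_cong[OF assms(1)]) (rule linear_basis_expansion[OF assms(4)])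
  have e3: "dd U v (\<lambda>x. (Y x \<bullet> i) *\<^sub>R \<Lambda> x i) p = (Y p \<bullet> i) *\<^sub>R dd U v (\<lambda>x. \<Lambda> x i) p + (dd U v Y p \<bullet> i) *\<^sub>R \<Lambda> p i" for i
    by (simp add: dd_scaleR smooth_on_component assms dd_bounded_linear[OF bounded_linear_inner_left])
  have e4: "dd U v (\<lambda>x. \<Lambda> x y) p = (\<Sum>i\<in>Basis. (y \<bullet> i) *\<^sub>R dd U v (\<lambda>x. \<Lambda> x i) p)" for y
    unfolding e2[of y] by (subst dd_sum)
      (auto simp: dd_bounded_linear[OF bounded_linear_scaleR_right] assms intro: smooth_on_cscaleR)
  show ?thesis
    unfolding e dd_sum[OF sc assms(1)] e3 e4[of "Y p"] sum.distrib
      linear_basis_expansion[OF assms(4)[OF assms(5)], of "dd U v Y p", symmetric] ..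
qed

context wirtinger begin

lemma W_family_linear:
  fixes Y :: "'a \<Rightarrow> 'b"
  assumes "sm Y" "\<And>y. sm (\<lambda>x. \<Lambda> x y)" "\<And>x. x \<in> U \<Longrightarrow> linear (\<Lambda> x)"
    and "\<And>x y. x \<in> U \<Longrightarrow> \<Lambda> x (K y) = K (\<Lambda> x y)" and p: "p \<in> U"
  shows "W s v (\<lambda>x. \<Lambda> x (Y x)) p = W s v (\<lambda>x. \<Lambda> x (Y p)) p + \<Lambda> p (W s v Y p)"
proof -
  have e: "dd U v (\<lambda>x. \<Lambda> x (Y x)) p = dd U v (\<lambda>x. \<Lambda> x (Y p)) p + \<Lambda> p (dd U v Y p)" for v
    by (rule dd_family[OF open_U assms(1-3) p])
  have "\<Lambda> p ((1 / 2) *\<^sub>R (a - s *\<^sub>R K b)) = (1 / 2) *\<^sub>R (\<Lambda> p a - s *\<^sub>R K (\<Lambda> p b))" for a b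
    using assms(4)[OF p] by (simp add: linear_diff[OF assms(3)[OF p]] linear_cmul[OF assms(3)[OF p]])
  then show ?thesis unfolding wd_def e by (simp add: algebra_simps)
qed

text \<open>The type changes on \<open>Y\<close> only: the conjugate linear map
  \<open>\<Lambda> p\<close> is moved across the derivative of \<open>Y\<close>, not across that of
  the family.\<close>

lemma W_family_antilinear:
  fixes Y :: "'a \<Rightarrow> 'b"
  assumes "sm Y" "\<And>y. sm (\<lambda>x. \<Lambda> x y)" "\<And>x. x \<in> U \<Longrightarrow> linear (\<Lambda> x)"
    and "\<And>x y. x \<in> U \<Longrightarrow> \<Lambda> x (K y) = - K (\<Lambda> x y)" and p: "p \<in> U"
  shows "W s v (\<lambda>x. \<Lambda> x (Y x)) p = W s v (\<lambda>x. \<Lambda> x (Y p)) p + \<Lambda> p (W (- s) v Y p)"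
proof -
  have e: "dd U v (\<lambda>x. \<Lambda> x (Y x)) p = dd U v (\<lambda>x. \<Lambda> x (Y p)) p + \<Lambda> p (dd U v Y p)" for v
    by (rule dd_family[OF open_U assms(1-3) p])
  show ?thesis unfolding wd_def e
  using assms(4)[OF p] linear_add[OF assms(3)[OF p]] linear_diff[OF assms(3)[OF p]] linear_cmul[OF assms(3)[OF p]]
  by (simp add: algebra_simps)
qed

lemma W_const [simp]: "W s v (\<lambda>x. c) = (\<lambda>x. 0)"
  by (simp add: wd_def)

lemma W_bilinear:
  fixes F H :: "'a \<Rightarrow> 'b"
  assumes "bilinear M" "\<And>y z. M (K y) z = K (M y z)" "\<And>y z. M y (K z) = K (M y z)" "sm F" "sm H"
  shows "W s v (\<lambda>x. M (F x) (H x)) = (\<lambda>x. M (W s v F x) (H x) + M (F x) (W s v H x))"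
proof -
  have M: "bounded_bilinear M" using assms(1) bilinear_conv_bounded_bilinear by blast
  show ?thesis
  proof
    fix x
    have 1: "M ((1 / 2) *\<^sub>R (a - s *\<^sub>R K b)) c = (1 / 2) *\<^sub>R (M a c - s *\<^sub>R K (M b c))" for a b c
      by (simp only: assms(2) bilinear_lsub[OF assms(1)] bilinear_lmul[OF assms(1)])
    have 2: "M c ((1 / 2) *\<^sub>R (a - s *\<^sub>R K b)) = (1 / 2) *\<^sub>R (M c a - s *\<^sub>R K (M c b))" for a b c
      by (simp only: assms(3) bilinear_rsub[OF assms(1)] bilinear_rmul[OF assms(1)])
    show "W s v (\<lambda>x. M (F x) (H x)) x = M (W s v F x) (H x) + M (F x) (W s v H x)"
      unfolding wd_def dd_bounded_bilinear[OF M assms(4,5)] 1 2 by (simp add: algebra_simps)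
  qed
qed

text \<open>Purity survives a variable argument whatever the jets of \<open>Y\<close> are, because
  the coordinates of \<open>Y\<close> are just smooth coefficients.\<close>

lemma pure_family:
  fixes Y :: "'a \<Rightarrow> 'c::euclidean_space"
  assumes "0 \<in> U" "sm Y" "\<And>y. sm (\<lambda>x. \<Lambda> x y)" "\<And>x. x \<in> U \<Longrightarrow> linear (\<Lambda> x)"
    and "\<And>y. pure s X (\<lambda>x. \<Lambda> x y)"
  shows "pure s X (\<lambda>x. \<Lambda> x (Y x))"
proof (rule pure_cong[OF assms(1)])
  show "pure s X (\<lambda>x. \<Sum>i\<in>Basis. (Y x \<bullet> i) *\<^sub>R \<Lambda> x i)"
    by (intro pure_sum pure_scalar smooth_on_scaleR smooth_on_component assms)
  show "(\<Sum>i\<in>Basis. (Y x \<bullet> i) *\<^sub>R \<Lambda> x i) = \<Lambda> x (Y x)" if "x \<in> U" for x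
    using linear_basis_expansion[OF assms(4)[OF that], of "Y x"] by simp
qed

lemma NL_family:
  fixes Y :: "'a \<Rightarrow> 'c::euclidean_space"
  assumes "0 \<in> U" "sm Y" "\<And>y. sm (\<lambda>x. \<Lambda> x y)" "\<And>x. x \<in> U \<Longrightarrow> linear (\<Lambda> x)"
    and "\<And>y. NL s X l (\<lambda>x. \<Lambda> x y)"
  shows "NL s X l (\<lambda>x. \<Lambda> x (Y x))"
proof (rule NL_cong[OF assms(1)])
  show "NL s X l (\<lambda>x. \<Sum>i\<in>Basis. (Y x \<bullet> i) *\<^sub>R \<Lambda> x i)"
    by (intro NL_sum NL_scalar smooth_on_scaleR smooth_on_component assms)
  show "(\<Sum>i\<in>Basis. (Y x \<bullet> i) *\<^sub>R \<Lambda> x i) = \<Lambda> x (Y x)" if "x \<in> U" for x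
    using linear_basis_expansion[OF assms(4)[OF that], of "Y x"] by simp
qed

section \<open>Polarization of jets by complex type\<close>

lemma W_polarize:
  assumes F: "sm F" and van: "\<And>X. (W s X ^^ Suc n) F 0 = 0"
  shows "(W s X ^^ n) (W s x F) 0 = 0"
proof -
  have "W s x ((W s X ^^ n) F) 0 = 0"
  proof (rule lin_op_polarize[OF lin_op_W lin_op_W open_U F])
    show "W s X (W s x F) = W s x (W s X F)" if "sm F" for F
      by (rule W_commute[OF that])
    fix t
    have "sm ((W s (t *\<^sub>R x + X) ^^ k) F) \<and>
       ((\<lambda>F y. t *\<^sub>R W s x F y + W s X F y) ^^ k) F = (W s (t *\<^sub>R x + X) ^^ k) F" for k
    proof (induction k)
      case (Suc k)
      then have "W s (t *\<^sub>R x + X) ((W s (t *\<^sub>R x + X) ^^ k) F) =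
          (\<lambda>y. t *\<^sub>R W s x ((W s (t *\<^sub>R x + X) ^^ k) F) y + W s X ((W s (t *\<^sub>R x + X) ^^ k) F) y)"
        by (simp add: W_vec_add W_vec_scaleR)
      with Suc show ?case using sm_W[of "(W s (t *\<^sub>R x + X) ^^ k) F" s "t *\<^sub>R x + X"] by simp
    qed (simp add: F)
    then have "((\<lambda>F y. t *\<^sub>R W s x F y + W s X F y) ^^ Suc n) F = (W s (t *\<^sub>R x + X) ^^ Suc n) F"
      by blast
    then show "((\<lambda>F y. t *\<^sub>R W s x F y + W s X F y) ^^ Suc n) F 0 = 0"
      by (simp only: van)
  qed
  then show ?thesis by (simp add: Wn_W_commute[OF F])
qed

text \<open>Coefficient of the first power of \<open>t\<close> after replacing \<open>X\<close> by
  \<open>t x + X\<close>. Real polarization alone controls only this sum of two terms.\<close>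

lemma W_mixed_polarize_aux:
  assumes F: "sm F" and van: "\<And>X. W s X ((W r X ^^ n) F) 0 = 0"
  shows "real n *\<^sub>R W s X (W r x ((W r X ^^ (n - 1)) F)) 0 + W s x ((W r X ^^ n) F) 0 = 0"
proof -
  define G where "G k = (W r x ^^ k) ((W r X ^^ (n - k)) F)" for k
  have G: "sm (G k)" for k unfolding G_def by (intro sm_Wn F)
  have expand: "(W r (t *\<^sub>R x + X) ^^ n) F = (\<lambda>y. \<Sum>k\<le>n. (real (n choose k) * t ^ k) *\<^sub>R G k y)" for t
  proof -
    have "sm ((W r (t *\<^sub>R x + X) ^^ k) F) \<and>
       ((\<lambda>F y. t *\<^sub>R W r x F y + W r X F y) ^^ k) F = (W r (t *\<^sub>R x + X) ^^ k) F" for k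
    proof (induction k)
      case (Suc k)
      then have "W r (t *\<^sub>R x + X) ((W r (t *\<^sub>R x + X) ^^ k) F) =
          (\<lambda>y. t *\<^sub>R W r x ((W r (t *\<^sub>R x + X) ^^ k) F) y + W r X ((W r (t *\<^sub>R x + X) ^^ k) F) y)"
        by (simp add: W_vec_add W_vec_scaleR)
      with Suc show ?case using sm_W[of "(W r (t *\<^sub>R x + X) ^^ k) F" r "t *\<^sub>R x + X"] by simp
    qed (simp add: F)
    then have "(W r (t *\<^sub>R x + X) ^^ n) F = ((\<lambda>F y. t *\<^sub>R W r x F y + W r X F y) ^^ n) F" by simp
    also have "\<dots> = (\<lambda>y. \<Sum>k\<le>n. real (n choose k) *\<^sub>R ((\<lambda>F y. t *\<^sub>R W r x F y) ^^ k) ((W r X ^^ (n - k)) F) y)"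
    proof (rule lin_op_binomial[OF lin_op_times[OF lin_op_W] lin_op_W open_U F])
      fix F :: "'a \<Rightarrow> 'b" assume "sm F"
      then show "(\<lambda>y. t *\<^sub>R W r x (W r X F) y) = W r X (\<lambda>y. t *\<^sub>R W r x F y)"
        by (simp add: lin_op_scaleR[OF lin_op_W] sm_W W_commute[of F r X])
    qed
    also have "\<dots> = (\<lambda>y. \<Sum>k\<le>n. (real (n choose k) * t ^ k) *\<^sub>R G k y)"
      unfolding G_def lin_op_times_funpow[OF lin_op_W sm_Wn[OF F]] by simp
    finally show ?thesis .
  qed
  \<comment> \<open>\<open>?a\<close> collects the terms of the outer derivative along
    \<open>X\<close>, \<open>?b\<close> those along \<open>t x\<close>, which are shifted by one
    power of \<open>t\<close>.\<close>
  let ?a = "\<lambda>k. if k \<le> n then real (n choose k) *\<^sub>R W s X (G k) 0 else 0"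
  let ?b = "\<lambda>k. if k = 0 then 0 else real (n choose (k - 1)) *\<^sub>R W s x (G (k - 1)) 0"
  have "(\<Sum>k\<le>Suc n. t ^ k *\<^sub>R (?a k + ?b k)) = 0" for t
  proof -
    have sG: "sm (\<lambda>y. (real (n choose k) * t ^ k) *\<^sub>R G k y)" for k
      by (intro smooth_on_cscaleR G)
    have "0 = W s (t *\<^sub>R x + X) (\<lambda>y. \<Sum>k\<le>n. (real (n choose k) * t ^ k) *\<^sub>R G k y) 0"
      using van[of "t *\<^sub>R x + X"] expand by simp
    also have "\<dots> = (\<Sum>k\<le>n. (real (n choose k) * t ^ k) *\<^sub>R (t *\<^sub>R W s x (G k) 0 + W s X (G k) 0))"
      by (simp add: lin_op_sum[OF lin_op_W open_U sG] lin_op_scaleR[OF lin_op_W G] W_vec_add[OF G] W_vec_scaleR[OF G])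
    also have "\<dots> = (\<Sum>k\<le>n. t ^ Suc k *\<^sub>R (real (n choose k) *\<^sub>R W s x (G k) 0)) + (\<Sum>k\<le>n. t ^ k *\<^sub>R (real (n choose k) *\<^sub>R W s X (G k) 0))"
      by (simp add: scaleR_add_right sum.distrib mult.commute mult.left_commute)
    also have "(\<Sum>k\<le>n. t ^ Suc k *\<^sub>R (real (n choose k) *\<^sub>R W s x (G k) 0)) = (\<Sum>k\<le>Suc n. t ^ k *\<^sub>R ?b k)"
      by (simp add: sum.atMost_Suc_shift del: sum.atMost_Suc)
    also have "(\<Sum>k\<le>n. t ^ k *\<^sub>R (real (n choose k) *\<^sub>R W s X (G k) 0)) = (\<Sum>k\<le>Suc n. t ^ k *\<^sub>R ?a k)"
      by simp
    finally show ?thesis by (simp only: scaleR_add_right sum.distrib add.commute)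
  qed
  from vector_polyfun_eq_0[OF this, of 1] have "?a 1 + ?b 1 = 0" by simp
  then show ?thesis by (cases n) (auto simp: G_def)
qed

text \<open>Real polarization at \<open>x\<close> gives \<open>a + b = 0\<close>. The terms
  \<open>a\<close> and \<open>b\<close> have opposite complex types in \<open>x\<close>, so the
  relation at \<open>J x\<close> amounts to \<open>- a + b = 0\<close>, and both vanish.\<close>

lemma W_mixed_polarize:
  assumes F: "sm F" and van: "\<And>X. W s X ((W (- s) X ^^ n) F) 0 = 0" and s: "s * s = 1"
  shows "W s x ((W (- s) X ^^ n) F) 0 = 0"
proof -
  define a where "a = real n *\<^sub>R W s X (W (- s) x ((W (- s) X ^^ (n - 1)) F)) 0"
  define b where "b = W s x ((W (- s) X ^^ n) F) 0"
  have 1: "a + b = 0" using W_mixed_polarize_aux[OF F van] by (simp add: a_def b_def)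
  have "real n *\<^sub>R W s X (W (- s) (J x) ((W (- s) X ^^ (n - 1)) F)) 0 + W s (J x) ((W (- s) X ^^ n) F) 0 = 0"
    by (rule W_mixed_polarize_aux[OF F van])
  moreover have "W (- s) (J x) ((W (- s) X ^^ (n - 1)) F) = (\<lambda>y. - (s *\<^sub>R K (W (- s) x ((W (- s) X ^^ (n - 1)) F) y)))"
    using s by (simp add: W_vec_J[OF sm_Wn[OF F]])
  moreover have "W s X (\<lambda>y. - (s *\<^sub>R K (W (- s) x ((W (- s) X ^^ (n - 1)) F) y))) 0 =
      - (s *\<^sub>R K (W s X (W (- s) x ((W (- s) X ^^ (n - 1)) F)) 0))"
    by (simp add: lin_op_minus[OF lin_op_W] lin_op_scaleR[OF lin_op_W] W_K sm_W sm_Wn F sm_K smooth_on_cscaleR)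
  ultimately have "s *\<^sub>R K (- a + b) = 0"
    by (simp add: a_def b_def W_vec_J[OF sm_Wn[OF F] s] scaleR_diff_right)
  then have "s *\<^sub>R K (s *\<^sub>R K (- a + b)) = 0" by (simp only: K_simps scaleR_zero_right)
  then have "a - b = 0" using s by (simp add: scaleR_diff_right)
  with 1 have "2 *\<^sub>R b = 0" by (simp add: scaleR_2)
  then show ?thesis by (simp add: b_def)
qed

end

section \<open>The jet of a Kaehler metric in normal coordinates\<close>

text \<open>
  \<open>f\<close> is the Kaehler potential in normal coordinates, \<open>B\<close> the metric at the origin and \<open>\<Gamma>\<close> the
  Christoffel map.  The metric itself does not appear: it is the (1,1)-part of the Hessian of \<open>f\<close>.
  The assumption \<open>jets\<close> states that \<open>f\<close> agrees with \<open>B\<close> modulo bidegrees \<open>\<ge> (2,2)\<close>.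
\<close>

locale kaehler_jet =
  fixes U :: "'e::euclidean_space set" and J :: "'e \<Rightarrow> 'e" and B :: "'e \<Rightarrow> 'e \<Rightarrow> real"
    and f :: "'e \<Rightarrow> real" and \<Gamma> :: "'e \<Rightarrow> 'e \<Rightarrow> 'e \<Rightarrow> 'e"
  assumes open_U': "open U" and zero_U: "0 \<in> U"
    and linear_J': "linear J" and J_J': "J (J v) = - v"
    and bilinear_B: "bilinear B" and B_sym: "B a b = B b a" and B_pos: "a \<noteq> 0 \<Longrightarrow> B a a > 0"
    and B_J: "B (J a) (J b) = B a b"
    and smooth_f: "smooth_on U f"
    and smooth_\<Gamma>: "smooth_on U (\<lambda>x. \<Gamma> x a b)"
    and bilinear_\<Gamma>: "x \<in> U \<Longrightarrow> bilinear (\<Gamma> x)"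
    and \<Gamma>_sym: "x \<in> U \<Longrightarrow> \<Gamma> x a b = \<Gamma> x b a"
    and \<Gamma>_J: "x \<in> U \<Longrightarrow> \<Gamma> x a (J b) = J (\<Gamma> x a b)"
    and G_0: "(dd U a (dd U b f) 0 + dd U (J a) (dd U (J b) f) 0) / 4 = B a b"
    and G_pos: "x \<in> U \<Longrightarrow> a \<noteq> 0 \<Longrightarrow> (dd U a (dd U a f) x + dd U (J a) (dd U (J a) f) x) / 4 > 0"
    and metric_parallel: "x \<in> U \<Longrightarrow>
      dd U v (\<lambda>x. (dd U a (dd U b f) x + dd U (J a) (dd U (J b) f) x) / 4) x =
        (dd U (\<Gamma> x v a) (dd U b f) x + dd U (J (\<Gamma> x v a)) (dd U (J b) f) x) / 4
      + (dd U a (dd U (\<Gamma> x v b) f) x + dd U (J a) (dd U (J (\<Gamma> x v b)) f) x) / 4"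
    and jets: "k < 2 \<or> l < 2 \<Longrightarrow> (k, l) \<noteq> (1, 1) \<Longrightarrow>
      (wd U J ((*) \<i>) 1 X ^^ k) ((wd U J ((*) \<i>) (- 1) X ^^ l) (\<lambda>x. complex_of_real (f x))) 0 = 0"
begin

sublocale E: wirtinger U J J
  by (rule wirtinger.intro[OF open_U' linear_J' J_J' linear_J' J_J'])

sublocale C: wirtinger U J "(*) \<i>"
  by (rule wirtinger.intro[OF open_U' linear_J' J_J' bounded_linear.linear[OF bounded_linear_mult_right]])
    (simp add: mult.assoc[symmetric])

abbreviation P :: "'e \<Rightarrow> ('e \<Rightarrow> 'e) \<Rightarrow> 'e \<Rightarrow> 'e" where "P \<equiv> wd U J J 1"
abbreviation Q :: "'e \<Rightarrow> ('e \<Rightarrow> 'e) \<Rightarrow> 'e \<Rightarrow> 'e" where "Q \<equiv> wd U J J (- 1)"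
abbreviation PC :: "'e \<Rightarrow> ('e \<Rightarrow> complex) \<Rightarrow> 'e \<Rightarrow> complex" where "PC \<equiv> wd U J ((*) \<i>) 1"
abbreviation QC :: "'e \<Rightarrow> ('e \<Rightarrow> complex) \<Rightarrow> 'e \<Rightarrow> complex" where "QC \<equiv> wd U J ((*) \<i>) (- 1)"
abbreviation fc :: "'e \<Rightarrow> complex" where "fc \<equiv> \<lambda>x. complex_of_real (f x)"

lemma sm_fc: "smooth_on U fc"
  by (rule smooth_on_bounded_linear[OF bounded_linear_of_real smooth_f])

lemmas B_simps = bilinear_ladd[OF bilinear_B] bilinear_radd[OF bilinear_B]
  bilinear_lsub[OF bilinear_B] bilinear_rsub[OF bilinear_B] bilinear_lmul[OF bilinear_B]
  bilinear_rmul[OF bilinear_B] bilinear_lneg[OF bilinear_B] bilinear_rneg[OF bilinear_B]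
  bilinear_lzero[OF bilinear_B] bilinear_rzero[OF bilinear_B]

lemma linear_B_left: "linear (\<lambda>a. B a b)"
  using bilinear_B by (simp add: bilinear_def)

lemma linear_B_right: "linear (B a)"
  using bilinear_B by (simp add: bilinear_def)

lemma B_J_left: "B (J a) b = - B a (J b)"
  using B_J[of a "J b"] by (simp add: B_simps)

lemma B_eqI: "(\<And>w. B a w = B b w) \<Longrightarrow> a = b"
  using B_pos[of "a - b"] by (force simp: B_simps)

section \<open>The half gradient and its jets\<close>

definition lower :: "'e \<Rightarrow> 'e" where "lower y = (\<Sum>b\<in>Basis. B y b *\<^sub>R b)"

lemma lower_inner: "lower y \<bullet> w = B y w"
proof -
  have "lower y \<bullet> w = (\<Sum>b\<in>Basis. (w \<bullet> b) *\<^sub>R B y b)"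
    unfolding lower_def inner_sum_left by (simp add: inner_commute[of _ w] mult.commute)
  also have "\<dots> = B y w" using linear_basis_expansion[OF linear_B_right, of y w] by simp
  finally show ?thesis .
qed

lemma linear_lower: "linear lower"
  unfolding linear_iff by (simp add: lower_def B_simps algebra_simps sum.distrib scaleR_sum_right)

lemma inj_lower: "inj lower"
proof (rule injI)
  fix x y assume "lower x = lower y"
  then show "x = y" using lower_inner by (metis B_eqI)
qed

lemma surj_lower: "surj lower"
  using linear_injective_imp_surjective[OF linear_lower inj_lower] by simp

text \<open>Turns a covector, written with the standard inner product, into the vector that
  represents it with respect to \<open>B\<close>.\<close>

definition raise :: "'e \<Rightarrow> 'e" where "raise = inv lower"

lemma B_raise: "B (raise y) w = y \<bullet> w"
  using lower_inner[of "raise y" w] surj_f_inv_f[OF surj_lower] by (simp add: raise_def)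

lemma linear_raise: "linear raise"
  unfolding raise_def by (rule inj_linear_imp_inv_linear[OF linear_lower inj_lower]) 

text \<open>The factor 1/2 makes \<open>Z\<close> the identity for the flat potential
  \<open>f x = B x x\<close>.\<close>

definition Z :: "'e \<Rightarrow> 'e" where
  "Z x = raise (\<Sum>b\<in>Basis. (dd U b f x / 2) *\<^sub>R b)"

lemma B_Z: "B (Z x) w = dd U w f x / 2"
proof -
  have "B (Z x) w = (\<Sum>b\<in>Basis. (w \<bullet> b) *\<^sub>R dd U b f x) / 2"
    unfolding Z_def B_raise inner_sum_left
    by (simp add: inner_commute[of _ w] mult.commute sum_divide_distrib)
  then show ?thesis using linear_basis_expansion[OF linear_dd[OF smooth_f], of w x] by simp
qed

lemma sm_Z: "smooth_on U Z"
proof -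
  have "smooth_on U (\<lambda>x. (dd U b f x / 2) *\<^sub>R b)" for b
    by (rule smooth_on_scaleR[OF smooth_on_bounded_linear[OF bounded_linear_divide] smooth_on_const])
      (auto intro: smooth_f open_U')
  then have "smooth_on U (\<lambda>x. \<Sum>b\<in>Basis. (dd U b f x / 2) *\<^sub>R b)"
    by (intro smooth_on_sum open_U')
  moreover have "bounded_linear raise"
    using linear_raise linear_conv_bounded_linear by blast
  ultimately have "smooth_on U (\<lambda>x. raise (\<Sum>b\<in>Basis. (dd U b f x / 2) *\<^sub>R b))"
    using smooth_on_bounded_linear by blast
  then show ?thesis by (simp add: Z_def[abs_def])
qed

text \<open>The Hermitean form with real part \<open>B\<close>, complex linear in \<open>y\<close>.
  It trades derivatives of vector valued functions for those of complex valued ones, to which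
  \<open>jets\<close> refers.\<close>

definition hm :: "'e \<Rightarrow> 'e \<Rightarrow> complex" where
  "hm y w = complex_of_real (B y w) + \<i> * complex_of_real (B y (J w))"

lemma linear_hm: "linear (\<lambda>y. hm y w)"
  by (simp add: linear_iff hm_def B_simps scaleR_conv_of_real algebra_simps)

lemma hm_J: "hm (J y) w = \<i> * hm y w"
  by (simp add: hm_def B_J_left B_simps algebra_simps)

lemma Re_hm: "Re (hm y w) = B y w"
  by (simp add: hm_def)

lemma hm_eq_0: "(\<And>w. hm y w = 0) \<Longrightarrow> y = 0"
  using B_eqI[of y 0] Re_hm by (metis B_simps(9) zero_complex.sel(1))

lemma hm_W: 
  assumes "smooth_on U F"
  shows "wd U J ((*) \<i>) s v (\<lambda>x. hm (F x) w) = (\<lambda>x. hm (wd U J J s v F x) w)"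
proof -
  have bl: "bounded_linear (\<lambda>y. hm y w)" using linear_hm linear_conv_bounded_linear by blast
  show ?thesis
    by (simp add: wd_def dd_bounded_linear[OF bl assms] linear_cmul[OF linear_hm] linear_diff[OF linear_hm] hm_J)
qed

lemma hm_Wn: 
  assumes "smooth_on U F"
  shows "(wd U J ((*) \<i>) s v ^^ n) (\<lambda>x. hm (F x) w) = (\<lambda>x. hm ((wd U J J s v ^^ n) F x) w)"
  by (induction n) (simp_all add: hm_W E.sm_Wn assms)

text \<open>Pairing with \<open>w\<close> identifies \<open>Z\<close> with the (0,1)-differential of
  the potential. A jet of \<open>Z\<close> is thus a jet of \<open>f\<close> with one more
  \<open>Q\<close>.\<close>

lemma hm_Z: "(\<lambda>x. hm (Z x) w) = QC w fc"
  by (simp add: wd_def hm_def B_Z dd_bounded_linear[OF bounded_linear_of_real smooth_f] fun_eq_iff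
      scaleR_conv_of_real field_simps)

lemma Q_words_Z: "(Q X ^^ n) Z 0 = 0"
proof (rule hm_eq_0)
  fix w
  have "(QC X ^^ n) (QC w fc) 0 = 0"
    by (rule C.W_polarize[OF sm_fc]) (use jets[of 0 "Suc n"] in simp)
  then show "hm ((Q X ^^ n) Z 0) w = 0"
    using hm_Wn[OF sm_Z] hm_Z by metis
qed

lemma Z_0: "Z 0 = 0"
  using Q_words_Z[of 0] by simp

text \<open>A jet of bidegree (n, 1), which the normalisation excludes from \<open>n = 2\<close> on.
  As \<open>w\<close> is independent of \<open>X\<close>, mixed polarization is required.\<close>

lemma P_words_QC: 
  assumes "2 \<le> n"
  shows "(PC X ^^ n) (QC w fc) 0 = 0"
proof -
  have "QC X ((PC X ^^ n) fc) 0 = 0" for X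
    using jets[of n 1 X] assms by (simp add: C.Wn_W_commute[OF sm_fc])
  then have "QC w ((PC X ^^ n) fc) 0 = 0"
    using C.W_mixed_polarize[OF sm_fc, of "-1" n w X] by simp
  then show ?thesis by (simp add: C.Wn_W_commute[OF sm_fc])
qed

lemma P_words_Z: 
  assumes "2 \<le> n"
  shows "(P X ^^ n) Z 0 = 0"
proof (rule hm_eq_0)
  fix w
  show "hm ((P X ^^ n) Z 0) w = 0"
    using P_words_QC[OF assms, of X w] hm_Wn[OF sm_Z] hm_Z by metis
qed

text \<open>
  \<open>GG x\<close> represents the metric at \<open>x\<close> with respect to \<open>B\<close>.
\<close>

definition GG :: "'e \<Rightarrow> 'e \<Rightarrow> 'e" where "GG x y = P y Z x"

lemma GG_eq: "(\<lambda>x. GG x y) = P y Z"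
  by (simp add: GG_def)

lemma sm_GG: "smooth_on U (\<lambda>x. GG x y)"
  unfolding GG_eq by (rule E.sm_W[OF sm_Z])

lemma linear_GG: "linear (GG x)"
  by (simp add: linear_iff GG_def E.W_vec_add E.W_vec_scaleR sm_Z)

lemma GG_J: "GG x (J y) = J (GG x y)"
  by (simp add: GG_def E.W_vec_J sm_Z)

lemma B_dd: "smooth_on U F \<Longrightarrow> B (dd U v F x) w = dd U v (\<lambda>x. B (F x) w) x"
  using dd_bounded_linear[of "\<lambda>y. B y w" U F v] linear_B_left linear_conv_bounded_linear by metis

lemma B_GG: "B (GG x a) b = (dd U a (dd U b f) x + dd U (J a) (dd U (J b) f) x) / 4"
proof -
  have *: "B (dd U a Z x) b = dd U a (dd U b f) x / 2" for a b
    by (simp add: B_dd sm_Z B_Z dd_bounded_linear[OF bounded_linear_divide] smooth_on_dd smooth_f)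
  show ?thesis by (simp add: GG_def wd_def B_simps B_J_left *)
qed

lemma B_GG_sym: "B (GG x a) b = B a (GG x b)"
  unfolding B_sym[of a] B_GG dd_commute[OF smooth_f, of a] dd_commute[OF smooth_f, of "J a"] ..

lemma GG_0: "GG 0 a = a"
  by (rule B_eqI) (simp add: B_GG G_0)

lemma GG_inj: "x \<in> U \<Longrightarrow> GG x a = 0 \<Longrightarrow> a = 0"
  using B_GG[of x a a] G_pos[of x a] by (force simp: B_simps)

lemma linear_\<Gamma>: "x \<in> U \<Longrightarrow> linear (\<Gamma> x a)" "x \<in> U \<Longrightarrow> linear (\<lambda>a. \<Gamma> x a b)"
  using bilinear_\<Gamma> by (simp_all add: bilinear_def)

lemma \<Gamma>_J_left: "x \<in> U \<Longrightarrow> \<Gamma> x (J a) b = J (\<Gamma> x a b)"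
  using \<Gamma>_sym \<Gamma>_J by metis

text \<open>Metric compatibility has one Christoffel term for each argument of the metric. As
  \<open>\<Gamma> x\<close> is complex bilinear, the term in the second argument cancels in the
  (1,0)-derivative.\<close>

lemma P_GG: 
  assumes x: "x \<in> U"
  shows "P v (\<lambda>x. GG x y) x = GG x (\<Gamma> x v y)"
proof (rule B_eqI)
  fix b
  have e: "B (dd U v (\<lambda>x. GG x y) x) b = B (GG x (\<Gamma> x v y)) b + B (GG x y) (\<Gamma> x v b)" for v b
    using metric_parallel[OF x, of v y b] by (simp add: B_dd[OF sm_GG] B_GG)
  show "B (P v (\<lambda>x. GG x y) x) b = B (GG x (\<Gamma> x v y)) b"
    by (simp add: wd_def B_simps B_J_left e \<Gamma>_J[OF x] \<Gamma>_J_left[OF x] GG_J)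
qed

text \<open>
  The (1,1)-part of the curvature.  Its value at the origin is the triple product of the Hermitian
  Jordan triple system of the symmetric space, written \<open>tr a b c\<close> below.
\<close>

definition T :: "'e \<Rightarrow> 'e \<Rightarrow> 'e \<Rightarrow> 'e \<Rightarrow> 'e" where
  "T x a b c = - Q b (\<lambda>x. \<Gamma> x a c) x"

lemma sm_T: "smooth_on U (\<lambda>x. T x a b c)"
  unfolding T_def by (intro smooth_on_minus E.sm_W smooth_\<Gamma>)

lemma T_sym: "T x a b c = T x c b a"
  unfolding T_def using E.W_cong[of "\<lambda>x. \<Gamma> x a c" "\<lambda>x. \<Gamma> x c a"] \<Gamma>_sym by simp

lemma T_J_left: "T x (J a) b c = J (T x a b c)"
proof -
  have "Q b (\<lambda>x. \<Gamma> x (J a) c) = Q b (\<lambda>x. J (\<Gamma> x a c))"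
    by (rule E.W_cong) (simp add: \<Gamma>_J_left)
  then show ?thesis by (simp add: T_def E.W_K[OF smooth_\<Gamma>])
qed

lemma T_J_right: "T x a b (J c) = J (T x a b c)"
  using T_sym T_J_left by metis

lemma T_J_mid: "T x a (J b) c = - J (T x a b c)"
  by (simp add: T_def E.W_vec_J[OF smooth_\<Gamma>])

lemma linear_T_left: "linear (\<lambda>a. T x a b c)"
proof -
  have "Q b (\<lambda>x. \<Gamma> x (a + a') c) = (\<lambda>x. Q b (\<lambda>x. \<Gamma> x a c) x + Q b (\<lambda>x. \<Gamma> x a' c) x)" for a a'
    by (subst E.W_add[OF smooth_\<Gamma> smooth_\<Gamma>, symmetric], rule E.W_cong)
      (use linear_add[OF linear_\<Gamma>(2)] in auto)
  moreover have "Q b (\<lambda>x. \<Gamma> x (r *\<^sub>R a) c) = (\<lambda>x. r *\<^sub>R Q b (\<lambda>x. \<Gamma> x a c) x)" for r a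
    by (subst lin_op_scaleR[OF E.lin_op_W smooth_\<Gamma>, symmetric], rule E.W_cong)
      (use linear_cmul[OF linear_\<Gamma>(2)] in auto)
  ultimately show ?thesis by (simp add: linear_iff T_def)
qed

lemma linear_T_right: "linear (T x a b)"
  using linear_T_left[of x b a] T_sym by (metis (no_types, lifting) ext)

lemma linear_T_mid: "linear (\<lambda>b. T x a b c)"
  by (simp add: linear_iff T_def E.W_vec_add E.W_vec_scaleR smooth_\<Gamma>)

section \<open>The curvature and its type decomposition\<close>

definition Rm :: "'e \<Rightarrow> 'e \<Rightarrow> 'e \<Rightarrow> 'e \<Rightarrow> 'e" where
  "Rm x a b c = dd U a (\<lambda>x. \<Gamma> x b c) x - dd U b (\<lambda>x. \<Gamma> x a c) x
     + \<Gamma> x a (\<Gamma> x b c) - \<Gamma> x b (\<Gamma> x a c)"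

lemma sm_\<Gamma>\<Gamma>: "smooth_on U (\<lambda>x. \<Gamma> x a (\<Gamma> x b c))"
  by (rule smooth_on_family[OF open_U' smooth_\<Gamma> smooth_\<Gamma>]) (rule linear_\<Gamma>)

lemma sm_Rm: "smooth_on U (\<lambda>x. Rm x a b c)"
  unfolding Rm_def by (intro smooth_on_diff smooth_on_add smooth_on_dd smooth_\<Gamma> sm_\<Gamma>\<Gamma>)

text \<open>The (2,0)-part of the curvature vanishes: \<open>GG x\<close> maps it to the commutator
  of two \<open>P\<close>-derivatives of the metric, and \<open>GG x\<close> is injective.\<close>

lemma P_\<Gamma>_commute:
  assumes x: "x \<in> U"
  shows "P a (\<lambda>x. \<Gamma> x b c) x + \<Gamma> x a (\<Gamma> x b c) = P b (\<lambda>x. \<Gamma> x a c) x + \<Gamma> x b (\<Gamma> x a c)"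
proof -
  have e: "P a (P b (\<lambda>x. GG x c)) x = GG x (\<Gamma> x a (\<Gamma> x b c)) + GG x (P a (\<lambda>x. \<Gamma> x b c) x)" for a b
  proof -
    have "P a (P b (\<lambda>x. GG x c)) x = P a (\<lambda>x. GG x (\<Gamma> x b c)) x"
      using E.W_cong[of "P b (\<lambda>x. GG x c)" "\<lambda>x. GG x (\<Gamma> x b c)" 1 a] P_GG by simp
    also have "\<dots> = P a (\<lambda>y. GG y (\<Gamma> x b c)) x + GG x (P a (\<lambda>x. \<Gamma> x b c) x)"
      by (rule E.W_family_linear[OF smooth_\<Gamma> sm_GG linear_GG GG_J x])
    finally show ?thesis by (simp add: P_GG[OF x])
  qed
  have "GG x (\<Gamma> x a (\<Gamma> x b c)) + GG x (P a (\<lambda>x. \<Gamma> x b c) x) = GG x (\<Gamma> x b (\<Gamma> x a c)) + GG x (P b (\<lambda>x. \<Gamma> x a c) x)"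
    using e[of a b] e[of b a] E.W_commute[OF sm_GG, of 1 a 1 b] by simp
  then have "GG x ((P a (\<lambda>x. \<Gamma> x b c) x + \<Gamma> x a (\<Gamma> x b c)) - (P b (\<lambda>x. \<Gamma> x a c) x + \<Gamma> x b (\<Gamma> x a c))) = 0"
    by (simp add: linear_add[OF linear_GG] linear_diff[OF linear_GG] add.commute)
  from GG_inj[OF x this] show ?thesis by simp
qed

lemma Rm_eq_T:
  assumes x: "x \<in> U"
  shows "Rm x a b c = T x a b c - T x b a c"
  using P_\<Gamma>_commute[OF x, of a b c]
  by (simp add: Rm_def E.dd_eq_W T_def algebra_simps)

text \<open>As a function of \<open>b\<close>, the two terms of \<open>Rm_eq_T\<close> are conjugate
  linear and complex linear; this is the projection to the first. Through it parallelity of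
  \<open>Rm\<close> passes to \<open>T\<close>.\<close>

lemma T_eq_Rm:
  assumes x: "x \<in> U"
  shows "T x a b c = (1 / 2) *\<^sub>R (Rm x a b c + J (Rm x a (J b) c))"
  by (simp add: Rm_eq_T[OF x] T_J_mid T_J_left scaleR_2[symmetric])

end

lemma half_scaleR_eq: "(1 / 2) *\<^sub>R x = y \<longleftrightarrow> x = y + y" for x y :: "'a::real_vector"
  using scaleR_half_double[of y] by (metis scaleR_cancel_left zero_eq_1_divide_iff zero_neq_numeral)

context wirtinger begin

lemma Wn_cong0:
  assumes "0 \<in> U" "\<And>y. y \<in> U \<Longrightarrow> F y = G y"
  shows "(W s X ^^ n) F 0 = (W s X ^^ n) G 0"
proof (cases n)
  case (Suc m)
  have "W s X F = W s X G" by (rule W_cong) (simp add: assms(2))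
  then show ?thesis unfolding Suc funpow_Suc_right o_apply by simp
qed (use assms in simp)

lemma pure_SucI: "F 0 = 0 \<Longrightarrow> pure s X (W s X F) \<Longrightarrow> pure s X F"
  unfolding pure_def by (metis funpow_0 funpow_Suc_right not0_implies_Suc o_apply)

lemma W_minus_const: "sm F \<Longrightarrow> W s X (\<lambda>x. F x - c) = W s X F"
  by (simp add: lin_op_diff[OF lin_op_W] open_U)

end

section \<open>Consequences of parallel curvature\<close>

locale symmetric_kaehler_jet = kaehler_jet U J B f \<Gamma>
  for U :: "'e::euclidean_space set" and J B f \<Gamma> +
  assumes Rm_parallel: "x \<in> U \<Longrightarrow>
    dd U v (\<lambda>x. Rm x a b c) x + \<Gamma> x v (Rm x a b c) =
      Rm x (\<Gamma> x v a) b c + Rm x a (\<Gamma> x v b) c + Rm x a b (\<Gamma> x v c)"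
begin

lemma dd_T:
  assumes x: "x \<in> U"
  shows "dd U v (\<lambda>x. T x a b c) x =
    - \<Gamma> x v (T x a b c) + T x (\<Gamma> x v a) b c + T x a (\<Gamma> x v b) c + T x a b (\<Gamma> x v c)"
proof -
  have "dd U v (\<lambda>x. T x a b c) = dd U v (\<lambda>x. (1 / 2) *\<^sub>R (Rm x a b c + J (Rm x a (J b) c)))"
    by (rule dd_cong[OF open_U']) (rule T_eq_Rm)
  also have "\<dots> = (\<lambda>x. (1 / 2) *\<^sub>R (dd U v (\<lambda>x. Rm x a b c) x + J (dd U v (\<lambda>x. Rm x a (J b) c) x)))"
    by (simp add: dd_bounded_linear[OF bounded_linear_scaleR_right] dd_add dd_bounded_linear[OF E.bl_K]
        sm_Rm E.sm_K smooth_on_add)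
  finally have "dd U v (\<lambda>x. T x a b c) x =
      (1 / 2) *\<^sub>R (dd U v (\<lambda>x. Rm x a b c) x + J (dd U v (\<lambda>x. Rm x a (J b) c) x))" by simp
  moreover have "dd U v (\<lambda>x. Rm x a b c) x = - \<Gamma> x v (Rm x a b c)
      + Rm x (\<Gamma> x v a) b c + Rm x a (\<Gamma> x v b) c + Rm x a b (\<Gamma> x v c)" for b
    using Rm_parallel[OF x, of v a b c] by (simp add: algebra_simps)
  ultimately show ?thesis
    unfolding T_eq_Rm[OF x] \<Gamma>_J[OF x]
    by (simp add: linear_add[OF linear_\<Gamma>(1)[OF x]] linear_cmul[OF linear_\<Gamma>(1)[OF x]] \<Gamma>_J[OF x] algebra_simps)
qed

text \<open>The Christoffel terms of the value and of the complex linear slots survive in the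
  (1,0)-derivative; that of the conjugate linear slot \<open>b\<close> survives in the
  (0,1)-derivative alone.\<close>

lemma P_T:
  assumes x: "x \<in> U"
  shows "P v (\<lambda>x. T x a b c) x = - \<Gamma> x v (T x a b c) + T x (\<Gamma> x v a) b c + T x a b (\<Gamma> x v c)"
  unfolding wd_def dd_T[OF x] \<Gamma>_J_left[OF x] T_J_mid T_J_left T_J_right
  by (subst half_scaleR_eq) (simp add: algebra_simps)

lemma Q_T:
  assumes x: "x \<in> U"
  shows "Q v (\<lambda>x. T x a b c) x = T x a (\<Gamma> x v b) c"
  unfolding wd_def dd_T[OF x] \<Gamma>_J_left[OF x] T_J_mid T_J_left T_J_right
  by (subst half_scaleR_eq) (simp add: algebra_simps)

section \<open>Pure jets of gradient, metric, Christoffel map and curvature\<close>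

lemma pure_Z: "E.pure (- 1) X Z"
  using Q_words_Z by (simp add: E.pure_def)

lemma W_ident: "x \<in> U \<Longrightarrow> P X (\<lambda>x. x) x = X" "Q X (\<lambda>x. x) x = 0"
  by (simp_all add: wd_def dd_ident scaleR_2[symmetric])

lemma sm_ident: "smooth_on U (\<lambda>x. x)"
  using open_U' by simp

text \<open>Orders 0 and 1 are \<open>Z 0 = 0\<close> and \<open>GG 0 = id\<close>; from order 2 on
  the identity map contributes nothing and \<open>P_words_Z\<close> applies.\<close>

lemma pure_Z': "E.pure 1 X (\<lambda>x. Z x - x)"
proof (rule E.pure_SucI)
  show "Z 0 - 0 = 0" by (simp add: Z_0)
  show "E.pure 1 X (P X (\<lambda>x. Z x - x))"
  proof (rule E.pure_cong[OF zero_U])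
    show "E.pure 1 X (\<lambda>x. P X Z x - X)"
    proof (rule E.pure_SucI)
      show "P X Z 0 - X = 0" using GG_0[of X] by (simp add: GG_def)
      have "E.pure 1 X (P X (P X Z))"
        unfolding E.pure_def
      proof
        fix n show "(P X ^^ n) (P X (P X Z)) 0 = 0"
          using P_words_Z[of "Suc (Suc n)" X] unfolding funpow_Suc_right o_apply by simp
      qed
      then show "E.pure 1 X (P X (\<lambda>x. P X Z x - X))"
        by (simp add: E.W_minus_const E.sm_W sm_Z)
    qed
    show "P X Z x - X = P X (\<lambda>x. Z x - x) x" if "x \<in> U" for x
      by (simp add: lin_op_diff[OF E.lin_op_W] sm_Z sm_ident W_ident that)
  qed
qed

text \<open>Paired with \<open>w\<close> this is a jet of the potential of bidegree (1, n + 2): the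
  \<open>P\<close> comes from \<open>y\<close>, one of the \<open>Q\<close> from \<open>w\<close>.
  Mixed polarization frees \<open>y\<close>, plain polarization frees \<open>w\<close>.\<close>

lemma Q_words_GG: "(Q X ^^ Suc n) (\<lambda>x. GG x y) 0 = 0"
proof (rule hm_eq_0)
  fix w
  have s: "smooth_on U (PC y fc)" by (rule C.sm_W[OF sm_fc])
  have "PC X ((QC X ^^ (Suc (Suc n))) fc) 0 = 0" for X
    using jets[of 1 "Suc (Suc n)" X] by simp
  then have "PC y ((QC X ^^ (Suc (Suc n))) fc) 0 = 0" for X
    using C.W_mixed_polarize[OF sm_fc, of 1 "Suc (Suc n)" y X] by simp
  then have "(QC X ^^ (Suc (Suc n))) (PC y fc) 0 = 0" for X
    using C.Wn_W_commute[OF sm_fc, where s = "-1" and v = X and n = "Suc (Suc n)" and t = 1 and w = y] by simp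
  then have "(QC X ^^ Suc n) (QC w (PC y fc)) 0 = 0"
    by (rule C.W_polarize[OF s])
  moreover have "QC w (PC y fc) = (\<lambda>x. hm (GG x y) w)"
    using C.W_commute[OF sm_fc, of "-1" w 1 y] hm_W[OF sm_Z, of 1 y w] hm_Z[of w] by (simp add: GG_def)
  ultimately show "hm ((Q X ^^ Suc n) (\<lambda>x. GG x y) 0) w = 0"
    using hm_Wn[OF sm_GG[of y], where s = "-1" and v = X and n = "Suc n" and w = w] by simp
qed

lemma P_words_GG: "(P X ^^ Suc n) (\<lambda>x. GG x y) 0 = 0"
proof (rule hm_eq_0)
  fix w
  have s: "smooth_on U (QC w fc)" by (rule C.sm_W[OF sm_fc])
  have "(PC X ^^ (Suc (Suc n))) (QC w fc) 0 = 0" for X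
    by (rule P_words_QC) simp
  then have "(PC X ^^ Suc n) (PC y (QC w fc)) 0 = 0"
    by (rule C.W_polarize[OF s])
  moreover have "PC y (QC w fc) = (\<lambda>x. hm (GG x y) w)"
    using hm_W[OF sm_Z, of 1 y w] hm_Z[of w] by (simp add: GG_def)
  ultimately show "hm ((P X ^^ Suc n) (\<lambda>x. GG x y) 0) w = 0"
    using hm_Wn[OF sm_GG[of y], where s = 1 and v = X and n = "Suc n" and w = w] by simp
qed

lemma pure_GG: "E.pure (- 1) X (\<lambda>x. GG x y - y)" "E.pure 1 X (\<lambda>x. GG x y - y)"
proof -
  have "E.pure (- 1) X (Q X (\<lambda>x. GG x y))"
    unfolding E.pure_def
  proof
    fix n show "(Q X ^^ n) (Q X (\<lambda>x. GG x y)) 0 = 0"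
      using Q_words_GG[of n X y] unfolding funpow_Suc_right o_apply .
  qed
  then show "E.pure (- 1) X (\<lambda>x. GG x y - y)"
    by (intro E.pure_SucI[where F = "\<lambda>x. GG x y - y"]) (simp_all add: GG_0 E.W_minus_const sm_GG)
  have "E.pure 1 X (P X (\<lambda>x. GG x y))"
    unfolding E.pure_def
  proof
    fix n show "(P X ^^ n) (P X (\<lambda>x. GG x y)) 0 = 0"
      using P_words_GG[of n X y] unfolding funpow_Suc_right o_apply .
  qed
  then show "E.pure 1 X (\<lambda>x. GG x y - y)"
    by (intro E.pure_SucI[where F = "\<lambda>x. GG x y - y"]) (simp_all add: GG_0 E.W_minus_const sm_GG)
qed

lemma sm_GG_diff: "smooth_on U (\<lambda>x. GG x y - y)"
  by (intro smooth_on_diff sm_GG smooth_on_const open_U')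

lemma linear_GG_diff: "linear (\<lambda>y. GG x y - y)"
  using linear_GG[of x] by (simp add: linear_iff algebra_simps)

text \<open>\<open>GG x (\<Gamma> x X y)\<close> is the \<open>P\<close>-derivative of the metric,
  hence pure, and its difference from \<open>\<Gamma> x X y\<close> is pure because
  \<open>GG - id\<close> is.\<close>

lemma pure_\<Gamma>: "E.pure 1 X (\<lambda>x. \<Gamma> x X y)"
proof -
  have "E.pure 1 X (P X (\<lambda>x. GG x y))"
    using E.pure_W[OF pure_GG(2)[of X y]] by (simp add: E.W_minus_const sm_GG)
  then have 1: "E.pure 1 X (\<lambda>x. GG x (\<Gamma> x X y))"
    by (rule E.pure_cong[OF zero_U, rotated]) (rule P_GG)
  have 2: "E.pure 1 X (\<lambda>x. GG x (\<Gamma> x X y) - \<Gamma> x X y)"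
    by (rule E.pure_family[where \<Lambda> = "\<lambda>x y. GG x y - y", OF zero_U smooth_\<Gamma> sm_GG_diff linear_GG_diff pure_GG(2)])
  have s: "smooth_on U (\<lambda>x. GG x (\<Gamma> x X y))"
    by (rule smooth_on_family[OF open_U' smooth_\<Gamma> sm_GG linear_GG])
  show ?thesis
    using E.pure_diff[OF s smooth_on_diff[OF s smooth_\<Gamma>] 1 2] by simp
qed

lemma Q_T_family:
  assumes "smooth_on U Y" "x \<in> U"
  shows "Q X (\<lambda>x. T x a (Y x) c) x = T x a (\<Gamma> x X (Y x) + P X Y x) c"
  using E.W_family_antilinear[where \<Lambda> = "\<lambda>x y. T x a y c", OF assms(1) sm_T linear_T_mid T_J_mid assms(2), of "-1" X]
    Q_T[OF assms(2)] by (simp add: linear_add[OF linear_T_mid])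

text \<open>Each \<open>Q\<close> acts on the argument in the conjugate linear slot as
  \<open>Y \<mapsto> \<Gamma> X Y + P X Y\<close>, and this preserves purity of type 1. So each
  \<open>Q\<close>-word ends in an argument that vanishes at 0.\<close>

lemma pure_T_family:
  assumes "smooth_on U Y" "E.pure 1 X Y"
  shows "E.pure (- 1) X (\<lambda>x. T x a (Y x) c)"
proof -
  have "(Q X ^^ n) (\<lambda>x. T x a (Y x) c) 0 = 0" for n
    using assms
  proof (induction n arbitrary: Y)
    case 0
    then have "Y 0 = 0" unfolding E.pure_def by (metis funpow_0)
    then show ?case by (simp add: linear_0[OF linear_T_mid])
  next
    case (Suc n)
    have s\<Gamma>: "smooth_on U (\<lambda>x. \<Gamma> x X (Y x))"
      by (rule smooth_on_family[OF open_U' Suc.prems(1) smooth_\<Gamma> linear_\<Gamma>(1)])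
    have p\<Gamma>: "E.pure 1 X (\<lambda>x. \<Gamma> x X (Y x))"
      by (rule E.pure_family[OF zero_U Suc.prems(1) smooth_\<Gamma> linear_\<Gamma>(1) pure_\<Gamma>])
    have "(Q X ^^ Suc n) (\<lambda>x. T x a (Y x) c) 0 = (Q X ^^ n) (Q X (\<lambda>x. T x a (Y x) c)) 0"
      unfolding funpow_Suc_right o_apply ..
    also have "\<dots> = (Q X ^^ n) (\<lambda>x. T x a (\<Gamma> x X (Y x) + P X Y x) c) 0"
      by (rule E.Wn_cong0[OF zero_U]) (rule Q_T_family[OF Suc.prems(1)])
    also have "\<dots> = 0"
      by (rule Suc.IH) (intro smooth_on_add s\<Gamma> E.sm_W Suc.prems E.pure_add p\<Gamma> E.pure_W)+
    finally show ?case .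
  qed
  then show ?thesis by (simp add: E.pure_def)
qed

abbreviation tr :: "'e \<Rightarrow> 'e \<Rightarrow> 'e \<Rightarrow> 'e" where "tr \<equiv> T 0"

lemma pure_T: "E.pure (- 1) X (\<lambda>x. T x a b c - tr a b c)"
proof (rule E.pure_SucI)
  have "E.pure (- 1) X (\<lambda>x. T x a (\<Gamma> x X b) c)"
    by (rule pure_T_family[OF smooth_\<Gamma> pure_\<Gamma>])
  then show "E.pure (- 1) X (Q X (\<lambda>x. T x a b c - tr a b c))"
    unfolding E.W_minus_const[OF sm_T]
    by (rule E.pure_cong[OF zero_U, rotated]) (rule Q_T[symmetric])
qed simp

lemma bilinear_tr: "bilinear (\<lambda>p q. tr p b q)"
  by (simp add: bilinear_def linear_T_left linear_T_right)

lemma bb_tr: "bounded_bilinear (\<lambda>p q. tr p b q)"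
  using bilinear_tr bilinear_conv_bounded_bilinear by blast

lemma sm_tr: "smooth_on U F \<Longrightarrow> smooth_on U H \<Longrightarrow> smooth_on U (\<lambda>x. tr (F x) b (H x))"
  by (rule smooth_on_bounded_bilinear[OF bb_tr])

lemma W_tr: "smooth_on U F \<Longrightarrow> smooth_on U H \<Longrightarrow>
  wd U J J s v (\<lambda>x. tr (F x) b (H x)) = (\<lambda>x. tr (wd U J J s v F x) b (H x) + tr (F x) b (wd U J J s v H x))"
  by (rule E.W_bilinear[OF bilinear_tr T_J_left T_J_right])

lemma pure_tr:
  assumes "smooth_on U F" "smooth_on U H" "E.pure s X F"
  shows "E.pure s X (\<lambda>x. tr (F x) b (H x))"
proof (rule E.pure_family[where \<Lambda> = "\<lambda>x w. tr (F x) b w", OF zero_U assms(2)])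
  show "smooth_on U (\<lambda>x. tr (F x) b y)" for y
    by (rule sm_tr[OF assms(1) smooth_on_const[OF open_U']])
  show "linear (\<lambda>w. tr (F x) b w)" for x by (rule linear_T_right)
  show "E.pure s X (\<lambda>x. tr (F x) b y)" for y
    by (rule E.pure_linear[OF linear_T_left T_J_left assms(1,3)])
qed

lemma NL_tr:
  assumes "smooth_on U F" "smooth_on U H" "E.NL s X l F"
  shows "E.NL s X l (\<lambda>x. tr (F x) b (H x))"
proof (rule E.NL_family[where \<Lambda> = "\<lambda>x w. tr (F x) b w", OF zero_U assms(2)])
  show "smooth_on U (\<lambda>x. tr (F x) b y)" for y
    by (rule sm_tr[OF assms(1) smooth_on_const[OF open_U']])
  show "linear (\<lambda>w. tr (F x) b w)" for x by (rule linear_T_right)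
  show "E.NL s X l (\<lambda>x. tr (F x) b y)" for y
    by (rule E.NL_linear[OF linear_T_left T_J_left assms(1,3)])
qed

section \<open>Linear systems for curvature, metric and gradient\<close>

text \<open>By \<open>P_GG\<close>, applying \<open>GG\<close> turns covariant (1,0)-derivatives
  into plain ones, so as far as \<open>P\<close> can see a parallel curvature becomes constant.
  \<open>\<Omega>\<close> is the difference from that constant.\<close>

definition \<Omega> :: "'e \<Rightarrow> 'e \<Rightarrow> 'e \<Rightarrow> 'e \<Rightarrow> 'e" where
  "\<Omega> c b y x = GG x (T x c b y) - tr (GG x c) b (GG x y)"

lemma sm_GGT: "smooth_on U (\<lambda>x. GG x (T x c b y))"
  by (rule smooth_on_family[OF open_U' sm_T sm_GG linear_GG])

lemma sm_\<Omega>: "smooth_on U (\<Omega> c b y)"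
  unfolding \<Omega>_def[abs_def] by (intro smooth_on_diff sm_GGT sm_tr sm_GG)

lemma linear_\<Omega>: "linear (\<lambda>c. \<Omega> c b y x)" "linear (\<lambda>y. \<Omega> c b y x)"
  by (simp_all add: linear_iff \<Omega>_def linear_add[OF linear_T_left] linear_cmul[OF linear_T_left]
      linear_add[OF linear_T_right] linear_cmul[OF linear_T_right]
      linear_add[OF linear_GG] linear_cmul[OF linear_GG] algebra_simps)

lemma P_\<Omega>:
  assumes x: "x \<in> U"
  shows "P X (\<Omega> c b y) x = \<Omega> (\<Gamma> x X c) b y x + \<Omega> c b (\<Gamma> x X y) x"
proof -
  have "P X (\<lambda>x. GG x (T x c b y)) x = GG x (\<Gamma> x X (T x c b y)) + GG x (P X (\<lambda>x. T x c b y) x)"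
    unfolding P_GG[OF x, symmetric]
    by (rule E.W_family_linear[OF sm_T sm_GG linear_GG GG_J x])
  also have "\<dots> = GG x (T x (\<Gamma> x X c) b y) + GG x (T x c b (\<Gamma> x X y))"
    by (simp add: P_T[OF x] linear_add[OF linear_GG] linear_neg[OF linear_GG] linear_diff[OF linear_GG])
  finally have 1: "P X (\<lambda>x. GG x (T x c b y)) x = GG x (T x (\<Gamma> x X c) b y) + GG x (T x c b (\<Gamma> x X y))" .
  have 2: "P X (\<lambda>x. tr (GG x c) b (GG x y)) x = tr (GG x (\<Gamma> x X c)) b (GG x y) + tr (GG x c) b (GG x (\<Gamma> x X y))"
    by (simp add: W_tr sm_GG P_GG[OF x])
  show ?thesis unfolding \<Omega>_def[abs_def]
    by (simp add: lin_op_diff[OF E.lin_op_W sm_GGT sm_tr] sm_GG 1 2)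
qed

lemma pure_\<Omega>: "E.pure (- 1) X (\<Omega> c b y)"
proof -
  have "E.pure (- 1) X (\<lambda>x. GG x (T x c b y) - T x c b y)"
    by (rule E.pure_family[where \<Lambda> = "\<lambda>x y. GG x y - y", OF zero_U sm_T sm_GG_diff linear_GG_diff pure_GG(1)])
  then have 1: "E.pure (- 1) X (\<lambda>x. (GG x (T x c b y) - T x c b y) + (T x c b y - tr c b y))"
    by (rule E.pure_add[rotated 2, OF _ pure_T])
      (intro smooth_on_diff sm_GGT sm_T smooth_on_const[OF open_U'])+
  \<comment> \<open>The change of \<open>tr (GG x c) b (GG x y)\<close> from
    \<open>tr c b y\<close>, one argument at a time. The second product is written in exchanged
    order because \<open>pure_tr\<close> expects the pure factor in the first slot.\<close>
  have 2: "E.pure (- 1) X (\<lambda>x. tr (GG x c - c) b (GG x y) + tr (GG x y - y) b c)"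
    by (rule E.pure_add[OF _ _ pure_tr[OF sm_GG_diff sm_GG pure_GG(1)]
          pure_tr[OF sm_GG_diff smooth_on_const[OF open_U'] pure_GG(1)]])
      (intro sm_tr sm_GG_diff sm_GG smooth_on_const[OF open_U'])+
  have "E.pure (- 1) X (\<lambda>x. (GG x (T x c b y) - T x c b y) + (T x c b y - tr c b y)
     - (tr (GG x c - c) b (GG x y) + tr (GG x y - y) b c))"
    by (rule E.pure_diff[OF _ _ 1 2])
      (intro smooth_on_add smooth_on_diff sm_GGT sm_T sm_tr sm_GG smooth_on_const[OF open_U'])+
  moreover have "(\<lambda>x. (GG x (T x c b y) - T x c b y) + (T x c b y - tr c b y)
     - (tr (GG x c - c) b (GG x y) + tr (GG x y - y) b c)) = \<Omega> c b y"
    by (simp add: \<Omega>_def fun_eq_iff linear_diff[OF linear_T_left] T_sym[of 0 _ b c])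
  ultimately show ?thesis by simp
qed

lemma NL_\<Omega>: "E.NL (- 1) X l (\<Omega> c b y)"
proof -
  \<comment> \<open>All parameters form a single family, since the derivative of a member is a
    combination of other members with coefficients from \<open>\<Gamma>\<close>.\<close>
  have "E.NL (- 1) X l ((\<lambda>(c, b, y). \<Omega> c b y) (c, b, y))"
  proof (rule E.NL_ode[where I = UNIV and F = "\<lambda>(c, b, y). \<Omega> c b y"])
    fix i :: "'e \<times> 'e \<times> 'e"
    show "E.pure (- 1) X ((\<lambda>(c, b, y). \<Omega> c b y) i)" by (cases i) (simp add: pure_\<Omega>)
  next
    fix l :: nat and i :: "'e \<times> 'e \<times> 'e"
    assume "\<And>j. j \<in> UNIV \<Longrightarrow> E.NL (- 1) X l ((\<lambda>(c, b, y). \<Omega> c b y) j)"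
    from this[of "(c, b, y)" for c b y] have IH: "E.NL (- 1) X l (\<Omega> c b y)" for c b y by simp
    obtain c b y where i: "i = (c, b, y)" by (cases i)
    have 1: "smooth_on U (\<lambda>x. \<Omega> (\<Gamma> x X c) b y x)" "smooth_on U (\<lambda>x. \<Omega> c b (\<Gamma> x X y) x)"
      by (rule smooth_on_family[where \<Lambda> = "\<lambda>x c. \<Omega> c b y x", OF open_U' smooth_\<Gamma> sm_\<Omega> linear_\<Omega>(1)]
          smooth_on_family[where \<Lambda> = "\<lambda>x y. \<Omega> c b y x", OF open_U' smooth_\<Gamma> sm_\<Omega> linear_\<Omega>(2)])+
    have "E.NL (- 1) X l (\<lambda>x. \<Omega> (\<Gamma> x X c) b y x + \<Omega> c b (\<Gamma> x X y) x)"
      by (intro E.NL_add 1 E.NL_family[where \<Lambda> = "\<lambda>x c. \<Omega> c b y x", OF zero_U smooth_\<Gamma> sm_\<Omega> linear_\<Omega>(1) IH]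
          E.NL_family[where \<Lambda> = "\<lambda>x y. \<Omega> c b y x", OF zero_U smooth_\<Gamma> sm_\<Omega> linear_\<Omega>(2) IH])
    then have "E.NL (- 1) X l (P X (\<Omega> c b y))"
      by (rule E.NL_cong[OF zero_U, rotated]) (rule P_\<Omega>[symmetric])
    then show "E.NL (- 1) X l (wd U J J (- (- 1)) X ((\<lambda>(c, b, y). \<Omega> c b y) i))" by (simp add: i)
  qed simp
  then show ?thesis by simp
qed

text \<open>By \<open>P_\<Psi>\<close> this is the \<open>P\<close>-derivative of
  \<open>\<Psi>\<close>. Its system closes up to \<open>\<Omega>\<close>, so it is settled before
  \<open>\<Psi>\<close>.\<close>

definition \<Theta> :: "'e \<Rightarrow> 'e \<Rightarrow> 'e \<Rightarrow> 'e" where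
  "\<Theta> b y x = Q b (\<lambda>x. GG x y) x + tr (Z x) b (GG x y)"

lemma sm_\<Theta>: "smooth_on U (\<Theta> b y)"
  unfolding \<Theta>_def[abs_def] by (intro smooth_on_add E.sm_W sm_GG sm_tr sm_Z)

lemma linear_\<Theta>: "linear (\<lambda>y. \<Theta> b y x)"
proof -
  have "Q b (\<lambda>x. GG x (y + z)) x = Q b (\<lambda>x. GG x y) x + Q b (\<lambda>x. GG x z) x" for y z
    by (simp add: linear_add[OF linear_GG] E.W_add sm_GG)
  moreover have "Q b (\<lambda>x. GG x (r *\<^sub>R y)) x = r *\<^sub>R Q b (\<lambda>x. GG x y) x" for r y
    by (simp add: linear_cmul[OF linear_GG] lin_op_scaleR[OF E.lin_op_W] sm_GG)
  ultimately show ?thesis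
    by (simp add: linear_iff \<Theta>_def linear_add[OF linear_GG] linear_cmul[OF linear_GG]
        linear_add[OF linear_T_right] linear_cmul[OF linear_T_right] algebra_simps)
qed

text \<open>After commuting \<open>P\<close> with \<open>Q\<close>, the \<open>Q\<close>-derivative
  falls either on the metric, which reproduces \<open>\<Theta>\<close>, or on the Christoffel map,
  which produces the curvature. What the curvature leaves is \<open>\<Omega>\<close>, whose jets are
  already known to vanish.\<close>

lemma P_\<Theta>:
  assumes x: "x \<in> U"
  shows "P X (\<Theta> b y) x = \<Theta> b (\<Gamma> x X y) x - \<Omega> X b y x"
proof -
  have "P X (Q b (\<lambda>x. GG x y)) = Q b (\<lambda>x. GG x (\<Gamma> x X y))"
    unfolding E.W_commute[OF sm_GG, of 1 X] by (rule E.W_cong) (rule P_GG)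
  moreover have "Q b (\<lambda>x. GG x (\<Gamma> x X y)) x = Q b (\<lambda>z. GG z (\<Gamma> x X y)) x + GG x (Q b (\<lambda>x. \<Gamma> x X y) x)"
    by (rule E.W_family_linear[OF smooth_\<Gamma> sm_GG linear_GG GG_J x])
  moreover have "Q b (\<lambda>x. \<Gamma> x X y) x = - T x X b y" by (simp add: T_def)
  ultimately have 1: "P X (Q b (\<lambda>x. GG x y)) x = Q b (\<lambda>z. GG z (\<Gamma> x X y)) x - GG x (T x X b y)"
    by (simp add: linear_neg[OF linear_GG])
  have 2: "P X (\<lambda>x. tr (Z x) b (GG x y)) x = tr (GG x X) b (GG x y) + tr (Z x) b (GG x (\<Gamma> x X y))"
    by (simp add: W_tr sm_GG sm_Z P_GG[OF x]) (simp add: GG_def)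
  show ?thesis unfolding \<Theta>_def[abs_def]
    by (simp add: E.W_add E.sm_W sm_tr sm_GG sm_Z 1 2 \<Omega>_def)
qed

lemma pure_Q_of:
  assumes "smooth_on U F" "\<And>X. E.pure (- 1) X F"
  shows "E.pure (- 1) X (Q b F)"
  unfolding E.pure_def using E.W_polarize[OF assms(1)] assms(2) unfolding E.pure_def by blast

lemma pure_\<Theta>: "E.pure (- 1) X (\<Theta> b y)"
proof -
  have "E.pure (- 1) X (Q b (\<lambda>x. GG x y))"
    using pure_Q_of[OF sm_GG_diff pure_GG(1), of X b y] by (simp add: E.W_minus_const sm_GG)
  then show ?thesis unfolding \<Theta>_def[abs_def]
    by (intro E.pure_add E.sm_W sm_GG sm_tr sm_Z pure_tr pure_Z)
qed

lemma NL_\<Theta>: "E.NL (- 1) X l (\<Theta> b y)"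
proof -
  have "E.NL (- 1) X l ((\<lambda>(b, y). \<Theta> b y) (b, y))"
  proof (rule E.NL_ode[where I = UNIV and F = "\<lambda>(b, y). \<Theta> b y"])
    fix i :: "'e \<times> 'e"
    show "E.pure (- 1) X ((\<lambda>(b, y). \<Theta> b y) i)" by (cases i) (simp add: pure_\<Theta>)
  next
    fix l :: nat and i :: "'e \<times> 'e"
    assume "\<And>j. j \<in> UNIV \<Longrightarrow> E.NL (- 1) X l ((\<lambda>(b, y). \<Theta> b y) j)"
    from this[of "(b, y)" for b y] have IH: "E.NL (- 1) X l (\<Theta> b y)" for b y by simp
    obtain b y where i: "i = (b, y)" by (cases i)
    have 1: "smooth_on U (\<lambda>x. \<Theta> b (\<Gamma> x X y) x)"
      by (rule smooth_on_family[where \<Lambda> = "\<lambda>x y. \<Theta> b y x", OF open_U' smooth_\<Gamma> sm_\<Theta> linear_\<Theta>])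
    have "E.NL (- 1) X l (\<lambda>x. \<Theta> b (\<Gamma> x X y) x - \<Omega> X b y x)"
      by (intro E.NL_diff 1 sm_\<Omega> NL_\<Omega> E.NL_family[where \<Lambda> = "\<lambda>x y. \<Theta> b y x", OF zero_U smooth_\<Gamma> sm_\<Theta> linear_\<Theta> IH])
    then have "E.NL (- 1) X l (P X (\<Theta> b y))"
      by (rule E.NL_cong[OF zero_U, rotated]) (rule P_\<Theta>[symmetric])
    then show "E.NL (- 1) X l (wd U J J (- (- 1)) X ((\<lambda>(b, y). \<Theta> b y) i))" by (simp add: i)
  qed simp
  then show ?thesis by simp
qed

text \<open>\<open>\<Psi> b = 0\<close> is a Riccati equation for \<open>Z\<close> in the
  (0,1)-directions.\<close>

definition \<Psi> :: "'e \<Rightarrow> 'e \<Rightarrow> 'e" where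
  "\<Psi> b x = Q b Z x + (1 / 2) *\<^sub>R tr (Z x) b (Z x)"

lemma sm_\<Psi>: "smooth_on U (\<Psi> b)"
  unfolding \<Psi>_def[abs_def] by (intro smooth_on_add E.sm_W smooth_on_cscaleR sm_tr sm_Z)

lemma W_tr_Z: "wd U J J s X (\<lambda>x. (1 / 2) *\<^sub>R tr (Z x) b (Z x)) = (\<lambda>x. tr (Z x) b (wd U J J s X Z x))"
proof -
  have "tr (wd U J J s X Z x) b (Z x) = tr (Z x) b (wd U J J s X Z x)" for x by (rule T_sym)
  then show ?thesis
    by (simp add: lin_op_scaleR[OF E.lin_op_W] sm_tr sm_Z W_tr scaleR_2[symmetric])
qed

lemma P_\<Psi>: "P X (\<Psi> b) = \<Theta> b X"
  unfolding \<Psi>_def[abs_def] \<Theta>_def[abs_def]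
  by (simp add: E.W_add E.sm_W smooth_on_cscaleR sm_tr sm_Z W_tr_Z E.W_commute[OF sm_Z, of 1 X] GG_eq)
    (simp add: GG_def)

lemma pure_\<Psi>: "E.pure (- 1) X (\<Psi> b)"
proof -
  have "E.pure (- 1) X (\<lambda>x. (1 / 2) *\<^sub>R tr (Z x) b (Z x))"
    by (rule E.pure_linear[OF bounded_linear.linear[OF bounded_linear_scaleR_right]])
      (simp_all add: sm_tr sm_Z pure_tr pure_Z)
  then show ?thesis unfolding \<Psi>_def[abs_def]
    by (intro E.pure_add E.sm_W smooth_on_cscaleR sm_tr sm_Z pure_Q_of pure_Z)
qed

lemma NL_\<Psi>: "E.NL (- 1) X l (\<Psi> b)"
  by (cases l) (simp_all add: E.NL_0 E.NL_Suc pure_\<Psi> P_\<Psi> NL_\<Theta>)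

lemma flat0_of_NL: 
  assumes "smooth_on U F" "\<And>X l. E.NL (- 1) X l F"
  shows "flat0 U F"
  by (rule E.flat0I) (use assms E.flat_iff_NL' in auto)

lemma flat0_of_NL': 
  assumes "smooth_on U F" "\<And>X l. E.NL 1 X l F"
  shows "flat0 U F"
  by (rule E.flat0I) (use assms E.flat_iff_NL in auto)

lemma flat0_\<Theta>: "flat0 U (\<Theta> b y)"
  by (rule flat0_of_NL[OF sm_\<Theta> NL_\<Theta>])

lemma flat0_\<Psi>: "flat0 U (\<Psi> b)"
  by (rule flat0_of_NL[OF sm_\<Psi> NL_\<Psi>])

lemma flat0_NL: "smooth_on U F \<Longrightarrow> flat0 U F \<Longrightarrow> E.NL 1 X l F"
  using E.flat0_flat E.flat_iff_NL by blast

end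

lemma ddn_cong0:
  assumes "open U" "0 \<in> U" "\<And>y. y \<in> U \<Longrightarrow> F y = G y"
  shows "(dd U X ^^ n) F 0 = (dd U X ^^ n) G 0"
proof (cases n)
  case (Suc m)
  have "dd U X F = dd U X G" by (rule dd_cong[OF assms(1)]) (simp add: assms(3))
  then show ?thesis unfolding Suc funpow_Suc_right o_apply by simp
qed (use assms in simp)

lemma (in wirtinger) Wn_antilinear:
  assumes "linear M" "\<And>y. M (K y) = - K (M y)" "sm F"
  shows "(W s v ^^ n) (\<lambda>x. M (F x)) = (\<lambda>x. M ((W (- s) v ^^ n) F x))"
proof (induction n)
  case (Suc n) then show ?case by (simp add: W_antilinear[OF assms(1,2) sm_Wn[OF assms(3)]])
qed simp

context symmetric_kaehler_jet begin

section \<open>Symmetries of the triple product\<close>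

lemma tr_eq: "tr a b c = - Q b (P a (P c Z)) 0"
proof -
  have "\<Gamma> 0 a c = 0"
    using pure_\<Gamma>[of a c] unfolding E.pure_def by (metis funpow_0)
  moreover have "Q b (\<lambda>x. GG x (\<Gamma> x a c)) 0 = Q b (\<lambda>x. GG x (\<Gamma> 0 a c)) 0 + GG 0 (Q b (\<lambda>x. \<Gamma> x a c) 0)"
    by (rule E.W_family_linear[OF smooth_\<Gamma> sm_GG linear_GG GG_J zero_U])
  moreover have "Q b (P a (\<lambda>x. GG x c)) = Q b (\<lambda>x. GG x (\<Gamma> x a c))"
    by (rule E.W_cong) (rule P_GG)
  ultimately show ?thesis
    by (simp add: T_def GG_eq linear_0[OF linear_GG] GG_0)
qed

text \<open>As \<open>\<Gamma> 0\<close> vanishes and \<open>GG 0\<close> is the identity, the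
  curvature at the origin is a plain fourth derivative of the potential, from which its symmetries
  can be read off.\<close>

lemma hm_tr: "hm (tr a b c) w = - QC b (PC a (PC c (QC w fc))) 0"
proof -
  have "QC b (PC a (PC c (\<lambda>x. hm (Z x) w))) = (\<lambda>x. hm (Q b (P a (P c Z)) x) w)"
    by (simp add: hm_W sm_Z E.sm_W)
  then show ?thesis
    by (simp add: tr_eq hm_Z[of w, symmetric] linear_neg[OF linear_hm])
qed

lemma B_tr: "B (tr a b c) w = - Re (QC b (PC a (PC c (QC w fc))) 0)"
  using arg_cong[OF hm_tr[of a b c w], of Re] by (simp add: Re_hm)

text \<open>
  \<open>B (tr a b c) w\<close> is a fourth derivative of the potential, in which the two \<open>Q\<close>-derivatives commute.
\<close>

lemma B_tr_swap: "B (tr a b c) w = B (tr a w c) b"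
proof -
  have e: "QC b (PC a (PC c (QC w fc))) = PC a (PC c (QC b (QC w fc)))" for b w
    by (simp add: C.W_commute[of _ "-1" b] C.sm_W sm_fc)
  show ?thesis unfolding B_tr e C.W_commute[OF sm_fc, of "-1" b] ..
qed

lemma cnj_W: "smooth_on U F \<Longrightarrow> wd U J ((*) \<i>) s v (\<lambda>x. cnj (F x)) = (\<lambda>x. cnj (wd U J ((*) \<i>) (- s) v F x))"
  by (rule C.W_antilinear) (simp_all add: bounded_linear.linear bounded_linear_cnj)

text \<open>The potential is real, so conjugation exchanges \<open>P\<close> and \<open>Q\<close> in
  the fourth derivative.\<close>

lemma B_tr_conj: "B (tr a b c) w = B (tr b a w) c"
proof -
  have "(\<lambda>x. cnj (fc x)) = fc" by simp
  then have "cnj (QC b (PC a (PC c (QC w fc))) 0) = PC b (QC a (QC c (PC w fc))) 0"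
    using cnj_W[OF sm_fc, of 1 w] cnj_W[of "QC w fc" "-1" c] cnj_W[of "PC c (QC w fc)" "-1" a]
      cnj_W[of "PC a (PC c (QC w fc))" 1 b] by (simp add: C.sm_W sm_fc)
  also have "PC b (QC a (QC c (PC w fc))) = QC a (PC b (PC w (QC c fc)))"
    unfolding C.W_commute[OF C.sm_W[OF C.sm_W[OF sm_fc]], of 1 b "-1" a] C.W_commute[OF sm_fc, of "-1" c 1 w] ..
  finally have "Re (QC b (PC a (PC c (QC w fc))) 0) = Re (QC a (PC b (PC w (QC c fc))) 0)"
    by (metis complex_cnj(1) complex.collapse complex.sel(1))
  then show ?thesis by (simp add: B_tr)
qed

lemma Q_Z: "Q b Z x = \<Psi> b x - (1 / 2) *\<^sub>R tr (Z x) b (Z x)"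
  by (simp add: \<Psi>_def)

lemma flat0_tr:
  assumes F: "smooth_on U F" and H: "smooth_on U H" "flat0 U H"
  shows "flat0 U (\<lambda>x. tr (F x) b (H x))"
proof -
  have 1: "smooth_on U (\<lambda>x. (F x \<bullet> i) *\<^sub>R tr i b (H x))" for i
    by (intro smooth_on_scaleR smooth_on_component F sm_tr smooth_on_const open_U' H(1))
  have "flat0 U (\<lambda>x. (F x \<bullet> i) *\<^sub>R tr i b (H x))" for i
    by (rule flat0_scalar[OF smooth_on_component[OF F] sm_tr[OF smooth_on_const[OF open_U'] H(1)]
          flat0_linear[OF linear_T_right H]])
  then have "flat0 U (\<lambda>x. \<Sum>i\<in>Basis. (F x \<bullet> i) *\<^sub>R tr i b (H x))"
    by (rule flat0_sum[OF open_U' 1])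
  then show ?thesis
    using linear_basis_expansion[OF linear_T_left[of 0 b], of "F _"] by simp
qed

lemma QQ_Z: "Q c (Q b Z) = (\<lambda>x. (Q c (\<Psi> b) x - tr (Z x) b (\<Psi> c x)) + (1 / 2) *\<^sub>R tr (Z x) b (tr (Z x) c (Z x)))"
proof -
  have "Q b Z = (\<lambda>x. \<Psi> b x - (1 / 2) *\<^sub>R tr (Z x) b (Z x))" by (simp add: \<Psi>_def)
  then have "Q c (Q b Z) = (\<lambda>x. Q c (\<Psi> b) x - tr (Z x) b (Q c Z x))"
    by (simp add: lin_op_diff[OF E.lin_op_W] sm_\<Psi> smooth_on_cscaleR sm_tr sm_Z W_tr_Z)
  then show ?thesis
    by (simp add: Q_Z fun_eq_iff linear_diff[OF linear_T_right] linear_cmul[OF linear_T_right])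
qed

lemma sm_tr_tr: "smooth_on U (\<lambda>x. tr (Z x) b (tr (Z x) c (Z x)))"
  by (intro sm_tr sm_Z)

text \<open>
  The second \<open>Q\<close>-derivative of \<open>Z\<close>, computed from \<open>Q b Z \<equiv> - tr Z b Z / 2\<close>, is symmetric.
\<close>

lemma flat0_jordan: "flat0 U (\<lambda>x. tr (Z x) b (tr (Z x) c (Z x)) - tr (Z x) c (tr (Z x) b (Z x)))"
proof -
  define H where "H b c x = Q c (\<Psi> b) x - tr (Z x) b (\<Psi> c x)" for b c x
  have H: "smooth_on U (H b c)" "flat0 U (H b c)" for b c
    unfolding H_def[abs_def]
    by (rule smooth_on_diff[OF E.sm_W[OF sm_\<Psi>] sm_tr[OF sm_Z sm_\<Psi>]]
        flat0_diff[OF E.sm_W[OF sm_\<Psi>] sm_tr[OF sm_Z sm_\<Psi>] E.flat0_W[OF sm_\<Psi> flat0_\<Psi>] flat0_tr[OF sm_Z sm_\<Psi> flat0_\<Psi>]])+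
  have "H b c x + (1 / 2) *\<^sub>R tr (Z x) b (tr (Z x) c (Z x)) = H c b x + (1 / 2) *\<^sub>R tr (Z x) c (tr (Z x) b (Z x))" for x
    using fun_cong[OF E.W_commute[OF sm_Z, of "-1" c "-1" b], of x] unfolding QQ_Z H_def .
  then have "2 *\<^sub>R (H b c x + (1 / 2) *\<^sub>R tr (Z x) b (tr (Z x) c (Z x))) = 2 *\<^sub>R (H c b x + (1 / 2) *\<^sub>R tr (Z x) c (tr (Z x) b (Z x)))" for x
    by simp
  then have "2 *\<^sub>R (H c b x - H b c x) = tr (Z x) b (tr (Z x) c (Z x)) - tr (Z x) c (tr (Z x) b (Z x))" for x
    by (simp add: algebra_simps)
  moreover have "flat0 U (\<lambda>x. 2 *\<^sub>R (H c b x - H b c x))"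
    by (rule flat0_linear[OF bounded_linear.linear[OF bounded_linear_scaleR_right] smooth_on_diff[OF H(1) H(1)]
          flat0_diff[OF H(1) H(1) H(2) H(2)]])
  ultimately show ?thesis by simp
qed

lemma P_Z_0: "P X Z 0 = X"
  using GG_0[of X] by (simp add: GG_def)

text \<open>Since \<open>Z 0 = 0\<close>, each of the three factors \<open>Z\<close> must receive
  exactly one derivative; the 6 ways of distributing them give the same term because
  \<open>P X Z 0 = X\<close>.\<close>

lemma PPP_tr: "P X (P X (P X (\<lambda>x. tr (Z x) b (tr (Z x) c (Z x))))) 0 = 6 *\<^sub>R tr X b (tr X c X)"
proof -
  have six: "6 *\<^sub>R a = a + a + a + a + a + a" for a :: 'e
  proof -
    have "(6::real) = 1 + 1 + 1 + 1 + 1 + 1" by simp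
    then show ?thesis by (simp only: scaleR_left_distrib scaleR_one)
  qed
  show ?thesis
    by (simp add: W_tr E.W_add E.sm_W sm_tr sm_Z smooth_on_add Z_0 P_Z_0 six
        linear_0[OF linear_T_left] linear_0[OF linear_T_right] linear_add[OF linear_T_right])
qed

text \<open>
  Third order \<open>P\<close>-jet of \<open>flat0_jordan\<close>, as \<open>Z x = x\<close> up to higher bidegree.
\<close>

lemma jordan_identity: "tr X b (tr X c X) = tr X c (tr X b X)"
proof -
  let ?V = "\<lambda>x. tr (Z x) b (tr (Z x) c (Z x)) - tr (Z x) c (tr (Z x) b (Z x))"
  have "E.flat X ?V"
    by (rule E.flat0_flat[OF _ flat0_jordan]) (intro smooth_on_diff sm_tr_tr)
  then have "(P X ^^ Suc (Suc (Suc 0))) ((Q X ^^ 0) ?V) 0 = 0"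
    unfolding E.flat_def by blast
  then have "P X (P X (P X ?V)) 0 = 0" by simp
  also have "P X (P X (P X ?V)) 0 = 6 *\<^sub>R tr X b (tr X c X) - 6 *\<^sub>R tr X c (tr X b X)"
    by (simp add: lin_op_diff[OF E.lin_op_W] E.sm_W sm_tr_tr PPP_tr)
  finally show ?thesis by simp
qed

text \<open>Tested against vectors by means of \<open>B\<close>, the (0,1)-derivative of the later
  \<open>defect\<close> consists of \<open>\<Psi>\<close> and half of this expression.\<close>

definition \<Delta> :: "'e \<Rightarrow> 'e \<Rightarrow> 'e" where
  "\<Delta> b x = GG x (tr x b x) - tr (Z x) b (Z x)"

lemma sm_tr_ident: "smooth_on U (\<lambda>x. tr x b x)"
  by (intro sm_tr sm_ident)

lemma sm_GG_tr: "smooth_on U (\<lambda>x. GG x (tr x b x))"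
  by (rule smooth_on_family[OF open_U' sm_tr_ident sm_GG linear_GG])

lemma sm_\<Delta>: "smooth_on U (\<Delta> b)"
  unfolding \<Delta>_def[abs_def] by (intro smooth_on_diff sm_GG_tr sm_tr sm_Z)

lemma Q_tr_ident: "x \<in> U \<Longrightarrow> Q X (\<lambda>x. tr x b x) x = 0"
  by (simp add: W_tr sm_ident W_ident linear_0[OF linear_T_left] linear_0[OF linear_T_right])

lemma Q_\<Delta>:
  assumes x: "x \<in> U"
  shows "Q X (\<Delta> b) x = \<Theta> X (tr x b x) x - tr (\<Delta> b x) X (Z x) - 2 *\<^sub>R tr (\<Psi> X x) b (Z x)"
proof -
  have 1: "Q X (\<lambda>x. GG x (tr x b x)) x = \<Theta> X (tr x b x) x - tr (Z x) X (GG x (tr x b x))"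
    using E.W_family_linear[OF sm_tr_ident sm_GG linear_GG GG_J x, of "-1" X b]
    by (simp add: Q_tr_ident[OF x] linear_0[OF linear_GG] \<Theta>_def)
  have 2: "Q X (\<lambda>x. tr (Z x) b (Z x)) x = 2 *\<^sub>R tr (\<Psi> X x) b (Z x) - tr (Z x) b (tr (Z x) X (Z x))"
    by (simp add: W_tr sm_Z Q_Z linear_diff[OF linear_T_right] linear_diff[OF linear_T_left]
        linear_cmul[OF linear_T_right] linear_cmul[OF linear_T_left] T_sym[of 0 "Z x" b] scaleR_2 algebra_simps
        scaleR_left_distrib[symmetric])
  have 3: "tr (\<Delta> b x) X (Z x) = tr (Z x) X (GG x (tr x b x)) - tr (Z x) b (tr (Z x) X (Z x))"
  proof -
    have "tr (\<Delta> b x) X (Z x) = tr (Z x) X (\<Delta> b x)" by (rule T_sym)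
    also have "\<dots> = tr (Z x) X (GG x (tr x b x)) - tr (Z x) X (tr (Z x) b (Z x))"
      unfolding \<Delta>_def by (rule linear_diff[OF linear_T_right])
    \<comment> \<open>Differentiating \<open>tr Z b Z\<close> leaves \<open>b\<close> in the outer
      product, whereas \<open>tr (\<Delta> b) X Z\<close> has \<open>X\<close> there. Only after
      this exchange does the equation become homogeneous in \<open>\<Delta>\<close>.\<close>
    also have "tr (Z x) X (tr (Z x) b (Z x)) = tr (Z x) b (tr (Z x) X (Z x))" by (rule jordan_identity)
    finally show ?thesis .
  qed
  have "Q X (\<Delta> b) x = Q X (\<lambda>x. GG x (tr x b x)) x - Q X (\<lambda>x. tr (Z x) b (Z x)) x"
    unfolding \<Delta>_def[abs_def] by (simp add: lin_op_diff[OF E.lin_op_W] sm_GG_tr sm_tr sm_Z)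
  then show ?thesis unfolding 1 2 3 by simp
qed

lemma sm_Z_diff: "smooth_on U (\<lambda>x. Z x - x)"
  by (intro smooth_on_diff sm_Z sm_ident)

text \<open>Modulo functions without pure \<open>P\<close>-jets, \<open>GG x\<close> is the identity
  and \<open>Z x\<close> is \<open>x\<close>, so both terms of \<open>\<Delta>\<close> become
  \<open>tr x b x\<close>.\<close>

lemma pure_\<Delta>: "E.pure 1 X (\<Delta> b)"
proof -
  have 1: "E.pure 1 X (\<lambda>x. GG x (tr x b x) - tr x b x)"
    by (rule E.pure_family[where \<Lambda> = "\<lambda>x y. GG x y - y", OF zero_U sm_tr_ident sm_GG_diff linear_GG_diff pure_GG(2)])
  have 2: "E.pure 1 X (\<lambda>x. tr (Z x - x) b (Z x) + tr (Z x - x) b x)"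
    by (rule E.pure_add[OF _ _ pure_tr[OF sm_Z_diff sm_Z pure_Z'] pure_tr[OF sm_Z_diff sm_ident pure_Z']])
      (intro sm_tr sm_Z_diff sm_Z sm_ident)+
  have "E.pure 1 X (\<lambda>x. (GG x (tr x b x) - tr x b x) - (tr (Z x - x) b (Z x) + tr (Z x - x) b x))"
    by (rule E.pure_diff[OF _ _ 1 2]) (intro smooth_on_diff smooth_on_add sm_GG_tr sm_tr sm_Z sm_ident)+
  moreover have "(\<lambda>x. (GG x (tr x b x) - tr x b x) - (tr (Z x - x) b (Z x) + tr (Z x - x) b x)) = \<Delta> b"
  proof
    fix x
    have "tr (Z x) b x = tr x b (Z x)" by (rule T_sym)
    then show "(GG x (tr x b x) - tr x b x) - (tr (Z x - x) b (Z x) + tr (Z x - x) b x) = \<Delta> b x"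
      by (simp add: \<Delta>_def linear_diff[OF linear_T_left])
  qed
  ultimately show ?thesis by simp
qed

lemma flat0_\<Delta>: "flat0 U (\<Delta> b)"
proof (rule flat0_of_NL'[OF sm_\<Delta>])
  fix X l
  show "E.NL 1 X l (\<Delta> b)"
  proof (rule E.NL_ode[where I = UNIV and F = \<Delta>])
    show "E.pure 1 X (\<Delta> i)" for i by (rule pure_\<Delta>)
  next
    fix l :: nat and b :: 'e
    assume "\<And>j. j \<in> UNIV \<Longrightarrow> E.NL 1 X l (\<Delta> j)"
    then have IH: "E.NL 1 X l (\<Delta> b)" by simp
    have s: "smooth_on U (\<lambda>x. \<Theta> X (tr x b x) x)"
      by (rule smooth_on_family[where \<Lambda> = "\<lambda>x y. \<Theta> X y x", OF open_U' sm_tr_ident sm_\<Theta> linear_\<Theta>])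
    have 1: "E.NL 1 X l (\<lambda>x. \<Theta> X (tr x b x) x)"
      by (rule E.NL_family[where \<Lambda> = "\<lambda>x y. \<Theta> X y x", OF zero_U sm_tr_ident sm_\<Theta> linear_\<Theta> flat0_NL[OF sm_\<Theta> flat0_\<Theta>]])
    have 2: "E.NL 1 X l (\<lambda>x. \<Theta> X (tr x b x) x - tr (\<Delta> b x) X (Z x))"
      by (rule E.NL_diff[OF s _ 1 NL_tr[OF sm_\<Delta> sm_Z IH]]) (intro sm_tr sm_\<Delta> sm_Z)
    have 3: "E.NL 1 X l (\<lambda>x. 2 *\<^sub>R tr (\<Psi> X x) b (Z x))"
      by (rule E.NL_linear[OF bounded_linear.linear[OF bounded_linear_scaleR_right] _ _ NL_tr[OF sm_\<Psi> sm_Z flat0_NL[OF sm_\<Psi> flat0_\<Psi>]]])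
        (auto intro: sm_tr sm_\<Psi> sm_Z)
    have "E.NL 1 X l (\<lambda>x. \<Theta> X (tr x b x) x - tr (\<Delta> b x) X (Z x) - 2 *\<^sub>R tr (\<Psi> X x) b (Z x))"
      by (rule E.NL_diff[OF _ _ 2 3]) (intro smooth_on_diff smooth_on_cscaleR s sm_tr sm_\<Delta> sm_\<Psi> sm_Z)+
    then show "E.NL 1 X l (Q X (\<Delta> b))"
      by (rule E.NL_cong[OF zero_U, rotated]) (rule Q_\<Delta>[symmetric])
  qed simp
qed

text \<open>
  Its vanishing is the equation \<open>Z = x - {x Z x} / 2\<close>, which determines the Taylor series of \<open>Z\<close>.
\<close>

definition defect :: "'e \<Rightarrow> 'e" where
  "defect x = Z x + (1 / 2) *\<^sub>R tr x (Z x) x - x"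

lemma sm_tr_mid:
  assumes "smooth_on U Y" "smooth_on U F" "smooth_on U H"
  shows "smooth_on U (\<lambda>x. tr (F x) (Y x) (H x))"
  by (rule smooth_on_family[where \<Lambda> = "\<lambda>x y. tr (F x) y (H x)", OF open_U' assms(1) sm_tr[OF assms(2,3)] linear_T_mid])

lemma sm_defect: "smooth_on U defect"
  unfolding defect_def[abs_def] by (intro smooth_on_diff smooth_on_add smooth_on_cscaleR sm_Z sm_ident sm_tr_mid)

text \<open>Here \<open>Z\<close> sits in the conjugate linear slot, so pure \<open>P\<close>-words
  of the product see pure \<open>Q\<close>-words of \<open>Z\<close>, and these vanish.\<close>

lemma pure_tr_mid: "E.pure 1 X (\<lambda>x. tr x (Z x) x)"
proof -
  have 1: "E.pure 1 X (\<lambda>x. tr p (Z x) q)" for p q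
    using pure_Z[of X] unfolding E.pure_def E.Wn_antilinear[OF linear_T_mid T_J_mid sm_Z]
    by (simp add: linear_0[OF linear_T_mid])
  have 2: "E.pure 1 X (\<lambda>x. tr x (Z x) q)" for q
    by (rule E.pure_family[where \<Lambda> = "\<lambda>x p. tr p (Z x) q", OF zero_U sm_ident _ linear_T_left 1])
      (intro sm_tr_mid sm_Z smooth_on_const open_U')
  show ?thesis
    by (rule E.pure_family[where \<Lambda> = "\<lambda>x q. tr x (Z x) q", OF zero_U sm_ident _ linear_T_right 2])
      (intro sm_tr_mid sm_Z sm_ident smooth_on_const open_U')
qed

lemma pure_defect: "E.pure 1 X defect"
proof -
  have 1: "E.pure 1 X (\<lambda>x. (1 / 2) *\<^sub>R tr x (Z x) x)"
    by (rule E.pure_linear[OF bounded_linear.linear[OF bounded_linear_scaleR_right] _ _ pure_tr_mid])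
      (auto intro: sm_tr_mid sm_Z sm_ident)
  have "E.pure 1 X (\<lambda>x. (Z x - x) + (1 / 2) *\<^sub>R tr x (Z x) x)"
    by (rule E.pure_add[OF sm_Z_diff _ pure_Z' 1]) (intro smooth_on_cscaleR sm_tr_mid sm_Z sm_ident)
  then show ?thesis unfolding defect_def[abs_def] by (simp add: algebra_simps)
qed

lemma Q_defect:
  assumes x: "x \<in> U"
  shows "Q X defect x = Q X Z x + (1 / 2) *\<^sub>R tr x (GG x X) x"
proof -
  have "Q X (\<lambda>x. tr x (Z x) x) x = Q X (\<lambda>y. tr y (Z x) y) x + tr x (P X Z x) x"
    using E.W_family_antilinear[where \<Lambda> = "\<lambda>x y. tr x y x", OF sm_Z sm_tr_ident linear_T_mid T_J_mid x, of "-1" X]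
    by simp
  then have 1: "Q X (\<lambda>x. tr x (Z x) x) x = tr x (GG x X) x"
    by (simp add: Q_tr_ident[OF x] GG_def)
  show ?thesis unfolding defect_def[abs_def]
    by (simp add: lin_op_diff[OF E.lin_op_W] E.W_add lin_op_scaleR[OF E.lin_op_W] smooth_on_add smooth_on_cscaleR
        sm_Z sm_ident sm_tr_mid 1 W_ident)
qed

text \<open>\<open>B_tr_swap\<close> exchanges the conjugate linear argument with the test vector,
  after which symmetry of \<open>GG x\<close> moves the metric onto \<open>tr x b x\<close>.\<close>

lemma B_Q_defect:
  assumes x: "x \<in> U"
  shows "B (Q X defect x) b = B (\<Psi> X x) b + B (\<Delta> b x) X / 2"
proof -
  have "B (tr x (GG x X) x) b = B (GG x (tr x b x)) X"
    by (simp add: B_tr_swap[of x "GG x X"] B_GG_sym)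
  moreover have "B (tr (Z x) X (Z x)) b = B (tr (Z x) b (Z x)) X" by (rule B_tr_swap)
  ultimately show ?thesis
    by (simp add: Q_defect[OF x] Q_Z \<Delta>_def B_simps diff_divide_distrib)
qed

text \<open>\<open>B_Q_defect\<close> yields components only. The vectors \<open>raise b\<close> are
  the basis dual to \<open>Basis\<close> with respect to \<open>B\<close> and reassemble the
  derivative from them.\<close>

lemma flat0_Q_defect: "flat0 U (Q X defect)"
proof -
  let ?H = "\<lambda>b x. B (\<Psi> X x) b *\<^sub>R raise b + (B (\<Delta> b x) X / 2) *\<^sub>R raise b"
  have l: "linear (\<lambda>y. B y p *\<^sub>R q)" "linear (\<lambda>y. (B y p / 2) *\<^sub>R q)" for p q :: 'e
    by (simp_all add: linear_iff B_simps algebra_simps add_divide_distrib)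
  then have bl: "bounded_linear (\<lambda>y. B y p *\<^sub>R q)" "bounded_linear (\<lambda>y. (B y p / 2) *\<^sub>R q)" for p q :: 'e
    by (simp_all add: linear_conv_bounded_linear)
  have s: "smooth_on U (\<lambda>x. B (\<Psi> X x) b *\<^sub>R raise b)" "smooth_on U (\<lambda>x. (B (\<Delta> b x) X / 2) *\<^sub>R raise b)" for b
    using smooth_on_bounded_linear[OF bl(1) sm_\<Psi>] smooth_on_bounded_linear[OF bl(2) sm_\<Delta>] by auto
  have "flat0 U (?H b)" for b
    by (rule flat0_add[OF s flat0_linear[OF l(1) sm_\<Psi> flat0_\<Psi>] flat0_linear[OF l(2) sm_\<Delta> flat0_\<Delta>]])
  then have "flat0 U (\<lambda>x. \<Sum>b\<in>Basis. ?H b x)"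
    by (rule flat0_sum[OF open_U' smooth_on_add[OF s]])
  moreover have "(\<Sum>b\<in>Basis. ?H b x) = Q X defect x" if x: "x \<in> U" for x
  proof (rule B_eqI)
    fix w
    have "B (\<Sum>b\<in>Basis. ?H b x) w = (\<Sum>b\<in>Basis. (w \<bullet> b) *\<^sub>R B (Q X defect x) b)"
      by (simp add: linear_sum[OF linear_B_left] scaleR_left_distrib[symmetric] B_simps B_raise B_Q_defect[OF x]
          inner_commute mult.commute)
    also have "\<dots> = B (Q X defect x) w"
      using linear_basis_expansion[OF linear_B_right, of "Q X defect x" w] by simp
    finally show "B (\<Sum>b\<in>Basis. ?H b x) w = B (Q X defect x) w" .
  qed
  ultimately show ?thesis by (rule flat0_cong[OF open_U' zero_U, rotated])
qed

lemma flat0_defect: "flat0 U defect"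
proof (rule flat0_of_NL'[OF sm_defect])
  fix X l
  have "E.NL 1 X l (Q X defect)" for l
    by (rule flat0_NL[OF E.sm_W[OF sm_defect] flat0_Q_defect])
  then show "E.NL 1 X l defect"
    by (cases l) (simp_all add: E.NL_0 E.NL_Suc pure_defect)
qed

section \<open>Taylor coefficients of gradient and potential along real lines\<close>

lemma dd_tr_mid_1:
  assumes "smooth_on U Y" "x \<in> U"
  shows "dd U X (\<lambda>x. tr X (Y x) x) x = tr X (dd U X Y x) x + tr X (Y x) X"
proof -
  have "dd U X (\<lambda>x. tr X (Y x) x) x = dd U X (\<lambda>z. tr X (Y x) z) x + tr X (dd U X Y x) x"
    by (rule dd_family[where \<Lambda> = "\<lambda>x y. tr X y x", OF open_U' assms(1) _ linear_T_mid assms(2)])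
      (intro sm_tr smooth_on_const open_U' sm_ident)
  moreover have "dd U X (\<lambda>z. tr X y z) x = tr X y X" for y
    using dd_bounded_linear[of "\<lambda>z. tr X y z" U "\<lambda>x. x" X] linear_T_right[of 0 X y] sm_ident assms(2)
    by (simp add: linear_conv_bounded_linear dd_ident)
  ultimately show ?thesis by simp
qed

lemma dd_tr_mid_2:
  assumes "smooth_on U Y" "x \<in> U"
  shows "dd U X (\<lambda>x. tr x (Y x) x) x = tr x (dd U X Y x) x + 2 *\<^sub>R tr X (Y x) x"
proof -
  have "dd U X (\<lambda>x. tr x (Y x) x) x = dd U X (\<lambda>z. tr z (Y x) z) x + tr x (dd U X Y x) x"
    by (rule dd_family[where \<Lambda> = "\<lambda>x y. tr x y x", OF open_U' assms(1) sm_tr_ident linear_T_mid assms(2)])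
  moreover have "dd U X (\<lambda>z. tr z y z) x = 2 *\<^sub>R tr X y x" for y
    using fun_cong[OF dd_bounded_bilinear[OF bb_tr sm_ident sm_ident, of X y], of x] assms(2)
    by (simp add: dd_ident T_sym[of 0 x y X] scaleR_2)
  ultimately show ?thesis by simp
qed

lemma ddn_tr_mid_0: "smooth_on U Y \<Longrightarrow> (dd U X ^^ n) (\<lambda>x. tr X (Y x) X) 0 = tr X ((dd U X ^^ n) Y 0) X"
  using ddn_bounded_linear[of "\<lambda>y. tr X y X" U Y n X] linear_T_mid[of 0 X X]
  by (simp add: linear_conv_bounded_linear)

lemma ddn_tr_mid_1:
  "smooth_on U Y \<Longrightarrow> (dd U X ^^ n) (\<lambda>x. tr X (Y x) x) 0 = real n *\<^sub>R tr X ((dd U X ^^ (n - 1)) Y 0) X"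
proof (induction n arbitrary: Y)
  case 0 then show ?case by (simp add: linear_0[OF linear_T_right])
next
  case (Suc n)
  have s: "smooth_on U (\<lambda>x. tr X (dd U X Y x) x)" "smooth_on U (\<lambda>x. tr X (Y x) X)"
    by (intro sm_tr_mid smooth_on_dd Suc.prems sm_ident smooth_on_const open_U')+
  have "(dd U X ^^ Suc n) (\<lambda>x. tr X (Y x) x) 0 = (dd U X ^^ n) (dd U X (\<lambda>x. tr X (Y x) x)) 0"
    unfolding funpow_Suc_right o_apply ..
  also have "\<dots> = (dd U X ^^ n) (\<lambda>x. tr X (dd U X Y x) x + tr X (Y x) X) 0"
    by (rule ddn_cong0[OF open_U' zero_U]) (rule dd_tr_mid_1[OF Suc.prems])
  also have "\<dots> = real n *\<^sub>R tr X ((dd U X ^^ (n - 1)) (dd U X Y) 0) X + tr X ((dd U X ^^ n) Y 0) X"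
    by (simp add: lin_op_add[OF lin_op_funpow[OF lin_op_dd] s] Suc.IH smooth_on_dd Suc.prems ddn_tr_mid_0)
  also have "\<dots> = real (Suc n) *\<^sub>R tr X ((dd U X ^^ n) Y 0) X"
  proof (cases n)
    case (Suc m)
    have "(dd U X ^^ m) (dd U X Y) = (dd U X ^^ Suc m) Y" unfolding funpow_Suc_right o_apply ..
    then have "(dd U X ^^ (n - 1)) (dd U X Y) = (dd U X ^^ n) Y" using Suc by simp
    then show ?thesis by (simp add: scaleR_left_distrib add.commute)
  qed simp
  finally show ?case by simp
qed

text \<open>At the origin both outer arguments must be differentiated exactly once, in one of
  \<open>n (n - 1)\<close> ways. For \<open>n < 2\<close> this factor is 0, which makes the
  truncated subtraction \<open>n - 2\<close> harmless.\<close>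

lemma ddn_tr_mid_2:
  "smooth_on U Y \<Longrightarrow> (dd U X ^^ n) (\<lambda>x. tr x (Y x) x) 0 = (real n * real (n - 1)) *\<^sub>R tr X ((dd U X ^^ (n - 2)) Y 0) X"
proof (induction n arbitrary: Y)
  case 0 then show ?case by (simp add: linear_0[OF linear_T_right])
next
  case (Suc n)
  have s: "smooth_on U (\<lambda>x. tr x (dd U X Y x) x)" "smooth_on U (\<lambda>x. tr X (Y x) x)"
    by (intro sm_tr_mid smooth_on_dd Suc.prems sm_ident smooth_on_const open_U')+
  have "(dd U X ^^ Suc n) (\<lambda>x. tr x (Y x) x) 0 = (dd U X ^^ n) (dd U X (\<lambda>x. tr x (Y x) x)) 0"
    unfolding funpow_Suc_right o_apply ..
  also have "\<dots> = (dd U X ^^ n) (\<lambda>x. tr x (dd U X Y x) x + 2 *\<^sub>R tr X (Y x) x) 0"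
    by (rule ddn_cong0[OF open_U' zero_U]) (rule dd_tr_mid_2[OF Suc.prems])
  also have "\<dots> = (real n * real (n - 1)) *\<^sub>R tr X ((dd U X ^^ (n - 2)) (dd U X Y) 0) X
      + (2 * real n) *\<^sub>R tr X ((dd U X ^^ (n - 1)) Y 0) X"
    by (simp add: lin_op_add[OF lin_op_funpow[OF lin_op_dd] s(1) smooth_on_cscaleR[OF s(2)]]
        lin_op_scaleR[OF lin_op_funpow[OF lin_op_dd] s(2)] Suc.IH smooth_on_dd Suc.prems ddn_tr_mid_1)
  also have "\<dots> = (real (Suc n) * real n) *\<^sub>R tr X ((dd U X ^^ (n - 1)) Y 0) X"
  proof (cases "n \<ge> 2")
    case True
    then have "Suc (n - 2) = n - 1" by simp
    then have "(dd U X ^^ (n - 2)) (dd U X Y) = (dd U X ^^ (n - 1)) Y"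
      by (metis funpow_Suc_right o_apply)
    then show ?thesis using True by (simp add: of_nat_diff algebra_simps flip: scaleR_left_distrib)
  next
    case False
    then have "n = 0 \<or> n = 1" by auto
    then show ?thesis by auto
  qed
  finally show ?case by (simp add: mult.commute)
qed

definition triple_op :: "'e \<Rightarrow> 'e \<Rightarrow> 'e" where
  "triple_op X y = - (1 / 2) *\<^sub>R tr X y X"

lemma ddn_ident_0: "(dd U X ^^ n) (\<lambda>x. x) 0 = (if n = 1 then X else 0)"
proof (cases n)
  case (Suc m)
  have "(dd U X ^^ Suc m) (\<lambda>x. x) 0 = (dd U X ^^ m) (dd U X (\<lambda>x. x)) 0"
    unfolding funpow_Suc_right o_apply ..
  also have "\<dots> = (dd U X ^^ m) (\<lambda>x. X) 0"
    by (rule ddn_cong0[OF open_U' zero_U]) (simp add: dd_ident)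
  also have "\<dots> = (if m = 0 then X else 0)"
  proof (cases m)
    case (Suc k)
    have "(dd U X ^^ k) (\<lambda>x. 0 :: 'e) = (\<lambda>x. 0)"
      by (rule lin_op_zero[OF lin_op_funpow[OF lin_op_dd] open_U'])
    then show ?thesis unfolding Suc funpow_Suc_right o_apply by simp
  qed simp
  finally show ?thesis using Suc by simp
qed simp

lemma ddn_Z_rec:
  "(dd U X ^^ n) Z 0 = (real n * real (n - 1)) *\<^sub>R triple_op X ((dd U X ^^ (n - 2)) Z 0) + (if n = 1 then X else 0)"
proof -
  have s: "smooth_on U (\<lambda>x. tr x (Z x) x)" by (intro sm_tr_mid sm_Z sm_ident)
  have "0 = (dd U X ^^ n) defect 0" using flat0_defect by (simp add: flat0_def)
  also have "\<dots> = (dd U X ^^ n) Z 0 + (1 / 2) *\<^sub>R (dd U X ^^ n) (\<lambda>x. tr x (Z x) x) 0 - (dd U X ^^ n) (\<lambda>x. x) 0"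
    unfolding defect_def[abs_def]
    by (simp add: lin_op_diff[OF lin_op_funpow[OF lin_op_dd]] lin_op_add[OF lin_op_funpow[OF lin_op_dd]]
        lin_op_scaleR[OF lin_op_funpow[OF lin_op_dd]] s sm_Z sm_ident smooth_on_add smooth_on_cscaleR)
  finally show ?thesis
    unfolding ddn_tr_mid_2[OF sm_Z] ddn_ident_0 triple_op_def by (simp add: algebra_simps)
qed

lemma linear_triple_op: "linear (triple_op X)"
  by (simp add: linear_iff triple_op_def linear_add[OF linear_T_mid] linear_cmul[OF linear_T_mid] algebra_simps)

text \<open>Raising the order by two applies \<open>triple_op X\<close> and multiplies by two
  consecutive integers; from the orders 0 and 1 this builds up the factorial.\<close>

lemma ddn_Z: "(dd U X ^^ (2 * k)) Z 0 = 0"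
  "(dd U X ^^ (2 * k + 1)) Z 0 = fact (2 * k + 1) *\<^sub>R (triple_op X ^^ k) X"
proof (induction k)
  case 0
  { case 1 show ?case by (simp add: Z_0) }
  { case 2 show ?case using ddn_Z_rec[of 1 X] by simp }
next
  case (Suc k)
  { case 1 show ?case using ddn_Z_rec[of "2 * Suc k" X] Suc(1) by (simp add: linear_0[OF linear_triple_op]) }
  { case 2
    have "(dd U X ^^ (2 * Suc k + 1)) Z 0 =
        (real (2 * Suc k + 1) * real (2 * Suc k)) *\<^sub>R triple_op X ((dd U X ^^ (2 * k + 1)) Z 0)"
      using ddn_Z_rec[of "2 * Suc k + 1" X] by (simp del: funpow.simps)
    also have "\<dots> = (real (2 * Suc k + 1) * real (2 * Suc k) * fact (2 * k + 1)) *\<^sub>R triple_op X ((triple_op X ^^ k) X)"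
      unfolding Suc(2) linear_cmul[OF linear_triple_op] by simp
    also have "real (2 * Suc k + 1) * real (2 * Suc k) * fact (2 * k + 1) = fact (2 * Suc k + 1)"
      by (simp add: fact_Suc algebra_simps)
    finally show ?case by simp }
qed

lemma ddn_f: "(dd U X ^^ Suc n) f 0 = 2 * B ((dd U X ^^ n) Z 0) X"
proof -
  have bl: "bounded_linear (\<lambda>y. 2 * B y X)"
    using linear_B_left[of X] by (simp add: linear_conv_bounded_linear[symmetric] linear_iff algebra_simps B_simps)
  have "dd U X f = (\<lambda>x. 2 * B (Z x) X)" by (simp add: B_Z)
  then have "(dd U X ^^ Suc n) f 0 = (dd U X ^^ n) (\<lambda>x. 2 * B (Z x) X) 0"
    unfolding funpow_Suc_right o_apply by simp
  then show ?thesis by (simp add: ddn_bounded_linear[OF bl sm_Z])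
qed

text \<open>\<open>jordan_identity\<close> speaks of three equal outer arguments. Testing against
  \<open>v\<close> and transporting arguments with \<open>B_tr_swap\<close> and
  \<open>B_tr_conj\<close> keeps both of its uses in that form.\<close>

lemma tr_commute: "tr X X (tr X y X) = tr X (tr X X y) X"
proof (rule B_eqI)
  fix v
  have "B (tr X X (tr X y X)) v = B (tr X y (tr X X X)) v" by (simp only: jordan_identity)
  also have "\<dots> = B (tr X v (tr X X X)) y" by (rule B_tr_swap)
  also have "\<dots> = B (tr X X (tr X v X)) y" by (simp only: jordan_identity)
  also have "\<dots> = B (tr X X y) (tr X v X)" by (rule B_tr_conj)
  also have "\<dots> = B (tr X v X) (tr X X y)" by (rule B_sym)
  also have "\<dots> = B (tr X (tr X X y) X) v" by (rule B_tr_swap)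
  finally show "B (tr X X (tr X y X)) v = B (tr X (tr X X y) X) v" .
qed

text \<open>The operator of the final formula contains, besides the conjugate linear
  \<open>triple_op X\<close>, the complex linear \<open>tr X X\<close>; the two can be compared on
  the iterates of \<open>X\<close>.\<close>

lemma Rm_0_ad: "(1 / 4) *\<^sub>R Rm 0 (J X) y (J X) = (1 / 2) *\<^sub>R triple_op X y - (1 / 4) *\<^sub>R tr X X y"
  by (simp add: Rm_eq_T[OF zero_U] T_J_left T_J_right T_J_mid triple_op_def T_sym[of 0 y X X] algebra_simps)

text \<open>At \<open>X\<close> the operator \<open>tr X X\<close> is \<open>- 2\<close> times
  \<open>triple_op X\<close> by definition, and by \<open>tr_commute\<close> this persists on all
  iterates. There the two terms of \<open>Rm_0_ad\<close> add up to
  \<open>triple_op X\<close>.\<close>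

lemma ad_power: "((\<lambda>y. (1 / 4) *\<^sub>R Rm 0 (J X) y (J X)) ^^ k) X = (triple_op X ^^ k) X"
proof -
  have D: "tr X X ((triple_op X ^^ k) X) = - 2 *\<^sub>R triple_op X ((triple_op X ^^ k) X)" for k
  proof (induction k)
    case 0 then show ?case by (simp add: triple_op_def)
  next
    case (Suc k)
    have "tr X X (triple_op X y) = triple_op X (tr X X y)" for y
      by (simp add: triple_op_def linear_neg[OF linear_T_right] linear_cmul[OF linear_T_right] tr_commute)
    then have "tr X X ((triple_op X ^^ Suc k) X) = triple_op X (- 2 *\<^sub>R triple_op X ((triple_op X ^^ k) X))"
      using Suc by simp
    then show ?case by (simp add: linear_cmul[OF linear_triple_op] linear_neg[OF linear_triple_op])
  qed
  show ?thesis
  proof (induction k)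
    case (Suc k)
    then show ?case by (simp add: Rm_0_ad D scaleR_left_distrib[symmetric])
  qed simp
qed

lemma f_0: "f 0 = 0"
  using jets[of 0 0] by simp

text \<open>The derivative of \<open>f\<close> along \<open>X\<close> is \<open>2 B(Z, X)\<close>,
  and \<open>2 (2k+1)! / (2k+2)! = 1 / (k+1)\<close>. Odd orders of \<open>f\<close> come from even
  orders of \<open>Z\<close>, which vanish.\<close>

lemma taylor_f:
  "(dd U X ^^ m) f 0 / fact m =
    (\<Sum>k | 2 * k + 2 = m. B X ((1 / real (k + 1)) *\<^sub>R ((\<lambda>y. (1 / 4) *\<^sub>R Rm 0 (J X) y (J X)) ^^ k) X))"
proof (cases "\<exists>k. m = 2 * k + 2")
  case True
  then obtain k where m: "m = 2 * k + 2" by blast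
  then have "{k. 2 * k + 2 = m} = {k}" by auto
  moreover have "(dd U X ^^ m) f 0 / fact m = B X ((1 / real (k + 1)) *\<^sub>R (triple_op X ^^ k) X)"
  proof -
    define F :: real where "F = fact (2 * k + 1)"
    have F: "F \<noteq> 0" by (simp add: F_def del: fact_Suc)
    have "(dd U X ^^ m) f 0 = 2 * F * B X ((triple_op X ^^ k) X)"
      unfolding F_def using ddn_f[of "2 * k + 1" X] ddn_Z(2)[of k X] by (simp add: m B_simps B_sym[of X])
    moreover have "(fact m :: real) = (2 * F) * (real k + 1)"
      unfolding F_def by (simp add: m fact_Suc algebra_simps)
    ultimately have "(dd U X ^^ m) f 0 / fact m = B X ((triple_op X ^^ k) X) / (real k + 1)"
      using F by (simp only: mult_divide_mult_cancel_left)
    then show ?thesis by (simp add: B_simps add.commute)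
  qed
  ultimately show ?thesis by (simp add: ad_power)
next
  case False
  then have "{k. 2 * k + 2 = m} = {}" by auto
  moreover have "(dd U X ^^ m) f 0 = 0"
  proof (cases m)
    case 0 then show ?thesis by (simp add: f_0)
  next
    case (Suc n)
    have "even n"
    proof (rule ccontr)
      assume "odd n"
      then obtain k where "n = 2 * k + 1" by (rule oddE)
      with Suc have "m = 2 * k + 2" by simp
      with False show False by blast
    qed
    then obtain k where "n = 2 * k" by (rule evenE)
    then show ?thesis using ddn_f[of n X] ddn_Z(1)[of k X] Suc by (simp add: B_simps)
  qed
  ultimately show ?thesis by simp
qed

end

section \<open>Bidegrees of Taylor polynomials\<close>

lemma infinite_squared_unit_circle: "infinite (range (\<lambda>s. cis s ^ 2))"
proof -
  have "inj_on (\<lambda>s. cis s ^ 2) {0<..<pi/2}"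
  proof (rule inj_onI)
    fix s t :: real assume st: "s \<in> {0<..<pi/2}" "t \<in> {0<..<pi/2}" "cis s ^ 2 = cis t ^ 2"
    have "cis (2 * u) = cis u ^ 2" for u using Complex.DeMoivre[of u 2] by simp
    then have "cis (2 * s) = cis (2 * t)" using st(3) by simp
    then have "cos (2 * s) = cos (2 * t)" by (metis cis.simps(1))
    then have "2 * s = 2 * t" using cos_inj_pi[of "2 * s" "2 * t"] st(1,2) by auto
    then show "s = t" by simp
  qed
  then have "infinite ((\<lambda>s. cis s ^ 2) ` {0<..<pi/2})"
    using finite_imageD by (metis infinite_Ioo pi_half_gt_zero)
  then show ?thesis by (meson finite_subset image_mono subset_UNIV)
qed

text \<open>A nonzero polynomial cannot vanish at the infinitely many values of
  \<open>cis s ^ 2\<close>.\<close>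

lemma trig_polynomial_eq_0:
  fixes d :: "nat \<Rightarrow> complex"
  assumes "\<And>s. (\<Sum>k\<le>m. d k * cis s ^ (2 * k)) = 0" "k \<le> m"
  shows "d k = 0"
proof (rule ccontr)
  assume "d k \<noteq> 0"
  then have "finite {z. (\<Sum>i\<le>m. d i * z ^ i) = 0}"
    using polyfun_finite_roots[of d m] assms(2) by blast
  moreover have "range (\<lambda>s. cis s ^ 2) \<subseteq> {z. (\<Sum>i\<le>m. d i * z ^ i) = 0}"
    using assms(1) by (auto simp: power_mult[symmetric])
  ultimately show False using infinite_squared_unit_circle finite_subset by blast
qed

text \<open>At each point of the orbit the weight condition is the equation
  \<open>u' = \<i> c u\<close> for the restriction \<open>u\<close> of \<open>\<beta>\<close> to the
  orbit; multiplication by the inverse exponential makes it constant.\<close>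

lemma rotation_weight:
  fixes \<beta> :: "'e::euclidean_space \<Rightarrow> complex"
  assumes J: "linear J" "\<And>v. J (J v) = - v" and poly: "polynomial_function \<beta>"
    and weight: "\<And>X. ((\<lambda>t. \<beta> (X + t *\<^sub>R J X)) has_vector_derivative \<i> * c * \<beta> X) (at 0)"
  shows "\<beta> (cos s *\<^sub>R X + sin s *\<^sub>R J X) = exp (\<i> * c * of_real s) * \<beta> X"
proof -
  define r where "r s = cos s *\<^sub>R X + sin s *\<^sub>R J X" for s
  have Jr: "J (r s) = - sin s *\<^sub>R X + cos s *\<^sub>R J X" for s
    by (simp add: r_def linear_add[OF J(1)] linear_cmul[OF J(1)] J(2))
  have dr: "(r has_vector_derivative J (r s)) (at s)" for s
  proof -
    have "((\<lambda>s. cos s *\<^sub>R X + sin s *\<^sub>R J X) has_vector_derivative - sin s *\<^sub>R X + cos s *\<^sub>R J X) (at s)"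
      by (auto intro!: derivative_eq_intros)
    then show ?thesis unfolding Jr by (simp add: r_def[abs_def])
  qed
  have D: "((\<lambda>t. \<beta> (r t)) has_vector_derivative \<i> * c * \<beta> (r s)) (at s)" for s
  proof -
    obtain D where D: "(\<beta> has_derivative D) (at (r s))"
      using differentiable_at_polynomial_function[OF poly] by (auto simp: differentiable_def)
    have "((\<lambda>t. r s + t *\<^sub>R J (r s)) has_vector_derivative J (r s)) (at 0)"
      by (auto intro!: derivative_eq_intros)
    then have "((\<lambda>t. \<beta> (r s + t *\<^sub>R J (r s))) has_vector_derivative D (J (r s))) (at 0)"
      using vector_derivative_diff_chain_within[of "\<lambda>t. r s + t *\<^sub>R J (r s)" "J (r s)" 0 UNIV \<beta> D]
        has_derivative_at_withinI[OF D] by (simp add: o_def)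
    then have "D (J (r s)) = \<i> * c * \<beta> (r s)"
      using weight[of "r s"] vector_derivative_unique_at by blast
    then show ?thesis
      using vector_derivative_diff_chain_within[of r "J (r s)" s UNIV \<beta> D] dr[of s]
        has_derivative_at_withinI[OF D] by (simp add: o_def)
  qed
  have E: "((\<lambda>s. exp (- (\<i> * c * of_real s))) has_vector_derivative - (\<i> * c) * exp (- (\<i> * c * of_real s))) (at s)" for s
  proof -
    have "((\<lambda>z. exp (- (\<i> * c * z))) has_field_derivative - (\<i> * c) * exp (- (\<i> * c * of_real s))) (at (of_real s))"
      by (auto intro!: derivative_eq_intros)
    then show ?thesis using has_vector_derivative_real_field by blast
  qed
  have "((\<lambda>s. exp (- (\<i> * c * of_real s)) * \<beta> (r s)) has_vector_derivative 0) (at s)" for s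
    using has_vector_derivative_mult[OF E D, of s] by (simp add: algebra_simps)
  then obtain C where C: "\<And>s. exp (- (\<i> * c * of_real s)) * \<beta> (r s) = C"
    using has_vector_derivative_zero_constant[of UNIV "\<lambda>s. exp (- (\<i> * c * of_real s)) * \<beta> (r s)"] by auto
  have "exp (- (\<i> * c * of_real s)) * \<beta> (r s) = \<beta> X"
    using C[of s] C[of 0] by (simp add: r_def)
  then have "exp (\<i> * c * of_real s) * (exp (- (\<i> * c * of_real s)) * \<beta> (r s)) = exp (\<i> * c * of_real s) * \<beta> X"
    by simp
  then show ?thesis by (simp add: r_def mult.assoc[symmetric] exp_add[symmetric])
qed

text \<open>The factor \<open>cis s ^ m\<close> shifts the Fourier mode \<open>k - l\<close> to
  \<open>2 k\<close>, so that ordinary polynomials in \<open>cis s ^ 2\<close> suffice.\<close>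

lemma weight_monomial: 
  assumes "k + l = m"
  shows "cis s ^ m * exp (\<i> * (of_nat k - of_nat l) * of_real s) = cis s ^ (2 * k)"
proof -
  have "exp (\<i> * (of_nat k - of_nat l) * of_real s) = cis ((real k - real l) * s)"
    by (simp add: cis_conv_exp algebra_simps)
  then have "cis s ^ m * exp (\<i> * (of_nat k - of_nat l) * of_real s) = cis (real m * s + (real k - real l) * s)"
    unfolding Complex.DeMoivre[of s m] cis_mult[symmetric] by simp
  also have "real m * s + (real k - real l) * s = real (2 * k) * s"
    using assms by (auto simp: algebra_simps)
  finally show ?thesis by (simp add: Complex.DeMoivre)
qed

text \<open>
  Along \<open>s \<mapsto> cos s X + sin s J X\<close> both sides of the assumed identity are trigonometric polynomials in
  \<open>s\<close>; comparing their Fourier coefficients separates the bidegrees.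
\<close>

lemma jets_of_weights:
  fixes U :: "'e::euclidean_space set" and f :: "'e \<Rightarrow> real"
  assumes U: "open U" "0 \<in> U" and J: "linear J" "\<And>v. J (J v) = - v"
    and f: "smooth_on U f"
    and B: "\<And>a b. B (J a) (J b) = B a b" "bilinear B" "\<And>a b. B a b = B b a"
    and \<beta>: "\<And>m. \<exists>\<beta>. (\<forall>k l. polynomial_function (\<beta> k l) \<and>
        (\<forall>X. ((\<lambda>t. \<beta> k l (X + t *\<^sub>R J X)) has_vector_derivative \<i> * (of_nat k - of_nat l) * \<beta> k l X) (at 0))) \<and>
        (\<forall>X. complex_of_real ((dd U X ^^ m) f 0 / fact m - (if m = 2 then B X X else 0)) =
          (\<Sum>(k, l) | k + l = m \<and> 2 \<le> k \<and> 2 \<le> l. \<beta> k l X))"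
    and kl: "k < 2 \<or> l < 2" "(k, l) \<noteq> (1, 1)"
  shows "(wd U J ((*) \<i>) 1 X ^^ k) ((wd U J ((*) \<i>) (- 1) X ^^ l) (\<lambda>x. complex_of_real (f x))) 0 = 0"
proof -
  interpret C: wirtinger U J "(*) \<i>"
    by (rule wirtinger.intro[OF U(1) J bounded_linear.linear[OF bounded_linear_mult_right]])
      (simp add: mult.assoc[symmetric])
  let ?P = "wd U J ((*) \<i>) 1 X" and ?Q = "wd U J ((*) \<i>) (- 1) X"
  let ?f = "\<lambda>x. complex_of_real (f x)"
  define r where "r s = cos s *\<^sub>R X + sin s *\<^sub>R J X" for s
  define m where "m = k + l"
  obtain \<beta> where poly: "\<And>k l. polynomial_function (\<beta> k l)" and
    weight: "\<And>k l X. ((\<lambda>t. \<beta> k l (X + t *\<^sub>R J X)) has_vector_derivative \<i> * (of_nat k - of_nat l) * \<beta> k l X) (at 0)" and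
    sum: "\<And>X. complex_of_real ((dd U X ^^ m) f 0 / fact m - (if m = 2 then B X X else 0)) =
          (\<Sum>(k, l) | k + l = m \<and> 2 \<le> k \<and> 2 \<le> l. \<beta> k l X)"
    using \<beta>[of m] by blast
  have fc: "smooth_on U ?f" by (rule smooth_on_bounded_linear[OF bounded_linear_of_real f])
  \<comment> \<open>The quadratic form is invariant under rotation, as befits bidegree (1,
    1).\<close>
  have Br: "B (r s) (r s) = B X X" for s
  proof -
    have "B (J X) X = 0" using B(1)[of X "J X"] B(3)[of X "J X"] J(2) by (simp add: bilinear_rneg[OF B(2)])
    moreover have "(cos s)\<^sup>2 * b + (sin s)\<^sup>2 * b = b" for b :: real
      by (metis distrib_right mult_1 sin_cos_squared_add2)
    ultimately show ?thesis
      by (simp add: r_def bilinear_ladd[OF B(2)] bilinear_radd[OF B(2)] bilinear_lmul[OF B(2)]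
          bilinear_rmul[OF B(2)] B(1) B(3)[of X "J X"] power2_eq_square mult.assoc[symmetric])
  qed
  define c where "c j = of_nat (m choose j) * (?P ^^ j) ((?Q ^^ (m - j)) ?f) 0" for j
  \<comment> \<open>The Fourier coefficient of the difference of both sides in degree
    \<open>m\<close>, multiplied by \<open>fact m\<close>. For \<open>m = 2\<close> that factor is
    2, whence \<open>2 * B X X\<close>.\<close>
  define d where "d j = c j - (if 2 \<le> j \<and> 2 \<le> m - j then fact m * \<beta> j (m - j) X else 0)
      - (if m = 2 \<and> j = 1 then complex_of_real (2 * B X X) else 0)" for j
  have opl: "smooth_on U F \<Longrightarrow> wd U J ((*) \<i>) t X (\<lambda>x. a * F x) = (\<lambda>x. a * wd U J ((*) \<i>) t X F x)" for F a t
    by (rule C.W_linear[OF bounded_linear.linear[OF bounded_linear_mult_right]]) (simp_all add: mult.left_commute)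
  have lop: "lin_op U (\<lambda>F x. a * wd U J ((*) \<i>) t X F x)" for a t
    by (rule lin_opI) (auto simp: C.W_add lin_op_scaleR[OF C.lin_op_W] distrib_left
        intro!: smooth_on_bounded_linear[OF bounded_linear_mult_right] C.sm_W)
  have opn: "((\<lambda>F x. a * wd U J ((*) \<i>) t X F x) ^^ n) F = (\<lambda>x. a ^ n * (wd U J ((*) \<i>) t X ^^ n) F x)"
    if "smooth_on U F" for F a t n
  proof (induction n)
    case (Suc n) then show ?case by (simp add: opl C.sm_Wn that mult.assoc)
  qed simp
  \<comment> \<open>Rotating the direction multiplies the (1,0)-derivative by \<open>cis s\<close>
    and the (0,1)-derivative by its conjugate.\<close>
  have rot: "dd U (r s) F = (\<lambda>x. cis s * ?P F x + cis (- s) * ?Q F x)" if "smooth_on U F" for F :: "'e \<Rightarrow> complex" and s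
    by (simp add: r_def dd_vec_add dd_vec_scaleR that wd_def fun_eq_iff complex_eq_iff scaleR_conv_of_real)
      (simp add: field_simps)
  have ddn: "(dd U (r s) ^^ m) ?f 0 = (\<Sum>j\<le>m. cis s ^ j * cis (- s) ^ (m - j) * c j)" for s
  proof -
    let ?A = "\<lambda>F x. cis s * ?P F x" and ?B = "\<lambda>F x. cis (- s) * ?Q F x"
    have "smooth_on U ((dd U (r s) ^^ n) ?f) \<and> (dd U (r s) ^^ n) ?f = ((\<lambda>F x. ?A F x + ?B F x) ^^ n) ?f" for n
    proof (induction n)
      case (Suc n)
      have 1: "smooth_on U ((dd U (r s) ^^ n) ?f)" and 2: "(dd U (r s) ^^ n) ?f = ((\<lambda>F x. ?A F x + ?B F x) ^^ n) ?f"
        using Suc by blast+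
      show ?case
      proof
        show "smooth_on U ((dd U (r s) ^^ Suc n) ?f)" using smooth_on_dd[OF 1] by simp
        show "(dd U (r s) ^^ Suc n) ?f = ((\<lambda>F x. ?A F x + ?B F x) ^^ Suc n) ?f"
          unfolding funpow.simps o_apply 2[symmetric] by (rule rot[OF 1])
      qed
    qed (simp add: fc)
    then have "(dd U (r s) ^^ m) ?f = ((\<lambda>F x. ?A F x + ?B F x) ^^ m) ?f" by blast
    also have "\<dots> = (\<lambda>x. \<Sum>j\<le>m. real (m choose j) *\<^sub>R (?A ^^ j) ((?B ^^ (m - j)) ?f) x)"
    proof (rule lin_op_binomial[OF lop lop U(1) fc])
      fix F :: "'e \<Rightarrow> complex" assume F: "smooth_on U F"
      show "?A (?B F) = ?B (?A F)"
        by (simp add: opl C.sm_W F C.W_commute[OF F, of 1 X "-1" X] mult.left_commute)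
    qed
    finally have e1: "(dd U (r s) ^^ m) ?f = (\<lambda>x. \<Sum>j\<le>m. real (m choose j) *\<^sub>R (?A ^^ j) ((?B ^^ (m - j)) ?f) x)" .
    have e2: "(?A ^^ j) ((?B ^^ (m - j)) ?f) = (\<lambda>x. cis s ^ j * cis (- s) ^ (m - j) * (?P ^^ j) ((?Q ^^ (m - j)) ?f) x)" for j
    proof -
      have s1: "smooth_on U ((?Q ^^ (m - j)) ?f)" by (rule C.sm_Wn[OF fc])
      have "(?P ^^ j) (\<lambda>x. a * F x) = (\<lambda>x. a * (?P ^^ j) F x)" if "smooth_on U F" for a F
        by (rule C.Wn_linear[OF bounded_linear.linear[OF bounded_linear_mult_right] _ that]) (simp add: mult.left_commute)
      then show ?thesis
        using s1 by (simp add: opn fc smooth_on_bounded_linear[OF bounded_linear_mult_right] mult.assoc)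
    qed
    show ?thesis
      unfolding e1 e2 c_def by (simp only: scaleR_conv_of_real mult.left_commute of_real_of_nat_eq)
  qed
  have ddf: "(dd U Y ^^ m) ?f 0 = complex_of_real ((dd U Y ^^ m) f 0)" for Y
    using fun_cong[OF ddn_bounded_linear[OF bounded_linear_of_real f, where X = Y and n = m], of 0] .
  have "(\<Sum>j\<le>m. d j * cis s ^ (2 * j)) = 0" for s
  proof -
    have 1: "(\<Sum>j\<le>m. cis s ^ m * (cis s ^ j * cis (- s) ^ (m - j) * c j)) = (\<Sum>j\<le>m. c j * cis s ^ (2 * j))"
    proof (rule sum.cong[OF refl])
      fix j assume "j \<in> {..m}"
      then have "real m * s + (real j * s + real (m - j) * (- s)) = real (2 * j) * s"
        by (simp add: of_nat_diff algebra_simps)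
      then have "cis s ^ m * (cis s ^ j * cis (- s) ^ (m - j)) = cis s ^ (2 * j)"
        unfolding Complex.DeMoivre[of s] Complex.DeMoivre[of "- s"] cis_mult by (simp only:)
      moreover have "cis s ^ m * (cis s ^ j * cis (- s) ^ (m - j) * c j) =
          cis s ^ m * (cis s ^ j * cis (- s) ^ (m - j)) * c j"
        by (simp only: mult.assoc)
      ultimately show "cis s ^ m * (cis s ^ j * cis (- s) ^ (m - j) * c j) = c j * cis s ^ (2 * j)"
        by (simp only: mult.commute)
    qed
    have "(\<Sum>(k, l) | k + l = m \<and> 2 \<le> k \<and> 2 \<le> l. cis s ^ m * \<beta> k l (r s)) =
        (\<Sum>(k, l) | k + l = m \<and> 2 \<le> k \<and> 2 \<le> l. cis s ^ (2 * k) * \<beta> k l X)"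
    proof (rule sum.cong[OF refl], clarify)
      fix k l assume "m = k + l"
      show "cis s ^ (k + l) * \<beta> k l (r s) = cis s ^ (2 * k) * \<beta> k l X"
        unfolding r_def rotation_weight[OF J poly weight]
        by (simp only: mult.assoc[symmetric] weight_monomial[OF refl])
    qed
    also have "\<dots> = (\<Sum>j | j \<le> m \<and> 2 \<le> j \<and> 2 \<le> m - j. cis s ^ (2 * j) * \<beta> j (m - j) X)"
      by (rule sum.reindex_bij_witness[where i = "\<lambda>j. (j, m - j)" and j = fst]) auto
    also have "\<dots> = (\<Sum>j\<le>m. (if 2 \<le> j \<and> 2 \<le> m - j then \<beta> j (m - j) X else 0) * cis s ^ (2 * j))"
    proof -
      have "(\<Sum>j\<in>{j \<in> {..m}. 2 \<le> j \<and> 2 \<le> m - j}. cis s ^ (2 * j) * \<beta> j (m - j) X) =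
          (\<Sum>j\<le>m. if 2 \<le> j \<and> 2 \<le> m - j then cis s ^ (2 * j) * \<beta> j (m - j) X else 0)"
        by (rule sum.inter_filter) simp
      moreover have "(\<Sum>j\<le>m. if 2 \<le> j \<and> 2 \<le> m - j then cis s ^ (2 * j) * \<beta> j (m - j) X else 0) =
          (\<Sum>j\<le>m. (if 2 \<le> j \<and> 2 \<le> m - j then \<beta> j (m - j) X else 0) * cis s ^ (2 * j))"
        by (rule sum.cong) auto
      ultimately show ?thesis by simp
    qed
    finally have 2: "cis s ^ m * (\<Sum>(k, l) | k + l = m \<and> 2 \<le> k \<and> 2 \<le> l. \<beta> k l (r s)) =
       (\<Sum>j\<le>m. (if 2 \<le> j \<and> 2 \<le> m - j then \<beta> j (m - j) X else 0) * cis s ^ (2 * j))"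
      by (simp add: sum_distrib_left case_prod_unfold)
    have e: "fact m * ((if Q then b else 0) * z) = (if Q then fact m * b else 0) * z" for Q and b z :: complex
      by simp
    have 3: "cis s ^ m * (if m = 2 then 2 * B X X else 0) = (\<Sum>j\<le>m. (if m = 2 \<and> j = 1 then complex_of_real (2 * B X X) else 0) * cis s ^ (2 * j))"
      by (simp add: if_distrib[where f = "\<lambda>z. z * _"] cong: if_cong)
    have "complex_of_real ((dd U (r s) ^^ m) f 0) = fact m * (\<Sum>(k, l) | k + l = m \<and> 2 \<le> k \<and> 2 \<le> l. \<beta> k l (r s))
        + (if m = 2 then 2 * B X X else 0)"
    proof -
      have "complex_of_real ((dd U (r s) ^^ m) f 0) = fact m * (\<Sum>(k, l) | k + l = m \<and> 2 \<le> k \<and> 2 \<le> l. \<beta> k l (r s))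
        + fact m * complex_of_real (if m = 2 then B (r s) (r s) else 0)"
        using sum[of "r s", symmetric] by (simp add: field_simps)
      then show ?thesis by (cases "m = 2") (simp_all add: Br)
    qed
    then have "cis s ^ m * (\<Sum>j\<le>m. cis s ^ j * cis (- s) ^ (m - j) * c j) =
       fact m * (\<Sum>j\<le>m. (if 2 \<le> j \<and> 2 \<le> m - j then \<beta> j (m - j) X else 0) * cis s ^ (2 * j))
       + (\<Sum>j\<le>m. (if m = 2 \<and> j = 1 then complex_of_real (2 * B X X) else 0) * cis s ^ (2 * j))"
      unfolding ddf[symmetric] ddn 2[symmetric] 3[symmetric] by (simp only: distrib_left mult.left_commute)
    then have "(\<Sum>j\<le>m. c j * cis s ^ (2 * j)) = (\<Sum>j\<le>m. (if 2 \<le> j \<and> 2 \<le> m - j then fact m * \<beta> j (m - j) X else 0) * cis s ^ (2 * j))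
       + (\<Sum>j\<le>m. (if m = 2 \<and> j = 1 then complex_of_real (2 * B X X) else 0) * cis s ^ (2 * j))"
      unfolding sum_distrib_left 1 e .
    then show ?thesis
      by (simp add: d_def left_diff_distrib sum_subtractf)
  qed
  from trig_polynomial_eq_0[OF this, of k] have "d k = 0" by (simp add: m_def)
  moreover have "m - k = l" "\<not> (2 \<le> k \<and> 2 \<le> m - k)" "\<not> (m = 2 \<and> k = 1)"
    using kl by (auto simp: m_def)
  ultimately have "c k = 0" unfolding d_def by (simp only: if_False diff_zero)
  then show ?thesis using \<open>m - k = l\<close> by (simp add: c_def m_def)
qed

section \<open>Vector fields and connections in a chart\<close>

lemma chart_inv_left: "is_chart c \<Longrightarrow> q \<in> fst c \<Longrightarrow> chart_inv c (snd c q) = q"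
  by (simp add: is_chart_def homeomorphism_def)

lemma chart_inv_right: "is_chart c \<Longrightarrow> y \<in> snd c ` fst c \<Longrightarrow> snd c (chart_inv c y) = y"
  by (auto simp: is_chart_def homeomorphism_def)

lemma chart_inv_mem: "is_chart c \<Longrightarrow> y \<in> snd c ` fst c \<Longrightarrow> chart_inv c y \<in> fst c"
  by (auto simp: is_chart_def homeomorphism_def)

lemma chart_open_image:
  assumes "is_chart c" "open T" "T \<subseteq> snd c ` fst c"
  shows "open (chart_inv c ` T)"
proof -
  have "chart_inv c ` T = snd c -` T \<inter> fst c"
    using assms chart_inv_left[OF assms(1)] chart_inv_right[OF assms(1)] chart_inv_mem[OF assms(1)]
    by (force simp: image_iff)
  moreover have "open (snd c -` T \<inter> fst c)"
    using assms(1,2) continuous_on_open_vimage[of "fst c" "snd c"] by (auto simp: is_chart_def homeomorphism_def)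
  ultimately show ?thesis by simp
qed

text \<open>\<open>h\<close> is prescribed only while the line stays in \<open>U\<close>. Iterated
  derivatives are local, so agreement on an open set of parameters is enough.\<close>

lemma deriv_funpow_line:
  fixes F :: "'a::real_normed_vector \<Rightarrow> real"
  assumes F: "smooth_on U F" and h: "\<And>t. t *\<^sub>R X \<in> U \<Longrightarrow> h t = F (t *\<^sub>R X)" and t: "t *\<^sub>R X \<in> U"
  shows "(deriv ^^ m) h t = (dd U X ^^ m) F (t *\<^sub>R X)"
  using t
proof (induction m arbitrary: t)
  case (Suc m)
  let ?F = "(dd U X ^^ m) F"
  have sF: "smooth_on U ?F" by (rule lin_op_smooth[OF lin_op_funpow[OF lin_op_dd] F])
  have 1: "(?F has_derivative frechet_derivative ?F (at (t *\<^sub>R X))) (at (t *\<^sub>R X))"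
    by (rule smooth_on_has_derivative[OF sF Suc.prems])
  have 2: "((\<lambda>t. t *\<^sub>R X) has_derivative (\<lambda>t. t *\<^sub>R X)) (at t)"
    by (rule bounded_linear_imp_has_derivative[OF bounded_linear_scaleR_left])
  have "((\<lambda>t. ?F (t *\<^sub>R X)) has_derivative (\<lambda>s. frechet_derivative ?F (at (t *\<^sub>R X)) (s *\<^sub>R X))) (at t)"
    by (rule has_derivative_compose[OF 2 1])
  moreover have "frechet_derivative ?F (at (t *\<^sub>R X)) (s *\<^sub>R X) = s * dd U X ?F (t *\<^sub>R X)" for s
    using linear_cmul[OF linear_dd[OF sF, of "t *\<^sub>R X"], of s X] by (simp add: dd_eq[OF Suc.prems])
  ultimately have d: "((\<lambda>t. ?F (t *\<^sub>R X)) has_field_derivative dd U X ?F (t *\<^sub>R X)) (at t)"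
    by (simp add: has_field_derivative_def mult.commute[of _ "dd U X ?F (t *\<^sub>R X)"])
  have "open ((\<lambda>t. t *\<^sub>R X) -` U)"
    by (intro open_vimage smooth_on_open[OF F] continuous_intros)
  then have "((deriv ^^ m) h has_field_derivative dd U X ?F (t *\<^sub>R X)) (at t)"
    by (rule has_field_derivative_transform_within_open[OF d]) (use Suc in auto)
  then show ?case by (simp add: DERIV_imp_deriv)
qed (simp add: h)

section \<open>Tangent vectors in an additional chart\<close>

text \<open>\<open>c0\<close> is compatible with the atlas but need not belong to it. Normal
  coordinates provide such a chart, so everything defined through \<open>A\<close> has to be
  transported by the transition maps \<open>out\<close> and \<open>back\<close>.\<close>

locale coordinate_chart = smooth_manifold A
  for A :: "('m::{t2_space,second_countable_topology}, 'e::euclidean_space) chart set" +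
  fixes c0 :: "('m, 'e) chart"
  assumes is_chart_c0: "is_chart c0" and compatible_c0: "c \<in> A \<Longrightarrow> compatible c0 c"
    and c0_points: "fst c0 \<subseteq> points A"
begin

abbreviation "N \<equiv> fst c0"
abbreviation "\<kappa> \<equiv> snd c0"
definition "S = \<kappa> ` N"
abbreviation "\<psi> \<equiv> chart_inv c0"
definition "out c = (\<lambda>x. snd c (\<psi> x))"
definition "back c = (\<lambda>y. \<kappa> (chart_inv c y))"
definition "dom_in c = \<kappa> ` (N \<inter> fst c)"
definition "dom_out c = snd c ` (N \<inter> fst c)"

lemmas \<psi>_\<kappa> = chart_inv_left[OF is_chart_c0]
lemmas \<kappa>_\<psi> = chart_inv_right[OF is_chart_c0, folded S_def]
lemmas \<psi>_mem = chart_inv_mem[OF is_chart_c0, folded S_def]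

lemma \<kappa>_mem: "q \<in> N \<Longrightarrow> \<kappa> q \<in> S"
  by (simp add: S_def)

lemma open_S: "open S"
  using is_chart_c0 by (simp_all add: is_chart_def S_def)

lemma dom_in_iff: "x \<in> dom_in c \<longleftrightarrow> x \<in> S \<and> \<psi> x \<in> fst c"
  using chart_inv_left[OF is_chart_c0] chart_inv_mem[OF is_chart_c0] chart_inv_right[OF is_chart_c0] unfolding dom_in_def S_def by (auto simp: image_iff) 

lemma dom_in_charts_at: "c \<in> charts_at A (\<psi> x) \<Longrightarrow> x \<in> S \<Longrightarrow> x \<in> dom_in c"
  by (simp add: dom_in_iff charts_at_def)

lemma smooth_out: "c \<in> A \<Longrightarrow> smooth_on (dom_in c) (out c)"
  using compatible_c0 by (simp add: compatible_def out_def[abs_def] dom_in_def o_def)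

lemma smooth_back: "c \<in> A \<Longrightarrow> smooth_on (dom_out c) (back c)"
  using compatible_c0 by (simp add: compatible_def back_def[abs_def] dom_out_def o_def)

lemma out_mem: "x \<in> dom_in c \<Longrightarrow> out c x \<in> dom_out c"
  using \<psi>_mem by (simp add: out_def dom_in_iff dom_out_def)

lemma back_out:
  assumes c: "c \<in> A" and x: "x \<in> dom_in c"
  shows "back c (out c x) = x"
  using chart_inv_left[OF is_chart[OF c]] \<kappa>_\<psi> x by (simp add: out_def back_def dom_in_iff)

lemma
  assumes c: "c \<in> A" and y: "y \<in> dom_out c"
  shows \<psi>_back: "\<psi> (back c y) = chart_inv c y"
    and back_mem: "back c y \<in> dom_in c"
    and out_back: "out c (back c y) = y"
proof -
  obtain q where q: "q \<in> N" "q \<in> fst c" "y = snd c q" using y by (auto simp: dom_out_def)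
  have e: "chart_inv c y = q" unfolding q(3) by (rule chart_inv_left[OF is_chart[OF c] q(2)])
  show "\<psi> (back c y) = chart_inv c y" "back c y \<in> dom_in c" "out c (back c y) = y"
    using q(1,2) \<psi>_\<kappa> \<kappa>_mem by (simp_all add: back_def out_def e q(3)[symmetric] dom_in_iff)
qed

lemma charts_at_nonempty: "x \<in> S \<Longrightarrow> \<exists>c. c \<in> charts_at A (\<psi> x)"
  using \<psi>_mem[of x] c0_points by (force simp: points_def charts_at_def)

lemma charts_at_A: "c \<in> charts_at A q \<Longrightarrow> c \<in> A"
  by (simp add: charts_at_def)

lemma D_back_out:
  assumes "c \<in> A" "x \<in> dom_in c"
  shows "frechet_derivative (back c) (at (out c x)) (frechet_derivative (out c) (at x) v) = v"
proof -
  have "frechet_derivative (\<lambda>x. back c (out c x)) (at x) = frechet_derivative (\<lambda>x. x) (at x)"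
    by (rule frechet_derivative_cong_open[OF smooth_on_open[OF smooth_out[OF assms(1)]] assms(2)])
      (rule back_out[OF assms(1)])
  moreover have "frechet_derivative (\<lambda>x. back c (out c x)) (at x) =
      (\<lambda>v. frechet_derivative (back c) (at (out c x)) (frechet_derivative (out c) (at x) v))"
    by (rule frechet_derivative_chain)
      (use smooth_on_differentiable[OF smooth_out[OF assms(1)] assms(2)]
        smooth_on_differentiable[OF smooth_back[OF assms(1)] out_mem[OF assms(2)]] in auto)
  ultimately show ?thesis by (simp add: fun_eq_iff)
qed

lemma transition_differentiable:
  assumes "c \<in> A" "c' \<in> A" "q \<in> fst c" "q \<in> fst c'"
  shows "(\<lambda>y. snd c' (chart_inv c y)) differentiable at (snd c q)"
proof -
  have "smooth_on (snd c ` (fst c \<inter> fst c')) (\<lambda>y. snd c' (chart_inv c y))"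
    using compatible[OF assms(1,2)] by (simp add: compatible_def o_def)
  then show ?thesis using assms by (intro smooth_on_differentiable) auto
qed

text \<open>
  The differential of the parametrization \<open>\<psi>\<close> at \<open>x\<close>.
\<close>

definition push :: "'e \<Rightarrow> 'e \<Rightarrow> ('m, 'e) tangent" where
  "push x v = (\<lambda>c. if c \<in> charts_at A (\<psi> x) then frechet_derivative (out c) (at x) v else 0)"

lemma out_differentiable: "c \<in> charts_at A (\<psi> x) \<Longrightarrow> x \<in> S \<Longrightarrow> out c differentiable (at x)"
  by (meson dom_in_charts_at charts_at_A smooth_on_differentiable smooth_out)

lemma linear_push: "x \<in> S \<Longrightarrow> linear (push x)"
  using linear_frechet_derivative[OF out_differentiable]
  by (auto simp: linear_iff push_def fun_eq_iff scaleR_fun_def)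

lemma push_velocity:
  assumes x: "x \<in> S" and \<gamma>: "\<gamma> 0 = \<psi> x" "eventually (\<lambda>t. \<gamma> t = \<psi> (x + t *\<^sub>R v)) (nhds 0)"
  shows "velocity A \<gamma> = push x v"
proof
  fix c
  show "velocity A \<gamma> c = push x v c"
  proof (cases "c \<in> charts_at A (\<psi> x)")
    case True
    have "((\<lambda>t. x + t *\<^sub>R v) has_vector_derivative v) (at 0)"
      by (auto intro!: derivative_eq_intros)
    moreover have "(out c has_derivative frechet_derivative (out c) (at x)) (at x)"
      using out_differentiable[OF True x] frechet_derivative_works by blast
    ultimately have "((\<lambda>t. out c (x + t *\<^sub>R v)) has_vector_derivative frechet_derivative (out c) (at x) v) (at 0)"
      using vector_derivative_diff_chain_within[of "\<lambda>t. x + t *\<^sub>R v" v 0 UNIV "out c" "frechet_derivative (out c) (at x)"]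
        has_derivative_at_withinI[of "out c" "frechet_derivative (out c) (at x)" x]
      by (simp add: o_def)
    moreover obtain T where T: "open T" "0 \<in> T" "\<And>t. t \<in> T \<Longrightarrow> \<gamma> t = \<psi> (x + t *\<^sub>R v)"
      using \<gamma>(2) by (auto simp: eventually_nhds)
    ultimately have "((\<lambda>t. snd c (\<gamma> t)) has_vector_derivative frechet_derivative (out c) (at x) v) (at 0)"
      using has_vector_derivative_transform_within_open[of "\<lambda>t. out c (x + t *\<^sub>R v)" _ 0 T "\<lambda>t. snd c (\<gamma> t)"]
      by (simp add: out_def)
    then show ?thesis using True \<gamma>(1) by (simp add: velocity_def push_def vector_derivative_at)
  qed (simp add: velocity_def push_def \<gamma>(1))
qed

lemma out_transition:
  assumes x: "x \<in> S" and c: "c \<in> charts_at A (\<psi> x)" "c' \<in> charts_at A (\<psi> x)"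
  shows "frechet_derivative (\<lambda>y. snd c' (chart_inv c y)) (at (snd c (\<psi> x))) (frechet_derivative (out c) (at x) v) =
    frechet_derivative (out c') (at x) v"
proof -
  have cA: "c \<in> A" "c' \<in> A" and q: "\<psi> x \<in> fst c" "\<psi> x \<in> fst c'" using c by (auto simp: charts_at_def)
  have "frechet_derivative (out c') (at x) = frechet_derivative (\<lambda>z. snd c' (chart_inv c (out c z))) (at x)"
  proof (rule frechet_derivative_cong_open)
    show "open (dom_in c)" "x \<in> dom_in c"
      using smooth_on_open[OF smooth_out[OF cA(1)]] dom_in_charts_at[OF c(1) x] by auto
    show "out c' z = snd c' (chart_inv c (out c z))" if "z \<in> dom_in c" for z
      using that chart_inv_left[OF is_chart[OF cA(1)]] by (simp add: out_def dom_in_iff)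
  qed
  also have "\<dots> = (\<lambda>v. frechet_derivative (\<lambda>y. snd c' (chart_inv c y)) (at (out c x)) (frechet_derivative (out c) (at x) v))"
    by (rule frechet_derivative_chain[OF out_differentiable[OF c(1) x]])
      (use transition_differentiable[OF cA q] in \<open>simp add: out_def\<close>)
  finally show ?thesis by (simp add: out_def fun_eq_iff)
qed

lemma push_tangent: "x \<in> S \<Longrightarrow> push x v \<in> tangent_space A (\<psi> x)"
  using out_transition by (auto simp: tangent_space_def push_def o_def)

text \<open>Surjectivity of \<open>push x\<close>: the component in a single chart determines all
  others by the transition rule in \<open>tangent_space\<close>.\<close>

lemma push_back:
  assumes x: "x \<in> S" and c: "c \<in> charts_at A (\<psi> x)" and u: "u \<in> tangent_space A (\<psi> x)"
  shows "push x (frechet_derivative (back c) (at (out c x)) (u c)) = u"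
proof
  fix c'
  have cA: "c \<in> A" using c by (simp add: charts_at_def)
  show "push x (frechet_derivative (back c) (at (out c x)) (u c)) c' = u c'"
  proof (cases "c' \<in> charts_at A (\<psi> x)")
    case True
    have xd: "x \<in> dom_in c" by (rule dom_in_charts_at[OF c x])
    define w where "w = frechet_derivative (back c) (at (out c x)) (u c)"
    have "frechet_derivative (\<lambda>y. out c (back c y)) (at (out c x)) = frechet_derivative (\<lambda>y. y) (at (out c x))"
      by (rule frechet_derivative_cong_open[OF smooth_on_open[OF smooth_back[OF cA]] out_mem[OF xd]])
        (rule out_back[OF cA])
    moreover have "frechet_derivative (\<lambda>y. out c (back c y)) (at (out c x)) =
        (\<lambda>v. frechet_derivative (out c) (at (back c (out c x))) (frechet_derivative (back c) (at (out c x)) v))"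
      by (rule frechet_derivative_chain)
        (use smooth_on_differentiable[OF smooth_out[OF cA] xd] back_out[OF cA xd]
          smooth_on_differentiable[OF smooth_back[OF cA] out_mem[OF xd]] in auto)
    ultimately have "frechet_derivative (out c) (at x) w = u c"
      by (simp add: fun_eq_iff w_def back_out[OF cA xd])
    then have "frechet_derivative (out c') (at x) w =
        frechet_derivative (\<lambda>y. snd c' (chart_inv c y)) (at (snd c (\<psi> x))) (u c)"
      using out_transition[OF x c True, of w] by simp
    also have "\<dots> = u c'"
    proof -
      have "\<forall>c\<in>charts_at A (\<psi> x). \<forall>c'\<in>charts_at A (\<psi> x).
          u c' = frechet_derivative (\<lambda>y. snd c' (chart_inv c y)) (at (snd c (\<psi> x))) (u c)"
        using u unfolding tangent_space_def o_def mem_Collect_eq by (rule conjunct2)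
      from this[rule_format, OF c True] show ?thesis by (rule sym)
    qed
    finally show ?thesis using True by (simp add: push_def w_def)
  next
    case False
    then have "u c' = 0" using u unfolding tangent_space_def mem_Collect_eq by blast
    with False show ?thesis by (simp add: push_def)
  qed
qed

lemma push_inj: 
  assumes "x \<in> S" "push x v = push x w"
  shows "v = w"
proof -
  obtain c where c: "c \<in> charts_at A (\<psi> x)" using charts_at_nonempty[OF assms(1)] by blast
  then have "frechet_derivative (out c) (at x) v = frechet_derivative (out c) (at x) w"
    using fun_cong[OF assms(2), of c] by (simp add: push_def)
  then show ?thesis
    using D_back_out[OF charts_at_A[OF c] dom_in_charts_at[OF c assms(1)]] by metis
qed

definition pull :: "'e \<Rightarrow> ('m, 'e) tangent \<Rightarrow> 'e" where
  "pull x u = (THE v. push x v = u)"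

lemma pull_push:
  assumes "x \<in> S"
  shows "pull x (push x v) = v"
  unfolding pull_def
proof (rule the_equality)
  show "w = v" if "push x w = push x v" for w
    by (rule push_inj[OF assms that])
qed simp

lemma pull_eq:
  assumes "x \<in> S" "c \<in> charts_at A (\<psi> x)" "u \<in> tangent_space A (\<psi> x)"
  shows "pull x u = frechet_derivative (back c) (at (out c x)) (u c)"
  using pull_push[OF assms(1), of "frechet_derivative (back c) (at (out c x)) (u c)"] push_back[OF assms] by simp

lemma push_pull:
  assumes "x \<in> S" "u \<in> tangent_space A (\<psi> x)"
  shows "push x (pull x u) = u"
proof -
  obtain c where c: "c \<in> charts_at A (\<psi> x)" using charts_at_nonempty[OF assms(1)] by blast
  show ?thesis unfolding pull_eq[OF assms(1) c assms(2)] by (rule push_back[OF assms(1) c assms(2)])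
qed

section \<open>Fields, functions and brackets in the chart\<close>

definition rep :: "'e set \<Rightarrow> ('m, 'e) field \<Rightarrow> ('e \<Rightarrow> 'e) \<Rightarrow> bool" where
  "rep T X F \<longleftrightarrow> (\<forall>y\<in>T. X (\<psi> y) = push y (F y))"

definition field :: "('e \<Rightarrow> 'e) \<Rightarrow> ('m, 'e) field" where
  "field F = (\<lambda>q. push (\<kappa> q) (F (\<kappa> q)))"

lemma field_\<psi>: "x \<in> S \<Longrightarrow> field F (\<psi> x) = push x (F x)"
  by (simp add: field_def \<kappa>_\<psi>)

lemma rep_field: "T \<subseteq> S \<Longrightarrow> rep T (field F) F"
  unfolding rep_def using field_\<psi> by blast

lemma smooth_field_rep:
  assumes T: "open T" "T \<subseteq> S" and F: "smooth_on T F" and X: "rep T X F"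
  shows "smooth_field A (\<psi> ` T) X"
  unfolding smooth_field_def
proof (intro conjI ballI)
  show "open (\<psi> ` T)" by (rule chart_open_image[OF is_chart_c0 T[unfolded S_def]])
  show "\<psi> ` T \<subseteq> points A" using T(2) \<psi>_mem c0_points by blast
  show "X q \<in> tangent_space A q" if "q \<in> \<psi> ` T" for q
    using that X T(2) push_tangent by (auto simp: rep_def)
  fix c assume c: "c \<in> A"
  \<comment> \<open>Writes the domain that \<open>smooth_field\<close> prescribes as a preimage
    under \<open>back c\<close>, whose continuity makes it open.\<close>
  have eqs: "snd c ` (\<psi> ` T \<inter> fst c) = (back c) -` T \<inter> dom_out c"
  proof
    show "snd c ` (\<psi> ` T \<inter> fst c) \<subseteq> back c -` T \<inter> dom_out c"
    proof
      fix y assume "y \<in> snd c ` (\<psi> ` T \<inter> fst c)"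
      then obtain x where x: "x \<in> T" "\<psi> x \<in> fst c" "y = out c x" by (auto simp: out_def)
      then have "x \<in> dom_in c" using T(2) by (auto simp: dom_in_iff)
      then show "y \<in> back c -` T \<inter> dom_out c" using x back_out[OF c] out_mem by simp
    qed
    show "back c -` T \<inter> dom_out c \<subseteq> snd c ` (\<psi> ` T \<inter> fst c)"
    proof
      fix y assume y: "y \<in> back c -` T \<inter> dom_out c"
      then have "\<psi> (back c y) \<in> fst c" using back_mem[OF c] by (auto simp: dom_in_iff)
      moreover have "y = snd c (\<psi> (back c y))" using y out_back[OF c] by (auto simp: out_def)
      ultimately show "y \<in> snd c ` (\<psi> ` T \<inter> fst c)" using y by auto
    qed
  qed
  have o: "open (back c -` T \<inter> dom_out c)"
    using continuous_on_open_vimage[OF smooth_on_open[OF smooth_back[OF c]]] smooth_on_continuous[OF smooth_back[OF c]] T(1) by blast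
  have i: "open (T \<inter> dom_in c)" using T(1) smooth_on_open[OF smooth_out[OF c]] by auto
  have g: "smooth_on (T \<inter> dom_in c) (\<lambda>x. frechet_derivative (out c) (at x) (F x))"
    by (rule smooth_on_derivative_field[OF smooth_on_subset[OF smooth_out[OF c] _ i] smooth_on_subset[OF F _ i]]) auto
  have b: "smooth_on (back c -` T \<inter> dom_out c) (back c)"
    by (rule smooth_on_subset[OF smooth_back[OF c] _ o]) auto
  have "smooth_on (back c -` T \<inter> dom_out c) (\<lambda>y. frechet_derivative (out c) (at (back c y)) (F (back c y)))"
    by (rule smooth_on_compose[OF b g]) (use back_mem[OF c] in auto)
  moreover have "frechet_derivative (out c) (at (back c y)) (F (back c y)) = X (chart_inv c y) c"
    if y: "y \<in> back c -` T \<inter> dom_out c" for y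
  proof -
    have "X (\<psi> (back c y)) = push (back c y) (F (back c y))" using X y by (auto simp: rep_def)
    moreover have "\<psi> (back c y) = chart_inv c y" using y \<psi>_back[OF c] by blast
    moreover have "c \<in> charts_at A (\<psi> (back c y))" using c y back_mem[OF c] by (auto simp: charts_at_def dom_in_iff)
    ultimately show ?thesis by (simp add: push_def)
  qed
  ultimately show "smooth_on (snd c ` (\<psi> ` T \<inter> fst c)) (\<lambda>x. X (chart_inv c x) c)"
    unfolding eqs using smooth_on_cong[of "back c -` T \<inter> dom_out c"
        "\<lambda>y. frechet_derivative (out c) (at (back c y)) (F (back c y))" "\<lambda>y. X (chart_inv c y) c"] by blast
qed

definition dom :: "'m set \<Rightarrow> 'e set" where
  "dom V = {x \<in> S. \<psi> x \<in> V}"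

lemma open_dom: "open V \<Longrightarrow> open (dom V)"
proof -
  assume "open V"
  then have "open (\<psi> -` V \<inter> S)"
    using continuous_on_open_vimage[OF open_S, of \<psi>] is_chart_c0 by (simp add: is_chart_def homeomorphism_def S_def)
  moreover have "\<psi> -` V \<inter> S = dom V" by (auto simp: dom_def)
  ultimately show ?thesis by simp
qed

lemma dom_subset: "dom V \<subseteq> S"
  by (auto simp: dom_def)

lemma smooth_pull:
  assumes X: "smooth_field A V X"
  shows "smooth_on (dom V) (\<lambda>x. pull x (X (\<psi> x)))"
proof (rule smooth_on_local)
  fix x assume x: "x \<in> dom V"
  have oV: "open V" and XT: "\<And>q. q \<in> V \<Longrightarrow> X q \<in> tangent_space A q"
    and Xs: "\<And>c. c \<in> A \<Longrightarrow> smooth_on (snd c ` (V \<inter> fst c)) (\<lambda>y. X (chart_inv c y) c)"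
    using X by (auto simp: smooth_field_def)
  obtain c where c: "c \<in> charts_at A (\<psi> x)" using charts_at_nonempty[of x] x unfolding dom_def by blast
  then have cA: "c \<in> A" by (rule charts_at_A)
  let ?T = "dom V \<inter> dom_in c"
  have oT: "open ?T" using open_dom[OF oV] smooth_on_open[OF smooth_out[OF cA]] by auto
  have oW: "open (snd c ` (V \<inter> fst c) \<inter> dom_out c)"
    using smooth_on_open[OF Xs[OF cA]] smooth_on_open[OF smooth_back[OF cA]] by auto
  have g: "smooth_on (snd c ` (V \<inter> fst c) \<inter> dom_out c) (\<lambda>y. frechet_derivative (back c) (at y) (X (chart_inv c y) c))"
    by (rule smooth_on_derivative_field[OF smooth_on_subset[OF smooth_back[OF cA] _ oW] smooth_on_subset[OF Xs[OF cA] _ oW]]) auto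
  have b: "smooth_on ?T (out c)"
    by (rule smooth_on_subset[OF smooth_out[OF cA] _ oT]) auto
  have "smooth_on ?T (\<lambda>x. frechet_derivative (back c) (at (out c x)) (X (chart_inv c (out c x)) c))"
    by (rule smooth_on_compose[OF b g]) (use out_mem[of _ c] in \<open>auto simp: out_def dom_def dom_in_iff\<close>)
  moreover have "frechet_derivative (back c) (at (out c y)) (X (chart_inv c (out c y)) c) = pull y (X (\<psi> y))"
    if y: "y \<in> ?T" for y
  proof -
    have "chart_inv c (out c y) = \<psi> y"
      using y chart_inv_left[OF is_chart[OF cA]] by (auto simp: out_def dom_in_iff)
    moreover have "c \<in> charts_at A (\<psi> y)" using y cA by (auto simp: charts_at_def dom_in_iff)
    ultimately show ?thesis
      using pull_eq[of y c "X (\<psi> y)"] XT[of "\<psi> y"] y by (simp add: dom_def)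
  qed
  ultimately have "smooth_on ?T (\<lambda>y. pull y (X (\<psi> y)))"
    using smooth_on_cong[of ?T "\<lambda>x. frechet_derivative (back c) (at (out c x)) (X (chart_inv c (out c x)) c)"
        "\<lambda>y. pull y (X (\<psi> y))"] by blast
  moreover have "x \<in> ?T" using x dom_in_charts_at[OF c] by (auto simp: dom_def)
  ultimately show "\<exists>T. x \<in> T \<and> T \<subseteq> dom V \<and> smooth_on T (\<lambda>y. pull y (X (\<psi> y)))" by blast
qed

lemma rep_pull:
  assumes "smooth_field A V X"
  shows "rep (dom V) X (\<lambda>x. pull x (X (\<psi> x)))"
  unfolding rep_def
proof
  fix y assume "y \<in> dom V"
  then have "y \<in> S" "X (\<psi> y) \<in> tangent_space A (\<psi> y)"
    using assms unfolding smooth_field_def dom_def by blast+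
  then show "X (\<psi> y) = push y (pull y (X (\<psi> y)))"
    by (rule push_pull[symmetric])
qed

lemma smooth_function_pullback:
  assumes h: "smooth_function A V h"
  shows "smooth_on (dom V) (\<lambda>x. h (\<psi> x))"
proof (rule smooth_on_local)
  fix x assume x: "x \<in> dom V"
  obtain c where c: "c \<in> charts_at A (\<psi> x)" using charts_at_nonempty[of x] x unfolding dom_def by blast
  then have cA: "c \<in> A" by (rule charts_at_A)
  let ?T = "dom V \<inter> dom_in c"
  have oV: "open V" using h by (simp add: smooth_function_def)
  have oT: "open ?T" using open_dom[OF oV] smooth_on_open[OF smooth_out[OF cA]] by auto
  have g: "smooth_on (snd c ` (V \<inter> fst c)) (\<lambda>y. h (chart_inv c y))"
    using h cA by (simp add: smooth_function_def o_def)
  have b: "smooth_on ?T (out c)"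
    by (rule smooth_on_subset[OF smooth_out[OF cA] _ oT]) auto
  have "smooth_on ?T (\<lambda>x. h (chart_inv c (out c x)))"
    by (rule smooth_on_compose[OF b g]) (use out_mem[of _ c] in \<open>auto simp: out_def dom_def dom_in_iff\<close>)
  moreover have "h (chart_inv c (out c y)) = h (\<psi> y)" if "y \<in> ?T" for y
    using that chart_inv_left[OF is_chart[OF cA]] by (auto simp: out_def dom_in_iff)
  ultimately have "smooth_on ?T (\<lambda>y. h (\<psi> y))"
    using smooth_on_cong[of ?T "\<lambda>x. h (chart_inv c (out c x))" "\<lambda>y. h (\<psi> y)"] by blast
  moreover have "x \<in> ?T" using x dom_in_charts_at[OF c] by (auto simp: dom_def)
  ultimately show "\<exists>T. x \<in> T \<and> T \<subseteq> dom V \<and> smooth_on T (\<lambda>y. h (\<psi> y))" by blast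
qed

lemma smooth_function_pushforward:
  assumes T: "open T" "T \<subseteq> S" and h: "smooth_on T h"
  shows "smooth_function A (\<psi> ` T) (\<lambda>q. h (\<kappa> q))"
  unfolding smooth_function_def
proof (intro conjI ballI)
  show "open (\<psi> ` T)" by (rule chart_open_image[OF is_chart_c0 T[unfolded S_def]])
  show "\<psi> ` T \<subseteq> points A" using T(2) \<psi>_mem c0_points by blast
  fix c assume c: "c \<in> A"
  have o: "open (back c -` T \<inter> dom_out c)"
    using continuous_on_open_vimage[OF smooth_on_open[OF smooth_back[OF c]]] smooth_on_continuous[OF smooth_back[OF c]] T(1) by blast
  have "smooth_on (back c -` T \<inter> dom_out c) (\<lambda>y. h (back c y))"
    by (rule smooth_on_compose[OF smooth_on_subset[OF smooth_back[OF c] _ o] h]) auto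
  moreover have "snd c ` (\<psi> ` T \<inter> fst c) \<subseteq> back c -` T \<inter> dom_out c"
  proof
    fix y assume "y \<in> snd c ` (\<psi> ` T \<inter> fst c)"
    then obtain x where x: "x \<in> T" "\<psi> x \<in> fst c" "y = out c x" by (auto simp: out_def)
    then have "x \<in> dom_in c" using T(2) by (auto simp: dom_in_iff)
    then show "y \<in> back c -` T \<inter> dom_out c" using x back_out[OF c] out_mem by simp
  qed
  moreover have "open (snd c ` (\<psi> ` T \<inter> fst c))"
  proof -
    have "smooth_field A (\<psi> ` T) (field (\<lambda>x. 0))"
      by (rule smooth_field_rep[OF T smooth_on_const[OF T(1)] rep_field[OF T(2)]])
    then show ?thesis using c smooth_on_open unfolding smooth_field_def by blast
  qed
  ultimately have "smooth_on (snd c ` (\<psi> ` T \<inter> fst c)) (\<lambda>y. h (back c y))"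
    by (rule smooth_on_subset)
  then show "smooth_on (snd c ` (\<psi> ` T \<inter> fst c)) ((\<lambda>q. h (\<kappa> q)) \<circ> chart_inv c)"
    by (simp add: back_def o_def)
qed

text \<open>The chart behind \<open>dir_deriv\<close> is an arbitrary choice; the chain rule through
  \<open>back c\<close> removes it.\<close>

lemma dir_deriv_push:
  assumes x: "x \<in> S" and h: "(\<lambda>x. h (\<psi> x)) differentiable at x"
  shows "dir_deriv A (\<psi> x) (push x v) h = frechet_derivative (\<lambda>x. h (\<psi> x)) (at x) v"
proof -
  define c where "c = (SOME c. c \<in> charts_at A (\<psi> x))"
  have c: "c \<in> charts_at A (\<psi> x)" unfolding c_def by (rule someI_ex[OF charts_at_nonempty[OF x]])
  then have cA: "c \<in> A" by (rule charts_at_A)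
  have xd: "x \<in> dom_in c" by (rule dom_in_charts_at[OF c x])
  have "frechet_derivative (\<lambda>y. h (chart_inv c y)) (at (out c x)) = frechet_derivative (\<lambda>y. h (\<psi> (back c y))) (at (out c x))"
    by (rule frechet_derivative_cong_open[OF smooth_on_open[OF smooth_back[OF cA]] out_mem[OF xd]])
      (simp add: \<psi>_back[OF cA])
  also have "\<dots> = (\<lambda>v. frechet_derivative (\<lambda>x. h (\<psi> x)) (at (back c (out c x))) (frechet_derivative (back c) (at (out c x)) v))"
    by (rule frechet_derivative_chain)
      (use smooth_on_differentiable[OF smooth_back[OF cA] out_mem[OF xd]] h back_out[OF cA xd] in auto)
  finally have "frechet_derivative (\<lambda>y. h (chart_inv c y)) (at (out c x)) (frechet_derivative (out c) (at x) v) =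
      frechet_derivative (\<lambda>x. h (\<psi> x)) (at x) v"
    by (simp add: D_back_out[OF cA xd] back_out[OF cA xd])
  then show ?thesis
    using c by (simp add: dir_deriv_def Let_def c_def[symmetric] push_def o_def out_def)
qed

text \<open>The bracket is defined in each atlas chart separately. The change of chart adds second
  derivatives of \<open>out c\<close>, which cancel by symmetry.\<close>

lemma lie_bracket_rep:
  assumes T: "open T" "T \<subseteq> S" and F: "smooth_on T F" and G: "smooth_on T G"
    and X: "rep T X F" and Y: "rep T Y G" and x: "x \<in> T"
  shows "lie_bracket A X Y (\<psi> x) = push x (dd T (F x) G x - dd T (G x) F x)"
proof
  fix c
  have xS: "x \<in> S" using x T by blast
  show "lie_bracket A X Y (\<psi> x) c = push x (dd T (F x) G x - dd T (G x) F x) c"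
  proof (cases "c \<in> charts_at A (\<psi> x)")
    case True
    then have cA: "c \<in> A" by (rule charts_at_A)
    have xd: "x \<in> dom_in c" by (rule dom_in_charts_at[OF True xS])
    let ?W = "T \<inter> dom_in c"
    have oW: "open ?W" using T(1) smooth_on_open[OF smooth_out[OF cA]] by auto
    have xW: "x \<in> ?W" using x xd by auto
    have so: "smooth_on ?W (out c)" by (rule smooth_on_subset[OF smooth_out[OF cA] _ oW]) auto
    have o: "open (back c -` T \<inter> dom_out c)"
      using continuous_on_open_vimage[OF smooth_on_open[OF smooth_back[OF cA]]] smooth_on_continuous[OF smooth_back[OF cA]] T(1) by blast
    have ox: "out c x \<in> back c -` T \<inter> dom_out c"
      using x back_out[OF cA xd] out_mem[OF xd] by simp
    have key: "frechet_derivative (\<lambda>y. Y (chart_inv c y) c) (at (out c x)) (frechet_derivative (out c) (at x) v) =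
        dd ?W v (dd ?W (G x) (out c)) x + frechet_derivative (out c) (at x) (dd T v G x)"
      if G: "smooth_on T G" and Y: "rep T Y G" for Y G v
    proof -
      have G': "smooth_on ?W G" by (rule smooth_on_subset[OF G _ oW]) auto
      have e: "Y (chart_inv c y) c = dd ?W (G (back c y)) (out c) (back c y)" if y: "y \<in> back c -` T \<inter> dom_out c" for y
      proof -
        have "Y (\<psi> (back c y)) = push (back c y) (G (back c y))" using Y y by (auto simp: rep_def)
        moreover have "\<psi> (back c y) = chart_inv c y" using y \<psi>_back[OF cA] by blast
        moreover have "c \<in> charts_at A (\<psi> (back c y))" using cA y back_mem[OF cA] by (auto simp: charts_at_def dom_in_iff)
        moreover have "back c y \<in> ?W" using y back_mem[OF cA] by auto
        ultimately show ?thesis by (simp add: push_def dd_eq)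
      qed
      have sK: "smooth_on ?W (\<lambda>z. dd ?W (G z) (out c) z)"
        by (rule smooth_on_family[OF oW G' smooth_on_dd[OF so] linear_dd[OF so]])
      have "frechet_derivative (\<lambda>y. Y (chart_inv c y) c) (at (out c x)) =
          frechet_derivative (\<lambda>y. (\<lambda>z. dd ?W (G z) (out c) z) (back c y)) (at (out c x))"
        by (rule frechet_derivative_cong_open[OF o ox]) (rule e)
      also have "\<dots> = (\<lambda>v. frechet_derivative (\<lambda>z. dd ?W (G z) (out c) z) (at (back c (out c x)))
          (frechet_derivative (back c) (at (out c x)) v))"
        by (rule frechet_derivative_chain)
          (use smooth_on_differentiable[OF smooth_back[OF cA] out_mem[OF xd]]
            smooth_on_differentiable[OF sK xW] back_out[OF cA xd] in auto)
      finally have "frechet_derivative (\<lambda>y. Y (chart_inv c y) c) (at (out c x)) (frechet_derivative (out c) (at x) v) =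
          dd ?W v (\<lambda>z. dd ?W (G z) (out c) z) x"
        by (simp add: D_back_out[OF cA xd] back_out[OF cA xd] dd_eq[OF xW])
      also have "\<dots> = dd ?W v (dd ?W (G x) (out c)) x + dd ?W (dd ?W v G x) (out c) x"
        using dd_family[where \<Lambda> = "\<lambda>z g. dd ?W g (out c) z", OF oW G' smooth_on_dd[OF so] linear_dd[OF so] xW] by simp
      finally show ?thesis by (simp add: dd_eq[OF xW] dd_eq[OF x])
    qed
    have XY: "X (\<psi> x) c = frechet_derivative (out c) (at x) (F x)" "Y (\<psi> x) c = frechet_derivative (out c) (at x) (G x)"
      using X Y x True by (auto simp: rep_def push_def)
    have comm: "dd ?W (F x) (dd ?W (G x) (out c)) x = dd ?W (G x) (dd ?W (F x) (out c)) x"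
      by (simp add: dd_commute[OF so, of "F x"])
    have "lie_bracket A X Y (\<psi> x) c =
        frechet_derivative (\<lambda>y. Y (chart_inv c y) c) (at (out c x)) (frechet_derivative (out c) (at x) (F x))
      - frechet_derivative (\<lambda>y. X (chart_inv c y) c) (at (out c x)) (frechet_derivative (out c) (at x) (G x))"
      using True by (simp add: lie_bracket_def XY out_def)
    also have "\<dots> = frechet_derivative (out c) (at x) (dd T (F x) G x) - frechet_derivative (out c) (at x) (dd T (G x) F x)"
      unfolding key[OF G Y] key[OF F X] comm by simp
    also have "\<dots> = frechet_derivative (out c) (at x) (dd T (F x) G x - dd T (G x) F x)"
      using linear_diff[OF linear_frechet_derivative[OF out_differentiable[OF True xS]]] by simp
    finally show ?thesis using True by (simp add: push_def)
  qed (simp add: lie_bracket_def push_def)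
qed

lemma dir_deriv_coords:
  assumes T: "open T" "T \<subseteq> S" and H: "smooth_on T H" and h: "\<And>y. y \<in> T \<Longrightarrow> h (\<psi> y) = H y" and x: "x \<in> T"
  shows "dir_deriv A (\<psi> x) (push x v) h = dd T v H x"
proof -
  have "(\<lambda>y. h (\<psi> y)) differentiable at x"
    using differentiable_cong_open[OF T(1) x, of "\<lambda>y. h (\<psi> y)" H] h smooth_on_differentiable[OF H x] by blast
  then have "dir_deriv A (\<psi> x) (push x v) h = frechet_derivative (\<lambda>y. h (\<psi> y)) (at x) v"
    using T(2) x by (intro dir_deriv_push) auto
  also have "\<dots> = dd T v H x"
    unfolding dd_eq[OF x] using frechet_derivative_cong_open[OF T(1) x, of "\<lambda>y. h (\<psi> y)" H] h by simp
  finally show ?thesis .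
qed

lemma lie_bracket_const:
  assumes T: "open T" "T \<subseteq> S" and X: "rep T X (\<lambda>_. a)" and Y: "rep T Y (\<lambda>_. b)" and x: "x \<in> T"
  shows "lie_bracket A X Y (\<psi> x) = 0"
proof -
  have "x \<in> S" using x T(2) by blast
  then show ?thesis
    using lie_bracket_rep[OF T smooth_on_const[OF T(1)] smooth_on_const[OF T(1)] X Y x] linear_0[OF linear_push, of x] by simp
qed

end

section \<open>The Christoffel map and the curvature in the chart\<close>

locale connection_chart = coordinate_chart A c0 + affine_connection A nabla
  for A :: "('m::{t2_space,second_countable_topology}, 'e::euclidean_space) chart set" and c0 nabla
begin

definition \<Gamma>0 :: "'e \<Rightarrow> 'e \<Rightarrow> 'e \<Rightarrow> 'e" where
  "\<Gamma>0 x v i = pull x (nabla (\<psi> x) (push x v) (field (\<lambda>_. i)))"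

text \<open>Built from the constant fields along basis vectors, so that linearity in
  \<open>b\<close> holds by construction; that it describes \<open>nabla\<close> on all smooth
  fields is the content of \<open>nabla_rep\<close>.\<close>

definition \<Gamma> :: "'e \<Rightarrow> 'e \<Rightarrow> 'e \<Rightarrow> 'e" where
  "\<Gamma> x v b = (\<Sum>i\<in>Basis. (b \<bullet> i) *\<^sub>R \<Gamma>0 x v i)"

lemma smooth_const_field: "open T \<Longrightarrow> T \<subseteq> S \<Longrightarrow> smooth_field A (\<psi> ` T) (field (\<lambda>_. a))"
  by (rule smooth_field_rep[OF _ _ smooth_on_const rep_field])

lemma nabla_tangent:
  assumes T: "open T" "T \<subseteq> S" and G: "smooth_on T G" "rep T Y G" and x: "x \<in> T"
  shows "nabla (\<psi> x) (push x v) Y \<in> tangent_space A (\<psi> x)"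
proof -
  have "smooth_field A (\<psi> ` T) (\<lambda>q. nabla q (field (\<lambda>_. v) q) Y)"
    by (rule nabla_smooth[OF smooth_const_field[OF T] smooth_field_rep[OF T G]])
  then have "nabla (\<psi> x) (field (\<lambda>_. v) (\<psi> x)) Y \<in> tangent_space A (\<psi> x)"
    using x unfolding smooth_field_def by blast
  then show ?thesis using x T(2) by (simp add: field_\<psi> subset_iff)
qed

lemma push_\<Gamma>0:
  assumes x: "x \<in> S"
  shows "nabla (\<psi> x) (push x v) (field (\<lambda>_. i)) = push x (\<Gamma>0 x v i)"
  unfolding \<Gamma>0_def
  by (rule push_pull[OF x nabla_tangent[OF open_S order_refl smooth_on_const[OF open_S] rep_field[OF order_refl] x], symmetric])

lemma linear_\<Gamma>_right: "linear (\<Gamma> x v)"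
  by (simp add: linear_iff \<Gamma>_def inner_add_left scaleR_add_left sum.distrib scaleR_sum_right)

lemma linear_\<Gamma>0:
  assumes x: "x \<in> S"
  shows "linear (\<lambda>v. \<Gamma>0 x v i)"
proof -
  have sf: "smooth_field A (\<psi> ` S) (field (\<lambda>_. i))" by (rule smooth_const_field[OF open_S order_refl])
  have p: "\<psi> x \<in> \<psi> ` S" using x by blast
  note lp = linear_push[OF x]
  have "push x (\<Gamma>0 x (v + w) i) = push x (\<Gamma>0 x v i + \<Gamma>0 x w i)" for v w
    unfolding linear_add[OF lp] push_\<Gamma>0[OF x, symmetric]
    by (rule nabla_add_vec[OF sf p push_tangent[OF x] push_tangent[OF x]])
  moreover have "push x (\<Gamma>0 x (r *\<^sub>R v) i) = push x (r *\<^sub>R \<Gamma>0 x v i)" for r v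
    unfolding linear_cmul[OF lp] push_\<Gamma>0[OF x, symmetric]
    by (rule nabla_scale_vec[OF sf p push_tangent[OF x]])
  ultimately show ?thesis unfolding linear_iff using push_inj[OF x] by blast
qed

lemma linear_\<Gamma>_left: "x \<in> S \<Longrightarrow> linear (\<lambda>v. \<Gamma> x v b)"
  using linear_\<Gamma>0[of x] by (simp add: linear_iff \<Gamma>_def scaleR_add_right sum.distrib scaleR_sum_right mult.commute)

lemma \<psi>_S: "\<psi> ` S = N"
  using \<psi>_mem \<psi>_\<kappa> \<kappa>_mem by force

lemma dom_N: "dom N = S"
  using \<psi>_mem by (auto simp: dom_def)

lemma smooth_\<Gamma>0: "smooth_on S (\<lambda>x. \<Gamma>0 x v i)"
proof -
  have "smooth_field A N (\<lambda>q. nabla q (field (\<lambda>_. v) q) (field (\<lambda>_. i)))"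
    unfolding \<psi>_S[symmetric] by (intro nabla_smooth smooth_const_field open_S order_refl)
  from smooth_pull[OF this] have "smooth_on S (\<lambda>x. pull x (nabla (\<psi> x) (field (\<lambda>_. v) (\<psi> x)) (field (\<lambda>_. i))))"
    unfolding dom_N .
  then show ?thesis
    using smooth_on_cong[of S "\<lambda>x. pull x (nabla (\<psi> x) (field (\<lambda>_. v) (\<psi> x)) (field (\<lambda>_. i)))" "\<lambda>x. \<Gamma>0 x v i"]
    by (simp add: \<Gamma>0_def field_\<psi>)
qed

lemma smooth_\<Gamma>: "smooth_on S (\<lambda>x. \<Gamma> x v b)"
  unfolding \<Gamma>_def by (intro smooth_on_sum open_S smooth_on_cscaleR smooth_\<Gamma>0)

text \<open>On \<open>T\<close> the field is a combination of constant fields with smooth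
  coefficients; \<open>nabla_local\<close> replaces it by this combination, and the Leibniz rule
  applies to each summand.\<close>

lemma nabla_rep:
  assumes T: "open T" "T \<subseteq> S" and G: "smooth_on T G" and Y: "rep T Y G" and x: "x \<in> T"
  shows "nabla (\<psi> x) (push x v) Y = push x (dd T v G x + \<Gamma> x v (G x))"
proof -
  have xS: "x \<in> S" using x T by blast
  note lp = linear_push[OF xS]
  define g where "g i q = G (\<kappa> q) \<bullet> i" for i q
  define E where "E i = field (\<lambda>_. i)" for i
  have p: "\<psi> x \<in> \<psi> ` T" using x by blast
  have g\<psi>: "g i (\<psi> y) = G y \<bullet> i" if "y \<in> T" for y i
    using that T(2) by (simp add: g_def \<kappa>_\<psi> subset_iff)
  have E\<psi>: "E i (\<psi> y) = push y i" if "y \<in> T" for y i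
    using that T(2) by (simp add: E_def field_\<psi> subset_iff)
  have sg: "smooth_function A (\<psi> ` T) (g i)" for i
    unfolding g_def by (rule smooth_function_pushforward[OF T smooth_on_component[OF G]])
  have sE: "smooth_field A (\<psi> ` T) (E i)" for i
    unfolding E_def by (rule smooth_const_field[OF T])
  have repI: "rep T (\<lambda>q. \<Sum>i\<in>I. g i q *\<^sub>R E i q) (\<lambda>y. \<Sum>i\<in>I. (G y \<bullet> i) *\<^sub>R i)" for I
    unfolding rep_def
  proof
    fix y assume y: "y \<in> T"
    then have l: "linear (push y)" using linear_push T(2) by blast
    show "(\<Sum>i\<in>I. g i (\<psi> y) *\<^sub>R E i (\<psi> y)) = push y (\<Sum>i\<in>I. (G y \<bullet> i) *\<^sub>R i)"
      by (simp add: g\<psi>[OF y] E\<psi>[OF y] linear_sum[OF l] linear_cmul[OF l])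
  qed
  have sI: "smooth_field A (\<psi> ` T) (\<lambda>q. \<Sum>i\<in>I. g i q *\<^sub>R E i q)" for I
  proof (rule smooth_field_rep[OF T _ repI])
    have "smooth_on T (\<lambda>y. (G y \<bullet> i) *\<^sub>R i)" for i
      by (rule smooth_on_scaleR[OF smooth_on_component[OF G] smooth_on_const[OF T(1)]])
    then show "smooth_on T (\<lambda>y. \<Sum>i\<in>I. (G y \<bullet> i) *\<^sub>R i)" by (intro smooth_on_sum T(1))
  qed
  have s1: "smooth_field A (\<psi> ` T) (\<lambda>q. g i q *\<^sub>R E i q)" for i
    using sI[of "{i}"] by simp
  have dg: "dir_deriv A (\<psi> x) (push x v) (g i) = dd T v G x \<bullet> i" for i
  proof -
    have "(\<lambda>y. G y \<bullet> i) differentiable at x"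
      by (rule smooth_on_differentiable[OF smooth_on_component[OF G] x])
    then have "(\<lambda>y. g i (\<psi> y)) differentiable at x"
      using differentiable_cong_open[OF T(1) x, of "\<lambda>y. g i (\<psi> y)" "\<lambda>y. G y \<bullet> i"] g\<psi> by blast
    then have "dir_deriv A (\<psi> x) (push x v) (g i) = frechet_derivative (\<lambda>y. g i (\<psi> y)) (at x) v"
      by (rule dir_deriv_push[OF xS])
    also have "\<dots> = dd T v (\<lambda>y. G y \<bullet> i) x"
      unfolding dd_eq[OF x] using frechet_derivative_cong_open[OF T(1) x, of "\<lambda>y. g i (\<psi> y)" "\<lambda>y. G y \<bullet> i"] g\<psi> by simp
    also have "\<dots> = dd T v G x \<bullet> i"
      by (simp add: dd_bounded_linear[OF bounded_linear_inner_left G])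
    finally show ?thesis .
  qed
  have one: "nabla (\<psi> x) (push x v) (\<lambda>q. g i q *\<^sub>R E i q) =
      push x ((dd T v G x \<bullet> i) *\<^sub>R i) + push x ((G x \<bullet> i) *\<^sub>R \<Gamma>0 x v i)" for i
    unfolding nabla_leibniz[OF sg sE p push_tangent[OF xS]] dg linear_cmul[OF lp] g\<psi>[OF x] E\<psi>[OF x]
    by (simp add: E_def push_\<Gamma>0[OF xS])
  \<comment> \<open>Beginning the induction with one summand avoids a separate argument for the zero
    field.\<close>
  have "nabla (\<psi> x) (push x v) (\<lambda>q. \<Sum>i\<in>I. g i q *\<^sub>R E i q) =
      (\<Sum>i\<in>I. push x ((dd T v G x \<bullet> i) *\<^sub>R i) + push x ((G x \<bullet> i) *\<^sub>R \<Gamma>0 x v i))"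
    if "finite I" "I \<noteq> {}" for I
    using that
  proof (induction I rule: finite_ne_induct)
    case (singleton i) then show ?case by (simp add: one)
  next
    case (insert i I)
    have "nabla (\<psi> x) (push x v) (\<lambda>q. g i q *\<^sub>R E i q + (\<Sum>i\<in>I. g i q *\<^sub>R E i q)) =
        nabla (\<psi> x) (push x v) (\<lambda>q. g i q *\<^sub>R E i q) + nabla (\<psi> x) (push x v) (\<lambda>q. \<Sum>i\<in>I. g i q *\<^sub>R E i q)"
      by (rule nabla_add_field[OF s1 sI p push_tangent[OF xS]])
    moreover have "(\<lambda>q. \<Sum>i\<in>insert i I. g i q *\<^sub>R E i q) = (\<lambda>q. g i q *\<^sub>R E i q + (\<Sum>i\<in>I. g i q *\<^sub>R E i q))"
      by (rule ext) (rule sum.insert[OF insert.hyps(1,3)])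
    ultimately show ?case
      unfolding sum.insert[OF insert.hyps(1,3)] one insert.IH by (simp only: one)
  qed
  from this[of Basis] have "nabla (\<psi> x) (push x v) (\<lambda>q. \<Sum>i\<in>Basis. g i q *\<^sub>R E i q) =
      push x (\<Sum>i\<in>Basis. (dd T v G x \<bullet> i) *\<^sub>R i) + push x (\<Sum>i\<in>Basis. (G x \<bullet> i) *\<^sub>R \<Gamma>0 x v i)"
    by (simp add: sum.distrib linear_sum[OF lp])
  also have "\<dots> = push x (dd T v G x + \<Gamma> x v (G x))"
    by (simp add: euclidean_representation \<Gamma>_def linear_add[OF lp])
  moreover have "nabla (\<psi> x) (push x v) Y = nabla (\<psi> x) (push x v) (\<lambda>q. \<Sum>i\<in>Basis. g i q *\<^sub>R E i q)"
  proof (rule nabla_local[OF smooth_field_rep[OF T G Y] sI p push_tangent[OF xS]])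
    fix q assume "q \<in> \<psi> ` T"
    then obtain y where y: "y \<in> T" "q = \<psi> y" by blast
    then show "Y q = (\<Sum>i\<in>Basis. g i q *\<^sub>R E i q)"
      using Y repI[of Basis] by (simp add: rep_def euclidean_representation)
  qed
  ultimately show ?thesis by simp
qed

definition Rm :: "'e \<Rightarrow> 'e \<Rightarrow> 'e \<Rightarrow> 'e \<Rightarrow> 'e" where
  "Rm x a b c = dd S a (\<lambda>x. \<Gamma> x b c) x - dd S b (\<lambda>x. \<Gamma> x a c) x
     + \<Gamma> x a (\<Gamma> x b c) - \<Gamma> x b (\<Gamma> x a c)"

lemma dd_S: "T \<subseteq> S \<Longrightarrow> x \<in> T \<Longrightarrow> dd S v F x = dd T v F x"
  using dd_eq[of x T v F] dd_eq[of x S v F] by auto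

lemma smooth_\<Gamma>_fields:
  assumes T: "open T" "T \<subseteq> S" and G: "smooth_on T G" and H: "smooth_on T H"
  shows "smooth_on T (\<lambda>y. \<Gamma> y (G y) (H y))"
proof -
  have s: "smooth_on T (\<lambda>y. \<Gamma> y a b)" for a b by (rule smooth_on_subset[OF smooth_\<Gamma> T(2,1)])
  have "smooth_on T (\<lambda>y. \<Gamma> y (G y) b)" for b
    by (rule smooth_on_family[where \<Lambda> = "\<lambda>y g. \<Gamma> y g b", OF T(1) G s]) (use linear_\<Gamma>_left T(2) in blast)
  then show ?thesis
    by (rule smooth_on_family[where \<Lambda> = "\<lambda>y h. \<Gamma> y (G y) h", OF T(1) H _ linear_\<Gamma>_right])
qed

lemma smooth_nabla_coords:
  assumes T: "open T" "T \<subseteq> S" and G: "smooth_on T G" and H: "smooth_on T H"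
  shows "smooth_on T (\<lambda>y. dd T (G y) H y + \<Gamma> y (G y) (H y))"
  by (rule smooth_on_add[OF smooth_on_family[OF T(1) G smooth_on_dd[OF H] linear_dd[OF H]] smooth_\<Gamma>_fields[OF assms]])

lemma rep_nabla:
  assumes T: "open T" "T \<subseteq> S" and H: "smooth_on T H" and Y: "rep T Y G" and Z: "rep T Z H"
  shows "rep T (\<lambda>r. nabla r (Y r) Z) (\<lambda>y. dd T (G y) H y + \<Gamma> y (G y) (H y))"
  using nabla_rep[OF T H Z] Y by (simp add: rep_def)

lemma dd_nabla_coords:
  assumes T: "open T" "T \<subseteq> S" and G: "smooth_on T G" and H: "smooth_on T H" and x: "x \<in> T"
  shows "dd T v (\<lambda>y. dd T (G y) H y + \<Gamma> y (G y) (H y)) x =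
    dd T v (dd T (G x) H) x + dd T (dd T v G x) H x + dd T v (\<lambda>y. \<Gamma> y (G x) (H x)) x
    + \<Gamma> x (dd T v G x) (H x) + \<Gamma> x (G x) (dd T v H x)"
proof -
  have s: "smooth_on T (\<lambda>y. \<Gamma> y a b)" for a b by (rule smooth_on_subset[OF smooth_\<Gamma> T(2,1)])
  have s2: "smooth_on T (\<lambda>y. \<Gamma> y (G y) b)" for b
    by (rule smooth_\<Gamma>_fields[OF T G smooth_on_const[OF T(1)]])
  have l: "linear (\<lambda>g. \<Gamma> y g b)" if "y \<in> T" for y b using that T(2) linear_\<Gamma>_left by blast
  have 1: "dd T v (\<lambda>y. dd T (G y) H y) x = dd T v (dd T (G x) H) x + dd T (dd T v G x) H x"
    using dd_family[where \<Lambda> = "\<lambda>z g. dd T g H z", OF T(1) G smooth_on_dd[OF H] linear_dd[OF H] x] by simp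
  have 2: "dd T v (\<lambda>y. \<Gamma> y (G y) (H y)) x = dd T v (\<lambda>y. \<Gamma> y (G y) (H x)) x + \<Gamma> x (G x) (dd T v H x)"
    by (rule dd_family[where \<Lambda> = "\<lambda>y h. \<Gamma> y (G y) h", OF T(1) H s2 linear_\<Gamma>_right x])
  have 3: "dd T v (\<lambda>y. \<Gamma> y (G y) b) x = dd T v (\<lambda>y. \<Gamma> y (G x) b) x + \<Gamma> x (dd T v G x) b" for b
    by (rule dd_family[where \<Lambda> = "\<lambda>y g. \<Gamma> y g b", OF T(1) G s l x])
  have "dd T v (\<lambda>y. dd T (G y) H y + \<Gamma> y (G y) (H y)) x =
      dd T v (\<lambda>y. dd T (G y) H y) x + dd T v (\<lambda>y. \<Gamma> y (G y) (H y)) x"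
    by (simp add: dd_add smooth_on_family[OF T(1) G smooth_on_dd[OF H] linear_dd[OF H]] smooth_\<Gamma>_fields[OF T G H])
  then show ?thesis unfolding 1 2 3 by simp
qed

text \<open>All derivatives of the fields cancel: second derivatives of \<open>H\<close> by
  symmetry, its first derivatives in pairs, and those of \<open>F\<close> and \<open>G\<close>
  against the bracket term.\<close>

lemma curvature_rep:
  assumes T: "open T" "T \<subseteq> S" and F: "smooth_on T F" and G: "smooth_on T G" and H: "smooth_on T H"
    and X: "rep T X F" and Y: "rep T Y G" and Z: "rep T Z H" and x: "x \<in> T"
  shows "curvature_field A nabla X Y Z (\<psi> x) = push x (Rm x (F x) (G x) (H x))"
proof -
  have xS: "x \<in> S" using x T by blast
  note lp = linear_push[OF xS]
  note lG = linear_\<Gamma>_left[OF xS] and lH = linear_\<Gamma>_right[of x]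
  have Xx: "X (\<psi> x) = push x (F x)" and Yx: "Y (\<psi> x) = push x (G x)" using X Y x by (auto simp: rep_def)
  have n1: "nabla (\<psi> x) (X (\<psi> x)) (\<lambda>r. nabla r (Y r) Z) =
      push x (dd T (F x) (\<lambda>y. dd T (G y) H y + \<Gamma> y (G y) (H y)) x + \<Gamma> x (F x) (dd T (G x) H x + \<Gamma> x (G x) (H x)))"
    unfolding Xx by (rule nabla_rep[OF T smooth_nabla_coords[OF T G H] rep_nabla[OF T H Y Z] x])
  have n2: "nabla (\<psi> x) (Y (\<psi> x)) (\<lambda>r. nabla r (X r) Z) =
      push x (dd T (G x) (\<lambda>y. dd T (F y) H y + \<Gamma> y (F y) (H y)) x + \<Gamma> x (G x) (dd T (F x) H x + \<Gamma> x (F x) (H x)))"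
    unfolding Yx by (rule nabla_rep[OF T smooth_nabla_coords[OF T F H] rep_nabla[OF T H X Z] x])
  let ?w = "dd T (F x) G x - dd T (G x) F x"
  have n3: "nabla (\<psi> x) (lie_bracket A X Y (\<psi> x)) Z = push x (dd T ?w H x + \<Gamma> x ?w (H x))"
    unfolding lie_bracket_rep[OF T F G X Y x] by (rule nabla_rep[OF T H Z x])
  have lH': "dd T (a - b) H x = dd T a H x - dd T b H x" for a b
    using linear_diff[OF linear_dd[OF H]] .
  have "curvature_field A nabla X Y Z (\<psi> x) = push x
      ((dd T (F x) (\<lambda>y. dd T (G y) H y + \<Gamma> y (G y) (H y)) x + \<Gamma> x (F x) (dd T (G x) H x + \<Gamma> x (G x) (H x)))
      - (dd T (G x) (\<lambda>y. dd T (F y) H y + \<Gamma> y (F y) (H y)) x + \<Gamma> x (G x) (dd T (F x) H x + \<Gamma> x (F x) (H x)))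
      - (dd T ?w H x + \<Gamma> x ?w (H x)))"
    unfolding curvature_field_def n1 n2 n3 by (simp add: linear_diff[OF lp])
  also have "\<dots> = push x (Rm x (F x) (G x) (H x))"
    unfolding dd_nabla_coords[OF T G H x] dd_nabla_coords[OF T F H x] Rm_def dd_S[OF T(2) x]
    by (rule arg_cong[of _ _ "push x"]) (simp add: linear_add[OF lH] linear_diff[OF lG] lH' dd_commute[OF H, of "F x"])
  finally show ?thesis .
qed

text \<open>The definite description needs two halves. For arbitrary fields,
  \<open>curvature_rep\<close> applied to their coordinate expressions shows that only values at the
  point matter; constant fields show that the prescribed values are attained.\<close>

lemma curvature_push:
  assumes x: "x \<in> S"
  shows "curvature A nabla (\<psi> x) (push x a) (push x b) (push x c) = push x (Rm x a b c)"
  unfolding curvature_def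
proof (rule the_equality)
  show "\<forall>U X Y Z. \<psi> x \<in> U \<and> smooth_field A U X \<and> smooth_field A U Y \<and> smooth_field A U Z \<and>
     X (\<psi> x) = push x a \<and> Y (\<psi> x) = push x b \<and> Z (\<psi> x) = push x c \<longrightarrow>
     push x (Rm x a b c) = curvature_field A nabla X Y Z (\<psi> x)"
  proof (intro allI impI, elim conjE)
    fix U X Y Z
    assume U: "\<psi> x \<in> U" and X: "smooth_field A U X" and Y: "smooth_field A U Y" and Z: "smooth_field A U Z"
      and e: "X (\<psi> x) = push x a" "Y (\<psi> x) = push x b" "Z (\<psi> x) = push x c"
    have oU: "open (dom U)" using X by (intro open_dom) (simp add: smooth_field_def)
    have xU: "x \<in> dom U" using x U by (simp add: dom_def)
    have "curvature_field A nabla X Y Z (\<psi> x) = push x (Rm x (pull x (X (\<psi> x))) (pull x (Y (\<psi> x))) (pull x (Z (\<psi> x))))"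
      by (rule curvature_rep[OF oU dom_subset smooth_pull[OF X] smooth_pull[OF Y] smooth_pull[OF Z]
            rep_pull[OF X] rep_pull[OF Y] rep_pull[OF Z] xU])
    then show "push x (Rm x a b c) = curvature_field A nabla X Y Z (\<psi> x)"
      by (simp add: e pull_push[OF x])
  qed
next
  fix r
  assume r: "\<forall>U X Y Z. \<psi> x \<in> U \<and> smooth_field A U X \<and> smooth_field A U Y \<and> smooth_field A U Z \<and>
     X (\<psi> x) = push x a \<and> Y (\<psi> x) = push x b \<and> Z (\<psi> x) = push x c \<longrightarrow>
     r = curvature_field A nabla X Y Z (\<psi> x)"
  have s: "smooth_field A (\<psi> ` S) (field (\<lambda>_. a))" for a by (rule smooth_const_field[OF open_S order_refl])
  have "r = curvature_field A nabla (field (\<lambda>_. a)) (field (\<lambda>_. b)) (field (\<lambda>_. c)) (\<psi> x)"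
    using r[rule_format, of "\<psi> ` S" "field (\<lambda>_. a)" "field (\<lambda>_. b)" "field (\<lambda>_. c)"] s x by (simp add: field_\<psi>)
  also have "\<dots> = push x (Rm x a b c)"
    using curvature_rep[OF open_S order_refl smooth_on_const[OF open_S] smooth_on_const[OF open_S] smooth_on_const[OF open_S]
        rep_field[OF order_refl] rep_field[OF order_refl] rep_field[OF order_refl] x] .
  finally show "r = push x (Rm x a b c)" .
qed

end

section \<open>Hermitean symmetric spaces in holomorphic coordinates\<close>

text \<open>Holomorphic coordinates make the complex structure constant: one \<open>J\<close> serves
  for all points of \<open>S\<close>. Its linearity and its square are inherited from
  \<open>I\<close> at the origin.\<close>

locale kaehler_chart = hermitean_locally_symmetric_space A g nabla I + connection_chart A c0 nabla
  for A :: "('m::{t2_space,second_countable_topology}, 'e::euclidean_space) chart set" and c0 g nabla I +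
  fixes J :: "'e \<Rightarrow> 'e" and V :: "'m set" and \<theta> :: "'m \<Rightarrow> real"
  assumes push_J: "x \<in> S \<Longrightarrow> push x (J v) = I (\<psi> x) (push x v)"
    and potential: "local_potential A g I V \<theta>"
    and zero_S: "0 \<in> S" and zero_V: "\<psi> 0 \<in> V"
begin

abbreviation "U \<equiv> dom V"

definition f :: "'e \<Rightarrow> real" where "f x = \<theta> (\<psi> x)"

definition G :: "'e \<Rightarrow> 'e \<Rightarrow> 'e \<Rightarrow> real" where "G x a b = g (\<psi> x) (push x a) (push x b)"

lemma \<psi>_points: "x \<in> S \<Longrightarrow> \<psi> x \<in> points A"
  using \<psi>_mem c0_points by blast

lemma smooth_\<theta>: "smooth_function A V \<theta>"
  using potential by (simp add: local_potential_def)

lemma open_U: "open U"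
  using smooth_\<theta> by (intro open_dom) (simp add: smooth_function_def)

lemma zero_U: "0 \<in> U"
  using zero_S zero_V by (simp add: dom_def)

lemma smooth_f: "smooth_on U f"
  using smooth_function_pullback[OF smooth_\<theta>] by (simp add: f_def[abs_def])

lemma linear_J: "linear J"
proof -
  note p = \<psi>_points[OF zero_S] and t = push_tangent[OF zero_S] and l = linear_push[OF zero_S]
  have "push 0 (J (v + w)) = push 0 (J v + J w)" for v w
    unfolding linear_add[OF l] push_J[OF zero_S] by (rule I_add[OF p t t])
  moreover have "push 0 (J (r *\<^sub>R v)) = push 0 (r *\<^sub>R J v)" for r v
    unfolding linear_cmul[OF l] push_J[OF zero_S] by (rule I_scale[OF p t])
  ultimately show ?thesis unfolding linear_iff using push_inj[OF zero_S] by blast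
qed

lemma J_J: "J (J v) = - v"
  by (rule push_inj[OF zero_S])
    (simp add: push_J[OF zero_S] I_square[OF \<psi>_points[OF zero_S] push_tangent[OF zero_S]] linear_neg[OF linear_push[OF zero_S]])

lemma rep_I: "T \<subseteq> S \<Longrightarrow> rep T X F \<Longrightarrow> rep T (\<lambda>q. I q (X q)) (\<lambda>y. J (F y))"
  unfolding rep_def using push_J by (metis subsetD)

lemma bilinear_G:
  assumes x: "x \<in> S"
  shows "bilinear (G x)"
proof -
  note p = \<psi>_points[OF x] and t = push_tangent[OF x] and l = linear_push[OF x]
  have s: "G x a b = G x b a" for a b unfolding G_def by (rule metric_sym[OF p t t])
  have "linear (\<lambda>a. G x a b)" for b
    by (simp add: linear_iff G_def linear_add[OF l] linear_cmul[OF l] metric_add[OF p t t t] metric_scale[OF p t t])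
  moreover from this have "linear (\<lambda>b. G x a b)" for a using s[of a] by simp
  ultimately show ?thesis by (simp add: bilinear_def)
qed

lemma G_sym: "x \<in> S \<Longrightarrow> G x a b = G x b a"
  unfolding G_def by (rule metric_sym[OF \<psi>_points push_tangent push_tangent])

lemma G_J: "x \<in> S \<Longrightarrow> G x (J a) (J b) = G x a b"
  unfolding G_def push_J by (rule I_orthogonal[OF \<psi>_points push_tangent push_tangent])

lemma G_pos: 
  assumes x: "x \<in> S" and a: "a \<noteq> 0"
  shows "G x a a > 0"
proof -
  have "push x a \<noteq> 0" using push_inj[OF x, of a 0] a linear_0[OF linear_push[OF x]] by auto
  then show ?thesis unfolding G_def by (rule metric_pos[OF \<psi>_points[OF x] push_tangent[OF x]])
qed

definition \<beta> :: "'e \<Rightarrow> 'e \<Rightarrow> complex" where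
  "\<beta> b y = (complex_of_real (dd U b f y) + \<i> * complex_of_real (dd U (J b) f y)) / 2"

lemma dir_deriv_\<theta>: "x \<in> U \<Longrightarrow> dir_deriv A (\<psi> x) (push x v) \<theta> = dd U v f x"
  by (rule dir_deriv_coords[OF open_U dom_subset smooth_f]) (simp_all add: f_def)

lemma del_bar_push: 
  assumes x: "x \<in> U"
  shows "del_bar A I \<theta> (\<psi> x) (push x v) = \<beta> v x"
proof -
  have "x \<in> S" using x dom_subset by blast
  then show ?thesis by (simp add: del_bar_def \<beta>_def dir_deriv_\<theta>[OF x] push_J[symmetric])
qed

lemma smooth_\<beta>: "smooth_on U (\<beta> b)"
proof -
  have "smooth_on U (\<lambda>y. complex_of_real (dd U v f y))" for v
    by (rule smooth_on_bounded_linear[OF bounded_linear_of_real smooth_on_dd[OF smooth_f]])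
  then show ?thesis
    unfolding \<beta>_def[abs_def]
    by (intro smooth_on_bounded_linear[OF bounded_linear_divide] smooth_on_add
        smooth_on_bounded_linear[OF bounded_linear_mult_right])
qed

lemma dd_\<beta>:
  "dd U a (\<beta> b) x = (complex_of_real (dd U a (dd U b f) x) + \<i> * complex_of_real (dd U a (dd U (J b) f) x)) / 2"
proof -
  have s: "smooth_on U (\<lambda>y. complex_of_real (dd U v f y))" for v
    by (rule smooth_on_bounded_linear[OF bounded_linear_of_real smooth_on_dd[OF smooth_f]])
  have s': "smooth_on U (\<lambda>y. \<i> * complex_of_real (dd U v f y))" for v
    by (rule smooth_on_bounded_linear[OF bounded_linear_mult_right s])
  show ?thesis
    unfolding \<beta>_def[abs_def]
      dd_bounded_linear[where M = "\<lambda>z. z / 2", OF bounded_linear_divide smooth_on_add[OF s s']]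
      dd_add[OF s s'] dd_bounded_linear[where M = "\<lambda>z. \<i> * z", OF bounded_linear_mult_right s]
      dd_bounded_linear[where M = complex_of_real, OF bounded_linear_of_real smooth_on_dd[OF smooth_f]] ..
qed

lemma exterior_deriv_coords:
  assumes X: "rep U X (\<lambda>_. a)" and Y: "rep U Y (\<lambda>_. b)" and x: "x \<in> U"
  shows "exterior_deriv A (del_bar A I \<theta>) X Y (\<psi> x) = dd U a (\<beta> b) x - dd U b (\<beta> a) x"
proof -
  have d: "dir_deriv A (\<psi> x) (push x v) (\<lambda>r. del_bar A I \<theta> r (Z r)) = dd U v (\<beta> c) x"
    if Z: "rep U Z (\<lambda>_. c)" for v c Z
  proof (rule dir_deriv_coords[OF open_U dom_subset smooth_\<beta> _ x])
    show "del_bar A I \<theta> (\<psi> y) (Z (\<psi> y)) = \<beta> c y" if "y \<in> U" for y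
      using Z that del_bar_push by (simp add: rep_def)
  qed
  have "x \<in> S" using x dom_subset by blast
  then have "push x 0 = 0" by (rule linear_0[OF linear_push])
  then have "del_bar A I \<theta> (\<psi> x) 0 = \<beta> 0 x" using del_bar_push[OF x, of 0] by simp
  also have "\<dots> = 0"
    using linear_0[OF linear_dd[OF smooth_f]] linear_0[OF linear_J] by (simp add: \<beta>_def)
  finally have 0: "del_bar A I \<theta> (\<psi> x) 0 = 0" .
  have "X (\<psi> x) = push x a" "Y (\<psi> x) = push x b" using X Y x by (simp_all add: rep_def)
  then show ?thesis
    by (simp add: exterior_deriv_def d[OF X] d[OF Y] lie_bracket_const[OF open_U dom_subset X Y x] 0)
qed

text \<open>On constant fields all brackets vanish, and the potential equation reduces to second
  derivatives of \<open>f\<close>, combined into a \<open>J\<close>-invariant form.\<close>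

lemma metric_potential:
  assumes x: "x \<in> U"
  shows "G x a b = (dd U a (dd U b f) x + dd U (J a) (dd U (J b) f) x) / 4"
proof -
  \<comment> \<open>The Kaehler form is \<open>g (I X) Y\<close>, so the value \<open>- J a\<close>
    makes it the metric on \<open>a\<close> and \<open>b\<close>.\<close>
  define X where "X = field (\<lambda>_. - J a)"
  define Y where "Y = field (\<lambda>_. b)"
  have X: "rep U X (\<lambda>_. - J a)" and Y: "rep U Y (\<lambda>_. b)"
    unfolding X_def Y_def by (rule rep_field[OF dom_subset])+
  have IX: "rep U (\<lambda>r. I r (X r)) (\<lambda>_. a)" and IY: "rep U (\<lambda>r. I r (Y r)) (\<lambda>_. J b)"
    using rep_I[OF dom_subset X] rep_I[OF dom_subset Y] by (simp_all add: linear_neg[OF linear_J] J_J)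
  have sX: "smooth_field A (\<psi> ` U) X" "smooth_field A (\<psi> ` U) Y"
    unfolding X_def Y_def by (rule smooth_const_field[OF open_U dom_subset])+
  have UV: "\<psi> ` U \<subseteq> V" by (auto simp: dom_def)
  have "complex_of_real (kaehler_form g I (\<psi> x) (X (\<psi> x)) (Y (\<psi> x))) = \<i> / 2 * del_del_bar A I \<theta> X Y (\<psi> x)"
    using potential sX UV x unfolding local_potential_def by blast
  moreover have "kaehler_form g I (\<psi> x) (X (\<psi> x)) (Y (\<psi> x)) = G x a b"
    using IX Y x by (simp add: kaehler_form_def G_def rep_def)
  moreover have "\<i> / 2 * del_del_bar A I \<theta> X Y (\<psi> x) =
      complex_of_real ((dd U a (dd U b f) x + dd U (J a) (dd U (J b) f) x) / 4)"
    unfolding del_del_bar_def exterior_deriv_coords[OF X Y x] exterior_deriv_coords[OF IX IY x] dd_\<beta>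
      linear_neg[OF linear_J] J_J dd_vec_minus[OF smooth_f] dd_vec_minus[OF smooth_on_dd[OF smooth_f]]
      dd_minus[OF smooth_on_dd[OF smooth_f]]
    by (simp add: complex_eq_iff dd_commute[OF smooth_f, of b a] dd_commute[OF smooth_f, of "J b" "J a"]
        dd_commute[OF smooth_f, of b "J a"] dd_commute[OF smooth_f, of "J b" a])
  ultimately show ?thesis by (metis of_real_eq_iff)
qed

lemma nabla_const:
  assumes x: "x \<in> S"
  shows "nabla (\<psi> x) (push x v) (field (\<lambda>_. a)) = push x (\<Gamma> x v a)"
  using nabla_rep[OF open_S order_refl smooth_on_const[OF open_S] rep_field[OF order_refl] x] by simp

lemma \<Gamma>_sym:
  assumes x: "x \<in> S"
  shows "\<Gamma> x a b = \<Gamma> x b a"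
proof (rule push_inj[OF x])
  have "push x (\<Gamma> x a b) - push x (\<Gamma> x b a) = 0"
    unfolding nabla_const[OF x, symmetric]
    using nabla_torsion_free[OF smooth_const_field[OF open_S order_refl] smooth_const_field[OF open_S order_refl], of "\<psi> x" a b]
      lie_bracket_const[OF open_S order_refl rep_field[OF order_refl] rep_field[OF order_refl] x, of a b] x
    by (simp add: field_\<psi>)
  then show "push x (\<Gamma> x a b) = push x (\<Gamma> x b a)" by simp
qed

lemma \<Gamma>_J:
  assumes x: "x \<in> S"
  shows "\<Gamma> x a (J b) = J (\<Gamma> x a b)"
proof (rule push_inj[OF x])
  have "push x (\<Gamma> x a (J b)) = nabla (\<psi> x) (push x a) (\<lambda>q. I q (field (\<lambda>_. b) q))"
    using nabla_rep[OF open_S order_refl smooth_on_const[OF open_S] rep_I[OF order_refl rep_field[OF order_refl]] x] by simp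
  also have "\<dots> = I (\<psi> x) (push x (\<Gamma> x a b))"
    unfolding nabla_const[OF x, symmetric]
    by (rule I_parallel[OF smooth_const_field[OF open_S order_refl] _ push_tangent[OF x]]) (use x in blast)
  finally show "push x (\<Gamma> x a (J b)) = push x (J (\<Gamma> x a b))" by (simp add: push_J[OF x])
qed

lemma metric_parallel:
  assumes x: "x \<in> U"
  shows "dd U v (\<lambda>x. (dd U a (dd U b f) x + dd U (J a) (dd U (J b) f) x) / 4) x = G x (\<Gamma> x v a) b + G x a (\<Gamma> x v b)"
proof -
  have xS: "x \<in> S" using x dom_subset by blast
  note sf = smooth_const_field[OF open_U dom_subset]
  let ?h = "\<lambda>x. (dd U a (dd U b f) x + dd U (J a) (dd U (J b) f) x) / 4"
  have h: "smooth_on U ?h"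
    by (intro smooth_on_bounded_linear[OF bounded_linear_divide] smooth_on_add smooth_on_dd smooth_f)
  have "dir_deriv A (\<psi> x) (push x v) (\<lambda>q. g q (field (\<lambda>_. a) q) (field (\<lambda>_. b) q)) = dd U v ?h x"
  proof (rule dir_deriv_coords[OF open_U dom_subset h _ x])
    fix y assume y: "y \<in> U"
    then have "y \<in> S" using dom_subset by blast
    then show "g (\<psi> y) (field (\<lambda>_. a) (\<psi> y)) (field (\<lambda>_. b) (\<psi> y)) = ?h y"
      using metric_potential[OF y, of a b] by (simp add: field_\<psi> G_def)
  qed
  moreover have "dir_deriv A (\<psi> x) (push x v) (\<lambda>q. g q (field (\<lambda>_. a) q) (field (\<lambda>_. b) q)) =
      G x (\<Gamma> x v a) b + G x a (\<Gamma> x v b)"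
    using nabla_metric[OF sf[of a] sf[of b] _ push_tangent[OF xS, of v]] x
    by (simp add: nabla_const[OF xS] field_\<psi>[OF xS] G_def)
  ultimately show ?thesis by simp
qed

lemma smooth_Rm: "smooth_on S (\<lambda>x. Rm x a b c)"
  unfolding Rm_def
  by (intro smooth_on_diff smooth_on_add smooth_on_dd smooth_\<Gamma> smooth_\<Gamma>_fields[OF open_S order_refl] smooth_on_const open_S)

text \<open>\<open>curvature_parallel\<close> evaluated on constant fields, whose covariant
  derivatives are the \<open>\<Gamma>\<close>-terms.\<close>

lemma Rm_parallel:
  assumes x: "x \<in> S"
  shows "dd S v (\<lambda>x. Rm x a b c) x + \<Gamma> x v (Rm x a b c) =
    Rm x (\<Gamma> x v a) b c + Rm x a (\<Gamma> x v b) c + Rm x a b (\<Gamma> x v c)"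
proof (rule push_inj[OF x])
  note l = linear_push[OF x]
  note S = open_S order_refl
  note c = smooth_on_const[OF open_S]
  have r: "rep S (field (\<lambda>_. d)) (\<lambda>_. d)" for d by (rule rep_field[OF order_refl])
  have r': "rep S (\<lambda>q. nabla q (field (\<lambda>_. v) q) (field (\<lambda>_. d))) (\<lambda>y. \<Gamma> y v d)" for d
    using nabla_const field_\<psi> by (simp add: rep_def)
  let ?R = "curvature_field A nabla (field (\<lambda>_. a)) (field (\<lambda>_. b)) (field (\<lambda>_. c))"
  have R: "rep S ?R (\<lambda>x. Rm x a b c)"
    unfolding rep_def using curvature_rep[OF S c c c r r r] by blast
  have "nabla (\<psi> x) (field (\<lambda>_. v) (\<psi> x)) ?R = push x (dd S v (\<lambda>x. Rm x a b c) x + \<Gamma> x v (Rm x a b c))"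
    unfolding field_\<psi>[OF x] by (rule nabla_rep[OF S smooth_Rm R x])
  moreover have "nabla (\<psi> x) (field (\<lambda>_. v) (\<psi> x)) ?R =
      push x (Rm x (\<Gamma> x v a) b c) + push x (Rm x a (\<Gamma> x v b) c) + push x (Rm x a b (\<Gamma> x v c))"
    unfolding curvature_rep[OF S smooth_\<Gamma> c c r' r r x, symmetric] curvature_rep[OF S c smooth_\<Gamma> c r r' r x, symmetric]
      curvature_rep[OF S c c smooth_\<Gamma> r r r' x, symmetric]
    by (rule curvature_parallel) (use smooth_const_field[OF S] x in auto)
  ultimately show "push x (dd S v (\<lambda>x. Rm x a b c) x + \<Gamma> x v (Rm x a b c)) =
      push x (Rm x (\<Gamma> x v a) b c + Rm x a (\<Gamma> x v b) c + Rm x a b (\<Gamma> x v c))"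
    by (simp add: linear_add[OF l])
qed

section \<open>From the normal form of the potential to its Taylor series\<close>

lemma symmetric_jet:
  assumes \<beta>: "\<And>m. \<exists>\<beta>. (\<forall>k l. polynomial_function (\<beta> k l) \<and>
        (\<forall>X. ((\<lambda>t. \<beta> k l (X + t *\<^sub>R J X)) has_vector_derivative \<i> * (of_nat k - of_nat l) * \<beta> k l X) (at 0))) \<and>
        (\<forall>X. complex_of_real ((dd U X ^^ m) f 0 / fact m - (if m = 2 then G 0 X X else 0)) =
          (\<Sum>(k, l) | k + l = m \<and> 2 \<le> k \<and> 2 \<le> l. \<beta> k l X))"
  shows "symmetric_kaehler_jet U J (G 0) f \<Gamma>"
proof -
  have US: "x \<in> S" if "x \<in> U" for x using that dom_subset by blast
  interpret K: kaehler_jet U J "G 0" f \<Gamma>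
  proof (rule kaehler_jet.intro)
    show "smooth_on U (\<lambda>x. \<Gamma> x a b)" for a b by (rule smooth_on_subset[OF smooth_\<Gamma> dom_subset open_U])
    show "bilinear (\<Gamma> x)" if "x \<in> U" for x
      using linear_\<Gamma>_left[OF US[OF that]] linear_\<Gamma>_right by (simp add: bilinear_def)
    show "(dd U a (dd U b f) 0 + dd U (J a) (dd U (J b) f) 0) / 4 = G 0 a b" for a b
      by (rule metric_potential[OF zero_U, symmetric])
    show "0 < (dd U a (dd U a f) x + dd U (J a) (dd U (J a) f) x) / 4" if "x \<in> U" "a \<noteq> 0" for x a
      unfolding metric_potential[OF that(1), symmetric] by (rule G_pos[OF US[OF that(1)] that(2)])
    show "dd U v (\<lambda>x. (dd U a (dd U b f) x + dd U (J a) (dd U (J b) f) x) / 4) x =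
        (dd U (\<Gamma> x v a) (dd U b f) x + dd U (J (\<Gamma> x v a)) (dd U (J b) f) x) / 4
      + (dd U a (dd U (\<Gamma> x v b) f) x + dd U (J a) (dd U (J (\<Gamma> x v b)) f) x) / 4" if "x \<in> U" for x v a b
      unfolding metric_parallel[OF that] metric_potential[OF that] ..
    show "(wd U J ((*) \<i>) 1 X ^^ k) ((wd U J ((*) \<i>) (- 1) X ^^ l) (\<lambda>x. complex_of_real (f x))) 0 = 0"
      if "k < 2 \<or> l < 2" "(k, l) \<noteq> (1, 1)" for k l X
      by (rule jets_of_weights[OF open_U zero_U linear_J J_J smooth_f G_J[OF zero_S] bilinear_G[OF zero_S] G_sym[OF zero_S] \<beta> that])
  qed (rule open_U zero_U linear_J J_J smooth_f bilinear_G[OF zero_S] G_sym[OF zero_S] G_pos[OF zero_S] G_J[OF zero_S]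
      \<Gamma>_sym[OF US] \<Gamma>_J[OF US] | assumption)+
  \<comment> \<open>The two curvature expressions differ only in the set, \<open>U\<close> or
    \<open>S\<close>, outside which derivatives are cut off.\<close>
  have R: "K.Rm x a b c = Rm x a b c" if "x \<in> U" for x a b c
    unfolding K.Rm_def Rm_def dd_S[OF dom_subset that] ..
  show ?thesis
  proof
    fix x v a b c assume x: "x \<in> U"
    have "dd U v (\<lambda>x. K.Rm x a b c) x = dd S v (\<lambda>x. Rm x a b c) x"
      using dd_cong[OF open_U, of "\<lambda>x. K.Rm x a b c" "\<lambda>x. Rm x a b c" v] R by (simp add: dd_S[OF dom_subset x])
    then show "dd U v (\<lambda>x. K.Rm x a b c) x + \<Gamma> x v (K.Rm x a b c) =
        K.Rm x (\<Gamma> x v a) b c + K.Rm x a (\<Gamma> x v b) c + K.Rm x a b (\<Gamma> x v c)"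
      using Rm_parallel[OF US[OF x]] R[OF x] by simp
  qed
qed

lemma taylor_log_potential:
  assumes \<beta>: "\<And>m. \<exists>\<beta>. (\<forall>k l. polynomial_function (\<beta> k l) \<and>
        (\<forall>X. ((\<lambda>t. \<beta> k l (X + t *\<^sub>R J X)) has_vector_derivative \<i> * (of_nat k - of_nat l) * \<beta> k l X) (at 0))) \<and>
        (\<forall>X. complex_of_real ((dd U X ^^ m) f 0 / fact m - (if m = 2 then G 0 X X else 0)) =
          (\<Sum>(k, l) | k + l = m \<and> 2 \<le> k \<and> 2 \<le> l. \<beta> k l X))"
  shows "(dd U X ^^ m) f 0 / fact m = log_potential A g nabla I (\<psi> 0) m (push 0 X)"
proof -
  interpret K: symmetric_kaehler_jet U J "G 0" f \<Gamma> by (rule symmetric_jet[OF \<beta>])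
  note l = linear_push[OF zero_S]
  have R: "K.Rm 0 a b c = Rm 0 a b c" for a b c
    unfolding K.Rm_def Rm_def dd_S[OF dom_subset zero_U] ..
  have "push 0 (((\<lambda>y. (1/4) *\<^sub>R Rm 0 (J X) y (J X)) ^^ k) X) =
      ((\<lambda>B. (1 / 4) *\<^sub>R ad_sq A nabla (\<psi> 0) (I (\<psi> 0) (push 0 X)) B) ^^ k) (push 0 X)" for k
  proof (induction k)
    case (Suc k)
    then show ?case
      by (simp add: linear_cmul[OF l] curvature_push[OF zero_S, symmetric] push_J[OF zero_S] ad_sq_def)
  qed simp
  then show ?thesis
    unfolding K.taylor_f R by (simp add: log_potential_def G_def linear_cmul[OF l])
qed

end

text \<open>The inverse of the normal coordinates, read through a frame \<open>L\<close> of the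
  tangent space, is a chart compatible with the atlas, and the potential expressed in it has the
  normalised jets.\<close>

theorem corollary5p4:
  fixes A :: "('m::{t2_space,second_countable_topology}, 'e::euclidean_space) chart set"
    and g :: "'m \<Rightarrow> ('m, 'e) tangent \<Rightarrow> ('m, 'e) tangent \<Rightarrow> real"
    and nabla :: "'m \<Rightarrow> ('m, 'e) tangent \<Rightarrow> ('m, 'e) field \<Rightarrow> ('m, 'e) tangent"
    and I :: "'m \<Rightarrow> ('m, 'e) tangent \<Rightarrow> ('m, 'e) tangent"
    and p :: 'm
    and \<Theta> :: "nat \<Rightarrow> ('m, 'e) tangent \<Rightarrow> real"
  assumes "hermitean_locally_symmetric_space A g nabla I"
    and "p \<in> points A"
    and "kaehler_normal_potential A g I p \<Theta>"
  shows "\<forall>X\<in>tangent_space A p. \<forall>m. \<Theta> m X = log_potential A g nabla I p m X"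
proof -
  interpret M: hermitean_locally_symmetric_space A g nabla I by (rule assms(1))
  obtain W \<phi> V \<theta> where anchored: "anchored_coordinates A p W \<phi>" and hol: "holomorphic_coordinates A I p W \<phi>"
    and pV: "p \<in> V" and pot: "local_potential A g I V \<theta>"
    and normal: "(\<lambda>m X. taylor_series (\<theta> \<circ> \<phi>) m X - (if m = 2 then g p X X else 0)) \<in> Sym_ge22 A I p"
    and \<Theta>: "\<And>m X. X \<in> tangent_space A p \<Longrightarrow> \<Theta> m X = taylor_series (\<theta> \<circ> \<phi>) m X"
    using assms(3) unfolding kaehler_normal_potential_def kaehler_normal_coordinates_def by blast
  have W: "W \<subseteq> tangent_space A p" "0 \<in> W" and inj: "inj_on \<phi> W" and \<phi>W: "\<phi> ` W \<subseteq> points A"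
    and \<phi>0: "\<phi> 0 = p" and vel: "\<And>X. X \<in> tangent_space A p \<Longrightarrow> velocity A (\<lambda>t. \<phi> (t *\<^sub>R X)) = X"
    using anchored unfolding anchored_coordinates_def by blast+
  obtain L where L: "tangent_frame A p L"
    and c0: "is_chart (\<phi> ` W, inv L \<circ> inv_into W \<phi>)" "\<And>c. c \<in> A \<Longrightarrow> compatible (\<phi> ` W, inv L \<circ> inv_into W \<phi>) c"
    using anchored unfolding anchored_coordinates_def Let_def by blast
  have lL: "linear L" and iL: "inj L" and rL: "range L = tangent_space A p"
    using L by (simp_all add: tangent_frame_def)
  have Lt: "L v \<in> tangent_space A p" for v using rL by blast
  have Linv: "L (inv L u) = u" if "u \<in> tangent_space A p" for u
    using that rL by (simp add: f_inv_into_f)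
  define c0 where "c0 = (\<phi> ` W, inv L \<circ> inv_into W \<phi>)"
  interpret connection_chart A c0 nabla
    by unfold_locales (use c0 \<phi>W in \<open>simp_all add: c0_def\<close>)
  have N: "N = \<phi> ` W" and \<kappa>: "\<kappa> (\<phi> w) = inv L w" if "w \<in> W" for w
    using inv_into_f_f[OF inj that] by (simp_all add: c0_def)
  have LS: "L x \<in> W" and \<psi>L: "\<psi> x = \<phi> (L x)" if x: "x \<in> S" for x
  proof -
    obtain w where w: "w \<in> W" "\<psi> x = \<phi> w" using \<psi>_mem[OF x] N[OF W(2)] by blast
    then have "L x = w" using \<kappa>_\<psi>[OF x] \<kappa>[OF w(1)] Linv W(1) by auto
    then show "L x \<in> W" "\<psi> x = \<phi> (L x)" using w by simp_all
  qed
  have "\<kappa> (\<phi> 0) = 0" using \<kappa>[OF W(2)] inv_f_f[OF iL, of 0] linear_0[OF lL] by simp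
  then have zero_S: "0 \<in> S" using \<kappa>_mem[of "\<phi> 0"] N[OF W(2)] W(2) by simp
  have \<psi>0: "\<psi> 0 = p" using \<psi>L[OF zero_S] linear_0[OF lL] \<phi>0 by simp
  \<comment> \<open>The differential \<open>push\<close> gives the velocities of coordinate lines;
    the velocity conditions on anchored and holomorphic coordinates thereby become statements about
    \<open>push\<close>.\<close>
  have push: "velocity A (\<lambda>t. \<phi> (L x + t *\<^sub>R L v)) = push x v" if x: "x \<in> S" for x v
  proof (rule push_velocity[OF x])
    have "open ((\<lambda>t. x + t *\<^sub>R v) -` S)" by (intro open_vimage open_S continuous_intros)
    then have "eventually (\<lambda>t. t \<in> (\<lambda>t. x + t *\<^sub>R v) -` S) (nhds 0)" by (rule eventually_nhds_in_open) (simp add: x)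
    then show "eventually (\<lambda>t. \<phi> (L x + t *\<^sub>R L v) = \<psi> (x + t *\<^sub>R v)) (nhds 0)"
      by (rule eventually_mono) (simp add: \<psi>L linear_add[OF lL] linear_cmul[OF lL])
  qed (simp add: \<psi>L[OF x])
  \<comment> \<open>The coordinates have the identity as differential at 0, so over the origin
    \<open>push\<close> is the frame itself.\<close>
  have push0: "push 0 v = L v" for v
    using push[OF zero_S, of v] vel[OF Lt, of v] linear_0[OF lL] by simp
  define J where "J v = inv L (I p (L v))" for v
  have LJ: "L (J v) = I p (L v)" for v
    unfolding J_def by (rule Linv[OF M.I_tangent[OF assms(2) Lt]])
  interpret kaehler_chart A c0 g nabla I J V \<theta>
  proof
    show "push x (J v) = I (\<psi> x) (push x v)" if x: "x \<in> S" for x v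
      using hol LS[OF x] Lt[of v]
      by (simp add: holomorphic_coordinates_def push[OF x, symmetric] LJ \<psi>L[OF x])
  qed (use pot zero_S \<psi>0 pV in simp_all)
  have taylor: "taylor_series (\<theta> \<circ> \<phi>) m (L X) = (dd U X ^^ m) f 0 / fact m" for m X
  proof -
    have "(deriv ^^ m) (\<lambda>t. (\<theta> \<circ> \<phi>) (t *\<^sub>R L X)) 0 = (dd U X ^^ m) f (0 *\<^sub>R X)"
    proof (rule deriv_funpow_line[OF smooth_f])
      show "(\<theta> \<circ> \<phi>) (t *\<^sub>R L X) = f (t *\<^sub>R X)" if "t *\<^sub>R X \<in> U" for t
        using \<psi>L[of "t *\<^sub>R X"] that by (simp add: f_def linear_cmul[OF lL] dom_def)
    qed (simp add: zero_U)
    then show ?thesis by (simp add: taylor_series_def)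
  qed
  have weights: "\<exists>\<beta>. (\<forall>k l. polynomial_function (\<beta> k l) \<and>
        (\<forall>X. ((\<lambda>t. \<beta> k l (X + t *\<^sub>R J X)) has_vector_derivative \<i> * (of_nat k - of_nat l) * \<beta> k l X) (at 0))) \<and>
        (\<forall>X. complex_of_real ((dd U X ^^ m) f 0 / fact m - (if m = 2 then G 0 X X else 0)) =
          (\<Sum>(k, l) | k + l = m \<and> 2 \<le> k \<and> 2 \<le> l. \<beta> k l X))" for m
  proof -
    obtain \<beta> where \<beta>: "\<And>k l. \<beta> k l \<in> Sym A I p k l"
      and sum: "\<And>X. X \<in> tangent_space A p \<Longrightarrow> complex_of_real (taylor_series (\<theta> \<circ> \<phi>) m X - (if m = 2 then g p X X else 0)) =
        (\<Sum>(k, l) | k + l = m \<and> 2 \<le> k \<and> 2 \<le> l. \<beta> k l X)"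
      using normal unfolding Sym_ge22_def by blast
    have poly: "polynomial_function (\<lambda>X. \<beta> k l (L X))" for k l
      using \<beta>[of k l] L by (simp add: Sym_def o_def)
    have deriv: "((\<lambda>t. \<beta> k l (L (X + t *\<^sub>R J X))) has_vector_derivative \<i> * (of_nat k - of_nat l) * \<beta> k l (L X)) (at 0)" for k l X
      using \<beta>[of k l] Lt[of X] by (simp add: Sym_def linear_add[OF lL] linear_cmul[OF lL] LJ)
    have s: "complex_of_real ((dd U X ^^ m) f 0 / fact m - (if m = 2 then G 0 X X else 0)) =
        (\<Sum>(k, l) | k + l = m \<and> 2 \<le> k \<and> 2 \<le> l. \<beta> k l (L X))" for X
      using sum[OF Lt, of X] unfolding taylor G_def \<psi>0 push0 .
    show ?thesis
      by (rule exI[of _ "\<lambda>k l X. \<beta> k l (L X)"]) (intro conjI allI poly deriv s)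
  qed
  show ?thesis
  proof (intro ballI allI)
    fix X m assume X: "X \<in> tangent_space A p"
    then obtain v where v: "X = L v" using rL by blast
    show "\<Theta> m X = log_potential A g nabla I p m X"
      using \<Theta>[OF X, of m] taylor_log_potential[where X = v and m = m, OF weights] by (simp add: v taylor \<psi>0 push0)
  qed
qed

end
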